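(* Let $f\colon X\to Y$ be a continuous map between locally connected topological spaces such that $\pi_X^{-1}$ and $\pi_Y^{-1}$ have left adjoints $\mathbb{L}(X,-)$ and $\mathbb{L}(Y,-)$. For any $F\in D(Y)$ one has a natural morphism $$f_*\colon\mathbb{L}(X,f^{-1}F)\to\mathbb{L}(Y,F),$$ hence morphisms $f_*\colon H_i(X,f^{-1}F)\to H_i(Y,F)$. For any continuous maps $X\xrightarrow{f}Y\xrightarrow{g}Z$ between such spaces one has $(g\circ f)_*=g_*\circ f_*$ and, for any such $X$, $(\operatorname{Id}_X)_*=\operatorname{Id}$.
   Context: $D(X)$ is the unbounded derived category of sheaves of abelian groups on $X$, $D(\mathbb{Z})$ that of abelian groups, $\pi_X\colon X\to\{*\}$ the projection, $\pi_X^{-1}\colon D(\mathbb{Z})\to D(X)$ the inverse image; $\mathbb{L}(X,-)$ denotes its left adjoint, and $H_i(X,F):=H^{-i}(\mathbb{L}(X,F))$. The morphism $f_*$ is the one corresponding by Yoneda and adjunction to the inverse image map $\operatorname{Hom}_{D(Y)}(F,\pi_Y^{-1}G)\to\operatorname{Hom}_{D(X)}(f^{-1}F,f^{-1}\pi_Y^{-1}G)=\operatorname{Hom}_{D(X)}(f^{-1}F,\pi_X^{-1}G)$, for $G\in D(\mathbb{Z})$. In $(g\circ f)_*=g_*\circ f_*$, for $F\in D(Z)$, the morphism $f_*$ is the one for the complex $g^{-1}F\in D(Y)$, and $f^{-1}g^{-1}=(g\circ f)^{-1}$. *)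

theory Defs
  imports "HOL-Analysis.Analysis" "HOL-Algebra.Coset"
begin

section \<open>Categories, functors, adjunctions\<close>

text \<open>
  Morphisms do not remember their source and target, so composition takes the three objects
  as arguments: \<open>Cmp C A B D g f\<close> is the composite of \<open>f : A \<rightarrow> B\<close> and \<open>g : B \<rightarrow> D\<close>.
\<close>

record ('o, 'm) category =
  Ob :: "'o set"
  Mor :: "'o \<Rightarrow> 'o \<Rightarrow> 'm set"
  Idn :: "'o \<Rightarrow> 'm"
  Cmp :: "'o \<Rightarrow> 'o \<Rightarrow> 'o \<Rightarrow> 'm \<Rightarrow> 'm \<Rightarrow> 'm"

record ('o, 'm) zcategory = "('o, 'm) category" +
  Zmor :: "'o \<Rightarrow> 'o \<Rightarrow> 'm"

definition is_inverse ::
    "('o, 'm, 'z) category_scheme \<Rightarrow> 'o \<Rightarrow> 'o \<Rightarrow> 'm \<Rightarrow> 'm \<Rightarrow> bool" where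
  "is_inverse C A B f g \<longleftrightarrow> f \<in> Mor C A B \<and> g \<in> Mor C B A \<and>
     Cmp C A B A g f = Idn C A \<and> Cmp C B A B f g = Idn C B"

definition is_iso :: "('o, 'm, 'z) category_scheme \<Rightarrow> 'o \<Rightarrow> 'o \<Rightarrow> 'm \<Rightarrow> bool" where
  "is_iso C A B f \<longleftrightarrow> (\<exists>g. is_inverse C A B f g)"

definition inverse_mor :: "('o, 'm, 'z) category_scheme \<Rightarrow> 'o \<Rightarrow> 'o \<Rightarrow> 'm \<Rightarrow> 'm" where
  "inverse_mor C A B f = (THE g. is_inverse C A B f g)"

record ('o1, 'm1, 'o2, 'm2) funct =
  FOb :: "'o1 \<Rightarrow> 'o2"
  FMor :: "'o1 \<Rightarrow> 'o1 \<Rightarrow> 'm1 \<Rightarrow> 'm2"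

definition is_functor ::
    "('o1, 'm1, 'z1) category_scheme \<Rightarrow> ('o2, 'm2, 'z2) category_scheme \<Rightarrow>
     ('o1, 'm1, 'o2, 'm2, 'z) funct_scheme \<Rightarrow> bool" where
  "is_functor C D T \<longleftrightarrow>
     (\<forall>A\<in>Ob C. FOb T A \<in> Ob D) \<and>
     (\<forall>A\<in>Ob C. \<forall>B\<in>Ob C. \<forall>f\<in>Mor C A B. FMor T A B f \<in> Mor D (FOb T A) (FOb T B)) \<and>
     (\<forall>A\<in>Ob C. FMor T A A (Idn C A) = Idn D (FOb T A)) \<and>
     (\<forall>A\<in>Ob C. \<forall>B\<in>Ob C. \<forall>E\<in>Ob C. \<forall>f\<in>Mor C A B. \<forall>g\<in>Mor C B E.
        FMor T A E (Cmp C A B E g f) =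
        Cmp D (FOb T A) (FOb T B) (FOb T E) (FMor T B E g) (FMor T A B f))"

definition comp_funct ::
    "('o2, 'm2, 'o3, 'm3) funct \<Rightarrow> ('o1, 'm1, 'o2, 'm2) funct \<Rightarrow> ('o1, 'm1, 'o3, 'm3) funct" where
  "comp_funct S T =
     \<lparr> FOb = (\<lambda>A. FOb S (FOb T A)),
       FMor = (\<lambda>A B f. FMor S (FOb T A) (FOb T B) (FMor T A B f)) \<rparr>"

text \<open>
  A left adjoint of \<open>R : D \<rightarrow> C\<close>: the functor \<open>L : C \<rightarrow> D\<close> together with the adjunction bijections
  \<open>Adj L A B : Hom\<^sub>D(L A, B) \<rightarrow> Hom\<^sub>C(A, R B)\<close>.
\<close>

record ('o1, 'm1, 'o2, 'm2) ladjoint = "('o1, 'm1, 'o2, 'm2) funct" +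
  Adj :: "'o1 \<Rightarrow> 'o2 \<Rightarrow> 'm2 \<Rightarrow> 'm1"

definition is_left_adjoint ::
    "('o1, 'm1, 'z1) category_scheme \<Rightarrow> ('o2, 'm2, 'z2) category_scheme \<Rightarrow>
     ('o2, 'm2, 'o1, 'm1) funct \<Rightarrow> ('o1, 'm1, 'o2, 'm2) ladjoint \<Rightarrow> bool" where
  "is_left_adjoint C D R L \<longleftrightarrow>
     is_functor C D L \<and>
     (\<forall>A\<in>Ob C. \<forall>B\<in>Ob D. bij_betw (Adj L A B) (Mor D (FOb L A) B) (Mor C A (FOb R B))) \<and>
     (\<forall>A'\<in>Ob C. \<forall>A\<in>Ob C. \<forall>B\<in>Ob D. \<forall>a\<in>Mor C A' A. \<forall>u\<in>Mor D (FOb L A) B.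
        Adj L A' B (Cmp D (FOb L A') (FOb L A) B u (FMor L A' A a)) =
        Cmp C A' A (FOb R B) (Adj L A B u) a) \<and>
     (\<forall>A\<in>Ob C. \<forall>B\<in>Ob D. \<forall>B'\<in>Ob D. \<forall>b\<in>Mor D B B'. \<forall>u\<in>Mor D (FOb L A) B.
        Adj L A B' (Cmp D (FOb L A) B B' b u) =
        Cmp C A (FOb R B) (FOb R B') (FMor R B B' b) (Adj L A B u))"


section \<open>Localization of a category at a class of morphisms\<close>

text \<open>
  The Gabriel--Zisman construction.  A zigzag from \<open>A\<close> is a list of steps, each of which records
  the object it arrives at: \<open>Fwd f B\<close> runs along a morphism \<open>f\<close> into \<open>B\<close>, and \<open>Bwd w B\<close> runs
  backwards along a morphism \<open>w\<close> of \<open>W\<close> out of \<open>B\<close>.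
\<close>

datatype ('o, 'm) step = Fwd 'm 'o | Bwd 'm 'o

fun zigzag ::
    "('o, 'm, 'z) category_scheme \<Rightarrow> ('o \<Rightarrow> 'o \<Rightarrow> 'm set) \<Rightarrow> 'o \<Rightarrow> 'o \<Rightarrow> ('o, 'm) step list \<Rightarrow> bool" where
  "zigzag C W A Z [] \<longleftrightarrow> A \<in> Ob C \<and> A = Z"
| "zigzag C W A Z (Fwd f B # p) \<longleftrightarrow> A \<in> Ob C \<and> f \<in> Mor C A B \<and> zigzag C W B Z p"
| "zigzag C W A Z (Bwd w B # p) \<longleftrightarrow> A \<in> Ob C \<and> w \<in> Mor C B A \<and> w \<in> W B A \<and> zigzag C W B Z p"

inductive zigzag_eq ::
    "('o, 'm, 'z) category_scheme \<Rightarrow> ('o \<Rightarrow> 'o \<Rightarrow> 'm set) \<Rightarrow>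
     'o \<Rightarrow> 'o \<Rightarrow> ('o, 'm) step list \<Rightarrow> ('o, 'm) step list \<Rightarrow> bool"
  for C :: "('o, 'm, 'z) category_scheme" and W :: "'o \<Rightarrow> 'o \<Rightarrow> 'm set" where
  zz_refl: "zigzag C W A Z p \<Longrightarrow> zigzag_eq C W A Z p p"
| zz_sym: "zigzag_eq C W A Z p q \<Longrightarrow> zigzag_eq C W A Z q p"
| zz_trans: "zigzag_eq C W A Z p q \<Longrightarrow> zigzag_eq C W A Z q r \<Longrightarrow> zigzag_eq C W A Z p r"
| zz_append: "zigzag_eq C W A B p p' \<Longrightarrow> zigzag_eq C W B Z q q' \<Longrightarrow>
    zigzag_eq C W A Z (p @ q) (p' @ q')"
| zz_id: "A \<in> Ob C \<Longrightarrow> zigzag_eq C W A A [Fwd (Idn C A) A] []"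
| zz_comp: "A \<in> Ob C \<Longrightarrow> B \<in> Ob C \<Longrightarrow> E \<in> Ob C \<Longrightarrow> f \<in> Mor C A B \<Longrightarrow> g \<in> Mor C B E \<Longrightarrow>
    zigzag_eq C W A E [Fwd f B, Fwd g E] [Fwd (Cmp C A B E g f) E]"
| zz_inv_left: "A \<in> Ob C \<Longrightarrow> B \<in> Ob C \<Longrightarrow> w \<in> Mor C A B \<Longrightarrow> w \<in> W A B \<Longrightarrow>
    zigzag_eq C W A A [Fwd w B, Bwd w A] []"
| zz_inv_right: "A \<in> Ob C \<Longrightarrow> B \<in> Ob C \<Longrightarrow> w \<in> Mor C A B \<Longrightarrow> w \<in> W A B \<Longrightarrow>
    zigzag_eq C W B B [Bwd w A, Fwd w B] []"

definition zz_class ::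
    "('o, 'm, 'z) category_scheme \<Rightarrow> ('o \<Rightarrow> 'o \<Rightarrow> 'm set) \<Rightarrow>
     'o \<Rightarrow> 'o \<Rightarrow> ('o, 'm) step list \<Rightarrow> ('o, 'm) step list set" where
  "zz_class C W A Z p = {q. zigzag_eq C W A Z p q}"

definition localization ::
    "('o, 'm, 'z) category_scheme \<Rightarrow> ('o \<Rightarrow> 'o \<Rightarrow> 'm set) \<Rightarrow>
     ('o, ('o, 'm) step list set) category" where
  "localization C W =
     \<lparr> Ob = Ob C,
       Mor = (\<lambda>A Z. {zz_class C W A Z p | p. zigzag C W A Z p}),
       Idn = (\<lambda>A. zz_class C W A A []),
       Cmp = (\<lambda>A B Z \<beta> \<alpha>. \<Union>p\<in>\<alpha>. \<Union>q\<in>\<beta>. zz_class C W A Z (p @ q)) \<rparr>"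

definition loc_functor ::
    "('o, 'm, 'z) category_scheme \<Rightarrow> ('o \<Rightarrow> 'o \<Rightarrow> 'm set) \<Rightarrow>
     ('o, 'm, 'o, ('o, 'm) step list set) funct" where
  "loc_functor C W = \<lparr> FOb = (\<lambda>A. A), FMor = (\<lambda>A B f. zz_class C W A B [Fwd f B]) \<rparr>"

text \<open>
  The functor on the localization induced by a functor \<open>T\<close> that sends the morphisms of \<open>W\<close> to
  isomorphisms.
\<close>

fun zz_eval ::
    "('o2, 'm2, 'z2) category_scheme \<Rightarrow> ('o1, 'm1, 'o2, 'm2) funct \<Rightarrow>
     'o1 \<Rightarrow> 'o1 \<Rightarrow> ('o1, 'm1) step list \<Rightarrow> 'm2" where
  "zz_eval D T A Z [] = Idn D (FOb T A)"
| "zz_eval D T A Z (Fwd f B # p) =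
     Cmp D (FOb T A) (FOb T B) (FOb T Z) (zz_eval D T B Z p) (FMor T A B f)"
| "zz_eval D T A Z (Bwd w B # p) =
     Cmp D (FOb T A) (FOb T B) (FOb T Z) (zz_eval D T B Z p)
       (inverse_mor D (FOb T B) (FOb T A) (FMor T B A w))"

definition loc_lift ::
    "('o2, 'm2, 'z2) category_scheme \<Rightarrow> ('o1, 'm1, 'o2, 'm2) funct \<Rightarrow>
     ('o1, ('o1, 'm1) step list set, 'o2, 'm2) funct" where
  "loc_lift D T =
     \<lparr> FOb = FOb T, FMor = (\<lambda>A Z \<alpha>. the_elem (zz_eval D T A Z ` \<alpha>)) \<rparr>"


section \<open>Complexes\<close>

record ('o, 'm) cpx =
  cob :: "int \<Rightarrow> 'o"
  cdiff :: "int \<Rightarrow> 'm"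

definition Ch :: "('o, 'm, 'z) zcategory_scheme \<Rightarrow> (('o, 'm) cpx, int \<Rightarrow> 'm) category" where
  "Ch C =
     \<lparr> Ob = {K. \<forall>n. cob K n \<in> Ob C \<and> cdiff K n \<in> Mor C (cob K n) (cob K (n + 1)) \<and>
               Cmp C (cob K n) (cob K (n + 1)) (cob K (n + 1 + 1)) (cdiff K (n + 1)) (cdiff K n) =
               Zmor C (cob K n) (cob K (n + 1 + 1))},
       Mor = (\<lambda>K L. {\<phi>. \<forall>n. \<phi> n \<in> Mor C (cob K n) (cob L n) \<and>
               Cmp C (cob K n) (cob K (n + 1)) (cob L (n + 1)) (\<phi> (n + 1)) (cdiff K n) =
               Cmp C (cob K n) (cob L n) (cob L (n + 1)) (cdiff L n) (\<phi> n)}),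
       Idn = (\<lambda>K n. Idn C (cob K n)),
       Cmp = (\<lambda>K L M \<psi> \<phi> n. Cmp C (cob K n) (cob L n) (cob M n) (\<psi> n) (\<phi> n)) \<rparr>"

definition Ch_funct ::
    "('o1, 'm1, 'o2, 'm2) funct \<Rightarrow>
     (('o1, 'm1) cpx, int \<Rightarrow> 'm1, ('o2, 'm2) cpx, int \<Rightarrow> 'm2) funct" where
  "Ch_funct T =
     \<lparr> FOb = (\<lambda>K. \<lparr> cob = (\<lambda>n. FOb T (cob K n)),
                   cdiff = (\<lambda>n. FMor T (cob K n) (cob K (n + 1)) (cdiff K n)) \<rparr>),
       FMor = (\<lambda>K L \<phi> n. FMor T (cob K n) (cob L n) (\<phi> n)) \<rparr>"


section \<open>Abelian groups and the derived category of abelian groups\<close>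

text \<open>
  Abelian groups are written multiplicatively, as in the library.  A type cannot contain groups of
  all sizes; the universe is the type \<open>'u\<close>, in which the carriers live.  All categories of groups
  and sheaves below are taken relative to this arbitrary universe.
\<close>

definition Ab :: "('u monoid, 'u \<Rightarrow> 'u) zcategory" where
  "Ab =
     \<lparr> Ob = {G. comm_group G},
       Mor = (\<lambda>G H. hom G H \<inter> extensional (carrier G)),
       Idn = (\<lambda>G. \<lambda>s\<in>carrier G. s),
       Cmp = (\<lambda>G H K h g. compose (carrier G) h g),
       Zmor = (\<lambda>G H. \<lambda>s\<in>carrier G. \<one>\<^bsub>H\<^esub>) \<rparr>"

definition cocycles :: "('u monoid, 'u \<Rightarrow> 'u) cpx \<Rightarrow> int \<Rightarrow> 'u set" where
  "cocycles K n = kernel (cob K n) (cob K (n + 1)) (cdiff K n)"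

definition coboundaries :: "('u monoid, 'u \<Rightarrow> 'u) cpx \<Rightarrow> int \<Rightarrow> 'u set" where
  "coboundaries K n = cdiff K (n - 1) ` carrier (cob K (n - 1))"

definition cohomology :: "int \<Rightarrow> ('u monoid, 'u \<Rightarrow> 'u) cpx \<Rightarrow> 'u set monoid" where
  "cohomology n K = (cob K n)\<lparr>carrier := cocycles K n\<rparr> Mod coboundaries K n"

text \<open>
  The map induced by \<open>\<phi>\<close> sends the class \<open>S\<close> of a cocycle to the class \<open>B + \<phi>(S)\<close>, where \<open>B\<close> is the
  group of coboundaries of the target.
\<close>

definition cohomology_map ::
    "int \<Rightarrow> ('u monoid, 'u \<Rightarrow> 'u) cpx \<Rightarrow> ('u monoid, 'u \<Rightarrow> 'u) cpx \<Rightarrow>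
     (int \<Rightarrow> 'u \<Rightarrow> 'u) \<Rightarrow> 'u set \<Rightarrow> 'u set" where
  "cohomology_map n K L \<phi> =
     (\<lambda>S\<in>carrier (cohomology n K). coboundaries L n <#>\<^bsub>cob L n\<^esub> (\<phi> n ` S))"

definition H_Ab ::
    "int \<Rightarrow> (('u monoid, 'u \<Rightarrow> 'u) cpx, int \<Rightarrow> 'u \<Rightarrow> 'u, 'u set monoid, 'u set \<Rightarrow> 'u set) funct" where
  "H_Ab n = \<lparr> FOb = cohomology n, FMor = cohomology_map n \<rparr>"

definition qis_Ab ::
    "('u monoid, 'u \<Rightarrow> 'u) cpx \<Rightarrow> ('u monoid, 'u \<Rightarrow> 'u) cpx \<Rightarrow> (int \<Rightarrow> 'u \<Rightarrow> 'u) set" where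
  "qis_Ab K L = {\<phi> \<in> Mor (Ch Ab) K L.
     \<forall>n. is_iso Ab (cohomology n K) (cohomology n L) (cohomology_map n K L \<phi>)}"

type_synonym 'u dab_obj = "('u monoid, 'u \<Rightarrow> 'u) cpx"
type_synonym 'u dab_mor = "('u dab_obj, int \<Rightarrow> 'u \<Rightarrow> 'u) step list set"

definition D_Ab :: "('u dab_obj, 'u dab_mor) category" where
  "D_Ab = localization (Ch Ab) qis_Ab"

definition H_D :: "int \<Rightarrow> ('u dab_obj, 'u dab_mor, 'u set monoid, 'u set \<Rightarrow> 'u set) funct" where
  "H_D n = loc_lift Ab (H_Ab n)"


section \<open>Sheaves of abelian groups\<close>

text \<open>
  A sheaf of abelian groups on \<open>X\<close> is given by its etale space: the stalks, and a topology on the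
  disjoint union of the stalks for which the projection to \<open>X\<close> is a local homeomorphism and the
  group operations are continuous.  In this model the inverse image is the fibre product, so that
  \<open>f\<inverse>g\<inverse> = (g \<circ> f)\<inverse>\<close> is an equality of functors.  Stalks are \<open>undefined\<close> outside \<open>X\<close>.
\<close>

record ('a, 'u) sheaf =
  stalk :: "'a \<Rightarrow> 'u monoid"
  espace :: "('a \<times> 'u) topology"

definition is_sheaf :: "'a topology \<Rightarrow> ('a, 'u) sheaf \<Rightarrow> bool" where
  "is_sheaf X F \<longleftrightarrow>
     stalk F \<in> extensional (topspace X) \<and>
     (\<forall>x\<in>topspace X. comm_group (stalk F x)) \<and>
     topspace (espace F) = (SIGMA x:topspace X. carrier (stalk F x)) \<and>
     (\<forall>e\<in>topspace (espace F). \<exists>U. openin (espace F) U \<and> e \<in> U \<and> openin X (fst ` U) \<and>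
        homeomorphic_map (subtopology (espace F) U) (subtopology X (fst ` U)) fst) \<and>
     continuous_map
       (subtopology (prod_topology (espace F) (espace F)) {(d, e). fst d = fst e}) (espace F)
       (\<lambda>(d, e). (fst d, snd d \<otimes>\<^bsub>stalk F (fst d)\<^esub> snd e)) \<and>
     continuous_map (espace F) (espace F) (\<lambda>(x, s). (x, inv\<^bsub>stalk F x\<^esub> s))"

definition Sh :: "'a topology \<Rightarrow> (('a, 'u) sheaf, 'a \<Rightarrow> 'u \<Rightarrow> 'u) zcategory" where
  "Sh X =
     \<lparr> Ob = {F. is_sheaf X F},
       Mor = (\<lambda>F G. {\<phi> \<in> (\<Pi>\<^sub>E x\<in>topspace X. Mor Ab (stalk F x) (stalk G x)).
                continuous_map (espace F) (espace G) (\<lambda>(x, s). (x, \<phi> x s))}),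
       Idn = (\<lambda>F. \<lambda>x\<in>topspace X. Idn Ab (stalk F x)),
       Cmp = (\<lambda>F G H \<psi> \<phi>. \<lambda>x\<in>topspace X.
                Cmp Ab (stalk F x) (stalk G x) (stalk H x) (\<psi> x) (\<phi> x)),
       Zmor = (\<lambda>F G. \<lambda>x\<in>topspace X. Zmor Ab (stalk F x) (stalk G x)) \<rparr>"

definition inv_im ::
    "'a topology \<Rightarrow> ('a \<Rightarrow> 'b) \<Rightarrow> (('b, 'u) sheaf, 'b \<Rightarrow> 'u \<Rightarrow> 'u, ('a, 'u) sheaf, 'a \<Rightarrow> 'u \<Rightarrow> 'u) funct" where
  "inv_im X f =
     \<lparr> FOb = (\<lambda>F. \<lparr> stalk = (\<lambda>x\<in>topspace X. stalk F (f x)),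
                   espace = pullback_topology (SIGMA x:topspace X. carrier (stalk F (f x)))
                              (\<lambda>(x, s). (x, (f x, s))) (prod_topology X (espace F)) \<rparr>),
       FMor = (\<lambda>F G \<phi>. \<lambda>x\<in>topspace X. \<phi> (f x)) \<rparr>"

text \<open>Abelian groups are identified with sheaves on the one-point space.\<close>

definition Ab_to_Sh_point ::
    "('u monoid, 'u \<Rightarrow> 'u, (unit, 'u) sheaf, unit \<Rightarrow> 'u \<Rightarrow> 'u) funct" where
  "Ab_to_Sh_point =
     \<lparr> FOb = (\<lambda>G. \<lparr> stalk = (\<lambda>_. G), espace = discrete_topology (UNIV \<times> carrier G) \<rparr>),
       FMor = (\<lambda>G H h. \<lambda>_. h) \<rparr>"

definition proj_inv ::
    "'a topology \<Rightarrow> ('u monoid, 'u \<Rightarrow> 'u, ('a, 'u) sheaf, 'a \<Rightarrow> 'u \<Rightarrow> 'u) funct" where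
  "proj_inv X = comp_funct (inv_im X (\<lambda>_. ())) Ab_to_Sh_point"


section \<open>The derived category of sheaves\<close>

definition stalk_cpx ::
    "(('a, 'u) sheaf, 'a \<Rightarrow> 'u \<Rightarrow> 'u) cpx \<Rightarrow> 'a \<Rightarrow> ('u monoid, 'u \<Rightarrow> 'u) cpx" where
  "stalk_cpx K x = \<lparr> cob = (\<lambda>n. stalk (cob K n) x), cdiff = (\<lambda>n. cdiff K n x) \<rparr>"

text \<open>
  The cohomology sheaf is the quotient of the sheaf of cocycles by the sheaf of coboundaries; its
  etale space carries the quotient topology of the etale space of the sheaf of cocycles.
\<close>

definition cocycle_space :: "'a topology \<Rightarrow> int \<Rightarrow> (('a, 'u) sheaf, 'a \<Rightarrow> 'u \<Rightarrow> 'u) cpx \<Rightarrow> ('a \<times> 'u) topology" where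
  "cocycle_space X n K =
     subtopology (espace (cob K n)) (SIGMA x:topspace X. cocycles (stalk_cpx K x) n)"

definition cocycle_class :: "int \<Rightarrow> (('a, 'u) sheaf, 'a \<Rightarrow> 'u \<Rightarrow> 'u) cpx \<Rightarrow> 'a \<times> 'u \<Rightarrow> 'a \<times> 'u set" where
  "cocycle_class n K = (\<lambda>(x, s). (x, coboundaries (stalk_cpx K x) n #>\<^bsub>stalk (cob K n) x\<^esub> s))"

definition cohomology_sheaf ::
    "'a topology \<Rightarrow> int \<Rightarrow> (('a, 'u) sheaf, 'a \<Rightarrow> 'u \<Rightarrow> 'u) cpx \<Rightarrow> ('a, 'u set) sheaf" where
  "cohomology_sheaf X n K =
     \<lparr> stalk = (\<lambda>x\<in>topspace X. cohomology n (stalk_cpx K x)),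
       espace = topology (\<lambda>U.
         U \<subseteq> (SIGMA x:topspace X. carrier (cohomology n (stalk_cpx K x))) \<and>
         openin (cocycle_space X n K)
           {e \<in> topspace (cocycle_space X n K). cocycle_class n K e \<in> U}) \<rparr>"

definition cohomology_sheaf_map ::
    "'a topology \<Rightarrow> int \<Rightarrow> (('a, 'u) sheaf, 'a \<Rightarrow> 'u \<Rightarrow> 'u) cpx \<Rightarrow> (('a, 'u) sheaf, 'a \<Rightarrow> 'u \<Rightarrow> 'u) cpx \<Rightarrow>
     (int \<Rightarrow> 'a \<Rightarrow> 'u \<Rightarrow> 'u) \<Rightarrow> 'a \<Rightarrow> 'u set \<Rightarrow> 'u set" where
  "cohomology_sheaf_map X n K L \<phi> =
     (\<lambda>x\<in>topspace X. cohomology_map n (stalk_cpx K x) (stalk_cpx L x) (\<lambda>m. \<phi> m x))"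

definition qis_Sh ::
    "'a topology \<Rightarrow> (('a, 'u) sheaf, 'a \<Rightarrow> 'u \<Rightarrow> 'u) cpx \<Rightarrow> (('a, 'u) sheaf, 'a \<Rightarrow> 'u \<Rightarrow> 'u) cpx \<Rightarrow>
     (int \<Rightarrow> 'a \<Rightarrow> 'u \<Rightarrow> 'u) set" where
  "qis_Sh X K L = {\<phi> \<in> Mor (Ch (Sh X)) K L.
     \<forall>n. is_iso (Sh X) (cohomology_sheaf X n K) (cohomology_sheaf X n L)
           (cohomology_sheaf_map X n K L \<phi>)}"

type_synonym ('a, 'u) dsh_obj = "(('a, 'u) sheaf, 'a \<Rightarrow> 'u \<Rightarrow> 'u) cpx"
type_synonym ('a, 'u) dsh_mor = "(('a, 'u) dsh_obj, int \<Rightarrow> 'a \<Rightarrow> 'u \<Rightarrow> 'u) step list set"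

definition D_Sh :: "'a topology \<Rightarrow> (('a, 'u) dsh_obj, ('a, 'u) dsh_mor) category" where
  "D_Sh X = localization (Ch (Sh X)) (qis_Sh X)"

text \<open>The inverse image functors are exact, so they are applied to complexes termwise.\<close>

definition D_inv_im ::
    "'a topology \<Rightarrow> ('a \<Rightarrow> 'b) \<Rightarrow>
     (('b, 'u) dsh_obj, ('b, 'u) dsh_mor, ('a, 'u) dsh_obj, ('a, 'u) dsh_mor) funct" where
  "D_inv_im X f =
     loc_lift (D_Sh X) (comp_funct (loc_functor (Ch (Sh X)) (qis_Sh X)) (Ch_funct (inv_im X f)))"

definition D_proj_inv ::
    "'a topology \<Rightarrow> ('u dab_obj, 'u dab_mor, ('a, 'u) dsh_obj, ('a, 'u) dsh_mor) funct" where
  "D_proj_inv X =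
     loc_lift (D_Sh X) (comp_funct (loc_functor (Ch (Sh X)) (qis_Sh X)) (Ch_funct (proj_inv X)))"


section \<open>Homology and its functoriality\<close>

type_synonym ('a, 'u) hladj = "(('a, 'u) dsh_obj, ('a, 'u) dsh_mor, 'u dab_obj, 'u dab_mor) ladjoint"

definition is_homology_adjoint :: "'a topology \<Rightarrow> ('a, 'u) hladj \<Rightarrow> bool" where
  "is_homology_adjoint X L \<longleftrightarrow> is_left_adjoint (D_Sh X) D_Ab (D_proj_inv X) L"

definition homology :: "('a, 'u) hladj \<Rightarrow> int \<Rightarrow> ('a, 'u) dsh_obj \<Rightarrow> 'u set monoid" where
  "homology L i F = FOb (H_D (- i)) (FOb L F)"

definition homology_map ::
    "('a, 'u) hladj \<Rightarrow> int \<Rightarrow> ('a, 'u) dsh_obj \<Rightarrow> ('a, 'u) dsh_obj \<Rightarrow> ('a, 'u) dsh_mor \<Rightarrow>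
     'u set \<Rightarrow> 'u set" where
  "homology_map L i F F' v = FMor (H_D (- i)) (FOb L F) (FOb L F') (FMor L F F' v)"

text \<open>
  \<open>h\<close> corresponds to the inverse image map if, under the two adjunctions, precomposition with \<open>h\<close>,
  \<open>Hom(L(Y,F), G) \<rightarrow> Hom(L(X,f\<inverse>F), G)\<close>, becomes
  \<open>f\<inverse> : Hom(F, \<pi>\<^sub>Y\<inverse>G) \<rightarrow> Hom(f\<inverse>F, f\<inverse>\<pi>\<^sub>Y\<inverse>G) = Hom(f\<inverse>F, \<pi>\<^sub>X\<inverse>G)\<close>, for every \<open>G\<close>.
\<close>

definition is_pushforward ::
    "'a topology \<Rightarrow> 'b topology \<Rightarrow> ('a \<Rightarrow> 'b) \<Rightarrow> ('a, 'u) hladj \<Rightarrow> ('b, 'u) hladj \<Rightarrow>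
     ('b, 'u) dsh_obj \<Rightarrow> 'u dab_mor \<Rightarrow> bool" where
  "is_pushforward X Y f LX LY F h \<longleftrightarrow>
     h \<in> Mor D_Ab (FOb LX (FOb (D_inv_im X f) F)) (FOb LY F) \<and>
     (\<forall>G\<in>Ob D_Ab. \<forall>u\<in>Mor D_Ab (FOb LY F) G.
        Adj LX (FOb (D_inv_im X f) F) G
          (Cmp D_Ab (FOb LX (FOb (D_inv_im X f) F)) (FOb LY F) G u h) =
        FMor (D_inv_im X f) F (FOb (D_proj_inv Y) G) (Adj LY F G u))"

definition pushforward ::
    "'a topology \<Rightarrow> 'b topology \<Rightarrow> ('a \<Rightarrow> 'b) \<Rightarrow> ('a, 'u) hladj \<Rightarrow> ('b, 'u) hladj \<Rightarrow>
     ('b, 'u) dsh_obj \<Rightarrow> 'u dab_mor" where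
  "pushforward X Y f LX LY F = (THE h. is_pushforward X Y f LX LY F h)"

definition homology_pushforward ::
    "'a topology \<Rightarrow> 'b topology \<Rightarrow> ('a \<Rightarrow> 'b) \<Rightarrow> ('a, 'u) hladj \<Rightarrow> ('b, 'u) hladj \<Rightarrow> int \<Rightarrow>
     ('b, 'u) dsh_obj \<Rightarrow> 'u set \<Rightarrow> 'u set" where
  "homology_pushforward X Y f LX LY i F =
     FMor (H_D (- i)) (FOb LX (FOb (D_inv_im X f) F)) (FOb LY F) (pushforward X Y f LX LY F)"

end

theory Submission
  imports Defs
begin

text \<open>
  Inverse images act on zigzags step by step, provided that they preserve quasi-isomorphisms.  This
  holds because a morphism of complexes of sheaves is a quasi-isomorphism iff it is one on all stalks,
  and the stalks of an inverse image are stalks of the original sheaf.  The criterion rests on the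
  fact that maps between etale spaces over the same base are open, which makes the quotient map onto
  the cohomology sheaf open and a stalkwise bijective map of cohomology sheaves a homeomorphism.

  Since \<open>f\<inverse>g\<inverse> = (g \<circ> f)\<inverse>\<close> and \<open>f\<inverse>\<pi>\<^sub>Y\<inverse> = \<pi>\<^sub>X\<inverse>\<close> hold strictly, the pushforward
  \<open>f\<^sub>*\<close> is the morphism adjoint to \<open>f\<inverse>\<eta>\<close>, where \<open>\<eta> : F \<rightarrow> \<pi>\<^sub>Y\<inverse>L(Y, F)\<close> is the unit, and its
  naturality and functoriality are checked after applying the adjunction bijection.
\<close>

section \<open>Categories and localization\<close>

text \<open>The definitions pick values by \<open>THE\<close>, by \<open>the_elem\<close> and by
  unions over representatives, so each of them becomes usable only through an invariance statement:
  two-sided inverses are unique, evaluation is constant on classes of zigzags, concatenation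
  respects the relation.

  Strictness carries more weight than it would on paper. A class of zigzags depends on its exact end
  objects, so the identification of Hom(f\<inverse>F, f\<inverse>\<pi>_Y\<inverse>G) with
  Hom(f\<inverse>F, \<pi>_X\<inverse>G) has to be an equality of sets. It is one because the stalk
  of f\<inverse>F at x is literally the stalk of F at f x, and because the topologies agree by the
  universal property of the fibre product.

  The group structure enters the topology through the zero section, which is open as the image of s
  \<mapsto> s - s. Cocycles therefore form an open part of the etale space of cochains, and open
  sets of cocycles can be moved around as open sets of cochains.\<close>

definition is_category :: "('o, 'm, 'z) category_scheme \<Rightarrow> bool" where
  "is_category C \<longleftrightarrow>
     (\<forall>A\<in>Ob C. Idn C A \<in> Mor C A A) \<and>
     (\<forall>A\<in>Ob C. \<forall>B\<in>Ob C. \<forall>D\<in>Ob C. \<forall>f\<in>Mor C A B. \<forall>g\<in>Mor C B D. Cmp C A B D g f \<in> Mor C A D) \<and>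
     (\<forall>A\<in>Ob C. \<forall>B\<in>Ob C. \<forall>f\<in>Mor C A B. Cmp C A B B (Idn C B) f = f \<and> Cmp C A A B f (Idn C A) = f) \<and>
     (\<forall>A\<in>Ob C. \<forall>B\<in>Ob C. \<forall>D\<in>Ob C. \<forall>E\<in>Ob C. \<forall>f\<in>Mor C A B. \<forall>g\<in>Mor C B D. \<forall>h\<in>Mor C D E.
        Cmp C A D E h (Cmp C A B D g f) = Cmp C A B E (Cmp C B D E h g) f)"

lemma Idn_in_Mor: "is_category C \<Longrightarrow> A \<in> Ob C \<Longrightarrow> Idn C A \<in> Mor C A A"
  by (simp add: is_category_def)

lemma Cmp_in_Mor:
  "is_category C \<Longrightarrow> A \<in> Ob C \<Longrightarrow> B \<in> Ob C \<Longrightarrow> D \<in> Ob C \<Longrightarrow> f \<in> Mor C A B \<Longrightarrow> g \<in> Mor C B D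
   \<Longrightarrow> Cmp C A B D g f \<in> Mor C A D"
  by (simp add: is_category_def)

lemma Cmp_Idn_left:
  "is_category C \<Longrightarrow> A \<in> Ob C \<Longrightarrow> B \<in> Ob C \<Longrightarrow> f \<in> Mor C A B \<Longrightarrow> Cmp C A B B (Idn C B) f = f"
  by (simp add: is_category_def)

lemma Cmp_Idn_right:
  "is_category C \<Longrightarrow> A \<in> Ob C \<Longrightarrow> B \<in> Ob C \<Longrightarrow> f \<in> Mor C A B \<Longrightarrow> Cmp C A A B f (Idn C A) = f"
  by (simp add: is_category_def)

lemma Cmp_assoc:
  "is_category C \<Longrightarrow> A \<in> Ob C \<Longrightarrow> B \<in> Ob C \<Longrightarrow> D \<in> Ob C \<Longrightarrow> E \<in> Ob C \<Longrightarrow>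
   f \<in> Mor C A B \<Longrightarrow> g \<in> Mor C B D \<Longrightarrow> h \<in> Mor C D E \<Longrightarrow>
   Cmp C A D E h (Cmp C A B D g f) = Cmp C A B E (Cmp C B D E h g) f"
  by (simp add: is_category_def)

lemmas category_laws = Idn_in_Mor Cmp_in_Mor Cmp_Idn_left Cmp_Idn_right

text \<open>\<open>inverse_mor\<close> is a definite description and gets its value from the
  uniqueness of two-sided inverses: g' = g'(fg) = (g'f)g = g.\<close>

lemma inverse_mor_eq:
  assumes "is_category C" "A \<in> Ob C" "B \<in> Ob C" "is_inverse C A B f g"
  shows "inverse_mor C A B f = g"
  unfolding inverse_mor_def
proof (rule the_equality)
  show "is_inverse C A B f g" by fact
  fix g' assume g': "is_inverse C A B f g'"
  have "g' = Cmp C B B A g' (Idn C B)"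
    using assms g' by (simp add: is_inverse_def category_laws)
  also have "\<dots> = Cmp C B B A g' (Cmp C B A B f g)"
    using assms by (simp add: is_inverse_def)
  also have "\<dots> = Cmp C B A A (Cmp C A B A g' f) g"
    using assms g' unfolding is_inverse_def by (intro Cmp_assoc) auto
  also have "\<dots> = g"
    using assms g' by (simp add: is_inverse_def category_laws)
  finally show "g' = g" .
qed

lemma is_inverse_inverse_mor:
  assumes "is_category C" "A \<in> Ob C" "B \<in> Ob C" "is_iso C A B f"
  shows "is_inverse C A B f (inverse_mor C A B f)"
  using assms inverse_mor_eq unfolding is_iso_def by metis

lemma FOb_in_Ob: "is_functor C D T \<Longrightarrow> A \<in> Ob C \<Longrightarrow> FOb T A \<in> Ob D"
  by (simp add: is_functor_def)

lemma FMor_in_Mor: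
  "is_functor C D T \<Longrightarrow> A \<in> Ob C \<Longrightarrow> B \<in> Ob C \<Longrightarrow> f \<in> Mor C A B \<Longrightarrow>
   FMor T A B f \<in> Mor D (FOb T A) (FOb T B)"
  by (simp add: is_functor_def)

lemma FMor_Idn: "is_functor C D T \<Longrightarrow> A \<in> Ob C \<Longrightarrow> FMor T A A (Idn C A) = Idn D (FOb T A)"
  by (simp add: is_functor_def)

lemma FMor_Cmp:
  "is_functor C D T \<Longrightarrow> A \<in> Ob C \<Longrightarrow> B \<in> Ob C \<Longrightarrow> E \<in> Ob C \<Longrightarrow> f \<in> Mor C A B \<Longrightarrow> g \<in> Mor C B E \<Longrightarrow>
   FMor T A E (Cmp C A B E g f) = Cmp D (FOb T A) (FOb T B) (FOb T E) (FMor T B E g) (FMor T A B f)"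
  by (simp add: is_functor_def)

lemma FOb_comp_funct [simp]: "FOb (comp_funct S T) A = FOb S (FOb T A)"
  by (simp add: comp_funct_def)

lemma FMor_comp_funct [simp]:
  "FMor (comp_funct S T) A B f = FMor S (FOb T A) (FOb T B) (FMor T A B f)"
  by (simp add: comp_funct_def)

lemma is_functor_comp_funct:
  assumes "is_functor C D T" "is_functor D E S"
  shows "is_functor C E (comp_funct S T)"
  using assms by (simp add: is_functor_def)

section \<open>Zigzag classes and the category laws of the localization\<close>

lemma zigzag_Ob:
  assumes "zigzag C W A Z p" shows "A \<in> Ob C \<and> Z \<in> Ob C"
  using assms by (induction C W A Z p rule: zigzag.induct) auto

lemma zigzag_append:
  "zigzag C W A B p \<Longrightarrow> zigzag C W B Z q \<Longrightarrow> zigzag C W A Z (p @ q)"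
  by (induction C W A B p rule: zigzag.induct) auto

text \<open>Each generating relation compares well-formed zigzags with common ends; for
  \<open>zz_id\<close> and \<open>zz_comp\<close> this rests on identities and composites being
  morphisms of C.\<close>

lemma zigzag_eq_zigzag:
  assumes "is_category C" "zigzag_eq C W A Z p q"
  shows "zigzag C W A Z p \<and> zigzag C W A Z q"
  using assms(2)
  by (induction rule: zigzag_eq.induct) (auto simp: zigzag_append category_laws assms(1))

lemma zz_class_eqI: "zigzag_eq C W A Z p q \<Longrightarrow> zz_class C W A Z p = zz_class C W A Z q"
  unfolding zz_class_def by (blast intro: zz_sym zz_trans)

lemma Ob_localization [simp]: "Ob (localization C W) = Ob C"
  by (simp add: localization_def)

lemma Mor_localization: "Mor (localization C W) A Z = {zz_class C W A Z p | p. zigzag C W A Z p}"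
  by (simp add: localization_def)

lemma zz_class_in_Mor: "zigzag C W A Z p \<Longrightarrow> zz_class C W A Z p \<in> Mor (localization C W) A Z"
  by (auto simp: Mor_localization)

lemma Mor_localizationE:
  assumes "\<alpha> \<in> Mor (localization C W) A Z"
  obtains p where "zigzag C W A Z p" "\<alpha> = zz_class C W A Z p"
  using assms by (auto simp: Mor_localization)

lemma Idn_localization [simp]: "Idn (localization C W) A = zz_class C W A A []"
  by (simp add: localization_def)

text \<open>Composition in \<open>localization\<close> is a union over all pairs of representatives.
  By \<open>zz_append\<close> every member of that union is the same class, so the union
  collapses.\<close>

lemma Cmp_localization:
  assumes "zigzag C W A B p" "zigzag C W B Z q"
  shows "Cmp (localization C W) A B Z (zz_class C W B Z q) (zz_class C W A B p) =
    zz_class C W A Z (p @ q)"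
proof -
  have "(\<Union>p'\<in>zz_class C W A B p. \<Union>q'\<in>zz_class C W B Z q. zz_class C W A Z (p' @ q')) =
      (\<Union>p'\<in>zz_class C W A B p. \<Union>q'\<in>zz_class C W B Z q. zz_class C W A Z (p @ q))"
  proof (intro SUP_cong refl zz_class_eqI zz_append)
    fix p' q' assume "p' \<in> zz_class C W A B p" "q' \<in> zz_class C W B Z q"
    then show "zigzag_eq C W A B p' p" "zigzag_eq C W B Z q' q"
      by (auto simp: zz_class_def intro: zz_sym)
  qed
  \<comment> \<open>A union of copies of one set equals that set only over a nonempty index set,
    hence the check that both classes are inhabited.\<close>
  moreover have "p \<in> zz_class C W A B p" "q \<in> zz_class C W B Z q"
    using assms by (auto simp: zz_class_def zz_refl)
  then have "zz_class C W A B p \<noteq> {}" "zz_class C W B Z q \<noteq> {}" by blast+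
  ultimately show ?thesis
    by (simp add: localization_def)
qed

text \<open>On representatives composition is concatenation of lists, so the laws are associativity
  of \<open>@\<close> and neutrality of \<open>[]\<close>.\<close>

lemma is_category_localization: "is_category (localization C W)"
  unfolding is_category_def
  by (auto elim!: Mor_localizationE simp: Cmp_localization zigzag_append zz_class_in_Mor dest: zigzag_Ob)

lemma FOb_loc_functor [simp]: "FOb (loc_functor C W) A = A"
  by (simp add: loc_functor_def)

lemma FMor_loc_functor [simp]: "FMor (loc_functor C W) A B f = zz_class C W A B [Fwd f B]"
  by (simp add: loc_functor_def)

lemma is_functor_loc_functor:
  assumes "is_category C"
  shows "is_functor C (localization C W) (loc_functor C W)"
  unfolding is_functor_def
  using assms by (auto simp: Cmp_localization category_laws
      intro!: zz_class_in_Mor zz_class_eqI zz_id zz_sym[OF zz_comp])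

lemma is_inverse_loc_functor:
  assumes "A \<in> Ob C" "B \<in> Ob C" "w \<in> Mor C A B" "w \<in> W A B"
  shows "is_inverse (localization C W) A B (zz_class C W A B [Fwd w B]) (zz_class C W B A [Bwd w A])"
  unfolding is_inverse_def using assms
  by (auto simp: Cmp_localization intro!: zz_class_in_Mor zz_class_eqI zz_inv_left zz_inv_right)

section \<open>Functors out of a localization\<close>

definition inverts ::
    "('o1, 'm1, 'z1) category_scheme \<Rightarrow> ('o1 \<Rightarrow> 'o1 \<Rightarrow> 'm1 set) \<Rightarrow> ('o2, 'm2, 'z2) category_scheme \<Rightarrow>
     ('o1, 'm1, 'o2, 'm2) funct \<Rightarrow> bool" where
  "inverts C W D T \<longleftrightarrow>
     (\<forall>A\<in>Ob C. \<forall>B\<in>Ob C. \<forall>w\<in>Mor C A B \<inter> W A B. is_iso D (FOb T A) (FOb T B) (FMor T A B w))"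

context
  fixes C :: "('o1, 'm1, 'z1) category_scheme" and W
    and D :: "('o2, 'm2, 'z2) category_scheme" and T :: "('o1, 'm1, 'o2, 'm2) funct"
  assumes C: "is_category C" and D: "is_category D" and T: "is_functor C D T" and inv: "inverts C W D T"
begin

lemma is_inverse_FMor:
  assumes "A \<in> Ob C" "B \<in> Ob C" "w \<in> Mor C A B" "w \<in> W A B"
  shows "is_inverse D (FOb T A) (FOb T B) (FMor T A B w)
    (inverse_mor D (FOb T A) (FOb T B) (FMor T A B w))"
  using assms inv unfolding inverts_def
  by (intro is_inverse_inverse_mor D FOb_in_Ob[OF T]) auto

lemma zz_eval_in_Mor:
  "zigzag C W A Z p \<Longrightarrow> zz_eval D T A Z p \<in> Mor D (FOb T A) (FOb T Z)"
proof (induction p arbitrary: A)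
  case Nil
  then show ?case by (auto intro!: category_laws D FOb_in_Ob[OF T])
next
  case (Cons s p)
  then show ?case
    using is_inverse_FMor
    by (cases s) (auto simp: is_inverse_def dest: zigzag_Ob
        intro!: Cmp_in_Mor[OF D] FMor_in_Mor[OF T] FOb_in_Ob[OF T] Cons.IH)
qed

text \<open>This is what makes \<open>loc_lift\<close> respect composition, and it gives the
  congruence case in the invariance of evaluation below. In the inductive step only the bracketing
  moves: the first arrow of the zigzag stays innermost.\<close>

lemma zz_eval_append:
  "zigzag C W A B p \<Longrightarrow> zigzag C W B Z q \<Longrightarrow> zz_eval D T A Z (p @ q) =
     Cmp D (FOb T A) (FOb T B) (FOb T Z) (zz_eval D T B Z q) (zz_eval D T A B p)"
proof (induction p arbitrary: A)
  case Nil
  then show ?case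
    using zigzag_Ob[OF Nil(2)] zz_eval_in_Mor[OF Nil(2)]
    by (auto simp: Cmp_Idn_right[OF D] FOb_in_Ob[OF T])
next
  case (Cons s p)
  note Z = zigzag_Ob[OF Cons.prems(2)]
  show ?case
  proof (cases s)
    case (Fwd f E)
    with Cons.prems have p: "zigzag C W E B p" "A \<in> Ob C" "E \<in> Ob C" "f \<in> Mor C A E"
      by (auto dest: zigzag_Ob)
    show ?thesis
      using Fwd Cons.IH[OF p(1) Cons.prems(2)] p Z Cons.prems
      by (simp add: Cmp_assoc[OF D] FOb_in_Ob[OF T] FMor_in_Mor[OF T] zz_eval_in_Mor)
  next
    case (Bwd f E)
    with Cons.prems have p: "zigzag C W E B p" "A \<in> Ob C" "E \<in> Ob C" "f \<in> Mor C E A" "f \<in> W E A"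
      by (auto dest: zigzag_Ob)
    show ?thesis
      using Bwd Cons.IH[OF p(1) Cons.prems(2)] p Z Cons.prems
        is_inverse_FMor[OF p(3,2,4,5)]
      by (simp add: Cmp_assoc[OF D] FOb_in_Ob[OF T] zz_eval_in_Mor is_inverse_def)
  qed
qed

text \<open>Induction over the generators of the relation: identities and composites are handled by
  functoriality, cancellation by the inverse laws for the images of W, concatenation by
  \<open>zz_eval_append\<close>. Only now does \<open>the_elem\<close> in \<open>loc_lift\<close>
  denote a value.\<close>

lemma zz_eval_cong:
  "zigzag_eq C W A Z p q \<Longrightarrow> zz_eval D T A Z p = zz_eval D T A Z q"
proof (induction rule: zigzag_eq.induct)
  case (zz_append A B p p' Z q q')
  then show ?case
    using zigzag_eq_zigzag[OF C zz_append.hyps(1)] zigzag_eq_zigzag[OF C zz_append.hyps(2)]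
    by (simp add: zz_eval_append[of A B _ Z])
next
  case (zz_id A)
  then show ?case by (simp add: FMor_Idn[OF T] category_laws[OF D] FOb_in_Ob[OF T])
next
  case (zz_comp A B E f g)
  then show ?case
    by (simp add: FMor_Cmp[OF T] category_laws[OF D] FOb_in_Ob[OF T] FMor_in_Mor[OF T])
next
  case (zz_inv_left A B w)
  then show ?case
    using is_inverse_FMor[OF zz_inv_left]
    by (simp add: category_laws[OF D] FOb_in_Ob[OF T] FMor_in_Mor[OF T] is_inverse_def)
next
  case (zz_inv_right A B w)
  then show ?case
    using is_inverse_FMor[OF zz_inv_right]
    by (simp add: category_laws[OF D] FOb_in_Ob[OF T] FMor_in_Mor[OF T] is_inverse_def)
qed auto

lemma FMor_loc_lift:
  assumes "zigzag C W A Z p"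
  shows "FMor (loc_lift D T) A Z (zz_class C W A Z p) = zz_eval D T A Z p"
proof -
  have "zz_eval D T A Z ` zz_class C W A Z p = {zz_eval D T A Z p}"
    using assms zz_eval_cong unfolding zz_class_def by (auto intro: zz_refl dest: zz_sym)
  then show ?thesis by (simp add: loc_lift_def)
qed

lemma is_functor_loc_lift: "is_functor (localization C W) D (loc_lift D T)"
proof -
  have FOb: "FOb (loc_lift D T) = FOb T" by (simp add: loc_lift_def)
  show ?thesis
    unfolding is_functor_def FOb
    by (auto elim!: Mor_localizationE simp: Cmp_localization FMor_loc_lift zigzag_append
        zz_eval_append zz_eval_in_Mor FOb_in_Ob[OF T])
qed

end

section \<open>Functors between localizations, computed on zigzags\<close>

text \<open>A backward step along w becomes a backward step along T w. No inverse has to be chosen,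
  so functors that agree on complexes visibly act alike on representatives.\<close>

fun zz_map :: "('o1, 'm1, 'o2, 'm2) funct \<Rightarrow> 'o1 \<Rightarrow> ('o1, 'm1) step list \<Rightarrow> ('o2, 'm2) step list" where
  "zz_map T A [] = []"
| "zz_map T A (Fwd f B # p) = Fwd (FMor T A B f) (FOb T B) # zz_map T B p"
| "zz_map T A (Bwd w B # p) = Bwd (FMor T B A w) (FOb T B) # zz_map T B p"

definition preserves_class ::
    "('o1, 'm1, 'z1) category_scheme \<Rightarrow> ('o1 \<Rightarrow> 'o1 \<Rightarrow> 'm1 set) \<Rightarrow> ('o2 \<Rightarrow> 'o2 \<Rightarrow> 'm2 set) \<Rightarrow>
     ('o1, 'm1, 'o2, 'm2) funct \<Rightarrow> bool" where
  "preserves_class C W V T \<longleftrightarrow>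
     (\<forall>A\<in>Ob C. \<forall>B\<in>Ob C. \<forall>w\<in>Mor C A B \<inter> W A B. FMor T A B w \<in> V (FOb T A) (FOb T B))"

text \<open>The common shape of \<open>D_inv_im\<close> and \<open>D_proj_inv\<close>, so that one
  computation serves both.\<close>

definition localized_functor ::
    "('o2, 'm2, 'z2) category_scheme \<Rightarrow> ('o2 \<Rightarrow> 'o2 \<Rightarrow> 'm2 set) \<Rightarrow> ('o1, 'm1, 'o2, 'm2) funct \<Rightarrow>
     ('o1, ('o1, 'm1) step list set, 'o2, ('o2, 'm2) step list set) funct" where
  "localized_functor D V T = loc_lift (localization D V) (comp_funct (loc_functor D V) T)"

lemma FOb_localized_functor [simp]: "FOb (localized_functor D V T) A = FOb T A"
  by (simp add: localized_functor_def loc_lift_def)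

context
  fixes C :: "('o1, 'm1, 'z1) category_scheme" and W
    and D :: "('o2, 'm2, 'z2) category_scheme" and V and T :: "('o1, 'm1, 'o2, 'm2) funct"
  assumes C: "is_category C" and D: "is_category D" and T: "is_functor C D T"
    and pres: "preserves_class C W V T"
begin

lemma zigzag_zz_map:
  "zigzag C W A Z p \<Longrightarrow> zigzag D V (FOb T A) (FOb T Z) (zz_map T A p)"
proof (induction p arbitrary: A)
  case Nil
  then show ?case by (auto intro: FOb_in_Ob[OF T])
next
  case (Cons s p)
  then show ?case
    using pres by (cases s) (auto simp: preserves_class_def dest: zigzag_Ob
        intro!: FMor_in_Mor[OF T] FOb_in_Ob[OF T])
qed

lemma is_inverse_loc_FMor:
  assumes "A \<in> Ob C" "B \<in> Ob C" "w \<in> Mor C A B" "w \<in> W A B"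
  shows "is_inverse (localization D V) (FOb T A) (FOb T B)
      (zz_class D V (FOb T A) (FOb T B) [Fwd (FMor T A B w) (FOb T B)])
      (zz_class D V (FOb T B) (FOb T A) [Bwd (FMor T A B w) (FOb T A)])"
  using assms pres
  by (intro is_inverse_loc_functor) (auto simp: preserves_class_def FMor_in_Mor[OF T] FOb_in_Ob[OF T])

lemma inverts_localized: "inverts C W (localization D V) (comp_funct (loc_functor D V) T)"
  unfolding inverts_def is_iso_def using is_inverse_loc_FMor by simp blast

text \<open>Evaluation of the composite with \<open>loc_functor\<close> composes classes of one-step
  zigzags, and composing these concatenates the mapped steps again.\<close>

lemma zz_eval_localized:
  "zigzag C W A Z p \<Longrightarrow> zz_eval (localization D V) (comp_funct (loc_functor D V) T) A Z p =
     zz_class D V (FOb T A) (FOb T Z) (zz_map T A p)"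
proof (induction p arbitrary: A)
  case Nil
  then show ?case by simp
next
  case (Cons s p)
  show ?case
  proof (cases s)
    case (Fwd f B)
    with Cons.prems have p: "zigzag C W B Z p" "A \<in> Ob C" "B \<in> Ob C" "f \<in> Mor C A B"
      by (auto dest: zigzag_Ob)
    have "zigzag D V (FOb T A) (FOb T B) [Fwd (FMor T A B f) (FOb T B)]"
      using p by (simp add: FMor_in_Mor[OF T] FOb_in_Ob[OF T])
    from Cmp_localization[OF this zigzag_zz_map[OF p(1)]] show ?thesis
      using Fwd Cons.IH[OF p(1)] by simp
  next
    case (Bwd w B)
    with Cons.prems have p: "zigzag C W B Z p" "A \<in> Ob C" "B \<in> Ob C" "w \<in> Mor C B A" "w \<in> W B A"
      by (auto dest: zigzag_Ob)
    have z: "zigzag D V (FOb T A) (FOb T B) [Bwd (FMor T B A w) (FOb T B)]"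
      using p pres by (simp add: preserves_class_def FMor_in_Mor[OF T] FOb_in_Ob[OF T])
    \<comment> \<open>The inverse selected in \<open>zz_eval\<close> is the class of the backward
      step, by uniqueness of inverses.\<close>
    have "inverse_mor (localization D V) (FOb T B) (FOb T A)
        (zz_class D V (FOb T B) (FOb T A) [Fwd (FMor T B A w) (FOb T A)]) =
        zz_class D V (FOb T A) (FOb T B) [Bwd (FMor T B A w) (FOb T B)]"
      using p by (intro inverse_mor_eq is_category_localization is_inverse_loc_FMor)
        (auto simp: FOb_in_Ob[OF T])
    with Cmp_localization[OF z zigzag_zz_map[OF p(1)]] show ?thesis
      using Bwd Cons.IH[OF p(1)] by simp
  qed
qed

lemma FMor_localized_functor:
  assumes "zigzag C W A Z p"
  shows "FMor (localized_functor D V T) A Z (zz_class C W A Z p) =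
    zz_class D V (FOb T A) (FOb T Z) (zz_map T A p)"
  unfolding localized_functor_def
  using FMor_loc_lift[OF C is_category_localization
      is_functor_comp_funct[OF T is_functor_loc_functor[OF D]] inverts_localized assms]
    zz_eval_localized[OF assms] by simp

lemma is_functor_localized_functor:
  "is_functor (localization C W) (localization D V) (localized_functor D V T)"
  unfolding localized_functor_def
  by (rule is_functor_loc_lift[OF C is_category_localization
      is_functor_comp_funct[OF T is_functor_loc_functor[OF D]] inverts_localized])

end

text \<open>Functors take junk values outside their source category, so they are only compared on it.\<close>

definition funct_eq_on ::
    "('o1, 'm1, 'z) category_scheme \<Rightarrow> ('o1, 'm1, 'o2, 'm2) funct \<Rightarrow> ('o1, 'm1, 'o2, 'm2) funct \<Rightarrow> bool" where
  "funct_eq_on C S T \<longleftrightarrow> (\<forall>A\<in>Ob C. FOb S A = FOb T A) \<and>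
     (\<forall>A\<in>Ob C. \<forall>B\<in>Ob C. \<forall>f\<in>Mor C A B. FMor S A B f = FMor T A B f)"

lemma funct_eq_on_FOb: "funct_eq_on C S T \<Longrightarrow> A \<in> Ob C \<Longrightarrow> FOb S A = FOb T A"
  by (simp add: funct_eq_on_def)

lemma funct_eq_on_FMor:
  "funct_eq_on C S T \<Longrightarrow> A \<in> Ob C \<Longrightarrow> B \<in> Ob C \<Longrightarrow> u \<in> Mor C A B \<Longrightarrow> FMor S A B u = FMor T A B u"
  by (simp add: funct_eq_on_def)

text \<open>A well-formed zigzag visits only objects of C and uses only its morphisms, so agreement
  on C suffices.\<close>

lemma zz_map_cong:
  assumes "funct_eq_on C S T"
  shows "zigzag C W A Z p \<Longrightarrow> zz_map S A p = zz_map T A p"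
proof (induction p arbitrary: A)
  case (Cons s p)
  then show ?case
    using assms by (cases s) (auto simp: funct_eq_on_def dest: zigzag_Ob)
qed simp

lemma zz_map_comp_funct: "zz_map (comp_funct S T) A p = zz_map S (FOb T A) (zz_map T A p)"
  by (induction T A p rule: zz_map.induct) auto

definition id_funct :: "('o, 'm, 'o, 'm) funct" where
  "id_funct = \<lparr> FOb = (\<lambda>A. A), FMor = (\<lambda>A B f. f) \<rparr>"

lemma zz_map_id_funct: "zz_map id_funct A p = p"
  by (induction "id_funct :: ('a, 'b, 'a, 'b) funct" A p rule: zz_map.induct) (auto simp: id_funct_def)

text \<open>An equality of functors before localization survives it, because all three localized
  functors act by \<open>zz_map\<close> on a representative.\<close>

lemma localized_functor_comp:
  assumes C: "is_category C" and D: "is_category D" and E: "is_category E"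
    and T: "is_functor C D T" "preserves_class C W V T"
    and S: "is_functor D E S" "preserves_class D V U S"
    and R: "is_functor C E R" "preserves_class C W U R" "funct_eq_on C (comp_funct S T) R"
    and A: "A \<in> Ob C" "B \<in> Ob C" "\<alpha> \<in> Mor (localization C W) A B"
  shows "FMor (localized_functor E U S) (FOb T A) (FOb T B) (FMor (localized_functor D V T) A B \<alpha>) =
    FMor (localized_functor E U R) A B \<alpha>"
proof -
  obtain p where p: "zigzag C W A B p" "\<alpha> = zz_class C W A B p"
    using A(3) by (rule Mor_localizationE)
  \<comment> \<open>The end objects are parameters of \<open>zz_class\<close>, so they must be
    identified along with the lists of steps.\<close>
  have "FOb S (FOb T A) = FOb R A" "FOb S (FOb T B) = FOb R B"
    using R(3) A by (auto simp: funct_eq_on_def)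
  then show ?thesis
    using FMor_localized_functor[OF C D T p(1)] FMor_localized_functor[OF C E R(1,2) p(1)]
      FMor_localized_functor[OF D E S zigzag_zz_map[OF C D T p(1)]]
      zz_map_cong[OF R(3) p(1)] by (simp add: p zz_map_comp_funct)
qed

lemma localized_functor_id:
  assumes C: "is_category C" and T: "is_functor C C T" "preserves_class C W W T" "funct_eq_on C T id_funct"
    and A: "A \<in> Ob C" "B \<in> Ob C" "\<alpha> \<in> Mor (localization C W) A B"
  shows "FMor (localized_functor C W T) A B \<alpha> = \<alpha>"
proof -
  obtain p where p: "zigzag C W A B p" "\<alpha> = zz_class C W A B p"
    using A(3) by (rule Mor_localizationE)
  have "FOb T A = A" "FOb T B = B"
    using T(3) A by (auto simp: funct_eq_on_def id_funct_def)
  then show ?thesis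
    using FMor_localized_functor[OF C C T(1,2) p(1)] zz_map_cong[OF T(3) p(1)]
    by (simp add: p zz_map_id_funct)
qed

section \<open>Complexes\<close>

text \<open>The only law with content is that a composite commutes with the differentials: the
  squares of f and g are pasted, with reassociation before, between and after the two exchanges. The
  rest holds degreewise.\<close>

lemma is_category_Ch:
  assumes "is_category C"
  shows "is_category (Ch C)"
proof -
  note law = category_laws[OF assms]
  have ob: "K \<in> Ob (Ch C) \<Longrightarrow> cob K n \<in> Ob C" for K n by (simp add: Ch_def)
  have d: "K \<in> Ob (Ch C) \<Longrightarrow> cdiff K n \<in> Mor C (cob K n) (cob K (n + 1))" for K n by (simp add: Ch_def)
  have mor: "f \<in> Mor (Ch C) K L \<Longrightarrow> f n \<in> Mor C (cob K n) (cob L n)" for f K L n by (simp add: Ch_def)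
  have comm: "f \<in> Mor (Ch C) K L \<Longrightarrow> Cmp C (cob K n) (cob K (n + 1)) (cob L (n + 1)) (f (n + 1)) (cdiff K n) =
               Cmp C (cob K n) (cob L n) (cob L (n + 1)) (cdiff L n) (f n)" for f K L n by (simp add: Ch_def)
  have "Cmp (Ch C) K L M g f \<in> Mor (Ch C) K M"
    if o: "K \<in> Ob (Ch C)" "L \<in> Ob (Ch C)" "M \<in> Ob (Ch C)"
      and m: "f \<in> Mor (Ch C) K L" "g \<in> Mor (Ch C) L M" for K L M f g
  proof -
    have "Cmp C (cob K n) (cob K (n+1)) (cob M (n+1))
        (Cmp C (cob K (n+1)) (cob L (n+1)) (cob M (n+1)) (g (n+1)) (f (n+1))) (cdiff K n) =
      Cmp C (cob K n) (cob M n) (cob M (n+1)) (cdiff M n)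
        (Cmp C (cob K n) (cob L n) (cob M n) (g n) (f n))" (is "?l = ?r") for n
    proof -
      have "?l = Cmp C (cob K n) (cob L (n+1)) (cob M (n+1)) (g (n+1))
          (Cmp C (cob K n) (cob K (n+1)) (cob L (n+1)) (f (n+1)) (cdiff K n))"
        using o m by (intro Cmp_assoc[OF assms, symmetric] ob d mor) auto
      also have "\<dots> = Cmp C (cob K n) (cob L (n+1)) (cob M (n+1)) (g (n+1))
          (Cmp C (cob K n) (cob L n) (cob L (n+1)) (cdiff L n) (f n))"
        using comm[OF m(1)] by simp
      also have "\<dots> = Cmp C (cob K n) (cob L n) (cob M (n+1))
          (Cmp C (cob L n) (cob L (n+1)) (cob M (n+1)) (g (n+1)) (cdiff L n)) (f n)"
        using o m by (intro Cmp_assoc[OF assms] ob d mor) auto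
      also have "\<dots> = Cmp C (cob K n) (cob L n) (cob M (n+1))
          (Cmp C (cob L n) (cob M n) (cob M (n+1)) (cdiff M n) (g n)) (f n)"
        using comm[OF m(2)] by simp
      also have "\<dots> = ?r"
        using o m by (intro Cmp_assoc[OF assms, symmetric] ob d mor) auto
      finally show ?thesis .
    qed
    moreover have "Cmp C (cob K n) (cob L n) (cob M n) (g n) (f n) \<in> Mor C (cob K n) (cob M n)" for n
      using o m by (intro law ob mor) auto
    ultimately show ?thesis by (simp add: Ch_def)
  qed
  moreover have "Idn (Ch C) K \<in> Mor (Ch C) K K" if "K \<in> Ob (Ch C)" for K
    using ob[OF that] d[OF that] by (simp add: Ch_def law)
  moreover have "Cmp (Ch C) K L L (Idn (Ch C) L) f = f \<and> Cmp (Ch C) K K L f (Idn (Ch C) K) = f"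
    if "K \<in> Ob (Ch C)" "L \<in> Ob (Ch C)" "f \<in> Mor (Ch C) K L" for K L f
    using ob[OF that(1)] ob[OF that(2)] mor[OF that(3)] by (simp add: Ch_def law)
  moreover have "Cmp (Ch C) K M N h (Cmp (Ch C) K L M g f) = Cmp (Ch C) K L N (Cmp (Ch C) L M N h g) f"
    if "K \<in> Ob (Ch C)" "L \<in> Ob (Ch C)" "M \<in> Ob (Ch C)" "N \<in> Ob (Ch C)"
      "f \<in> Mor (Ch C) K L" "g \<in> Mor (Ch C) L M" "h \<in> Mor (Ch C) M N" for K L M N f g h
    using that(1-4)[THEN ob] that(5-7)[THEN mor] Cmp_assoc[OF assms]
    by (simp add: Ch_def fun_eq_iff)
  ultimately show ?thesis
    unfolding is_category_def by blast
qed

text \<open>Zero morphisms are part of the data of a \<open>zcategory\<close>, so their preservation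
  is a separate premise; it is what carries the equation d d = 0 over to the image complex.\<close>

lemma is_functor_Ch_funct:
  assumes T: "is_functor C D T"
    and Z: "\<And>A B. A \<in> Ob C \<Longrightarrow> B \<in> Ob C \<Longrightarrow> FMor T A B (Zmor C A B) = Zmor D (FOb T A) (FOb T B)"
  shows "is_functor (Ch C) (Ch D) (Ch_funct T)"
proof -
  have "FOb (Ch_funct T) K \<in> Ob (Ch D)" if K: "K \<in> Ob (Ch C)" for K
  proof -
    have o: "\<And>n. cob K n \<in> Ob C" and d: "\<And>n. cdiff K n \<in> Mor C (cob K n) (cob K (n + 1))"
      and z: "\<And>n. Cmp C (cob K n) (cob K (n + 1)) (cob K (n + 1 + 1)) (cdiff K (n + 1)) (cdiff K n) =
               Zmor C (cob K n) (cob K (n + 1 + 1))"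
      using K by (auto simp: Ch_def)
    show ?thesis
      using FMor_Cmp[OF T o o o d d, unfolded z Z[OF o o], symmetric] FOb_in_Ob[OF T o]
        FMor_in_Mor[OF T o o d]
      by (simp add: Ch_def Ch_funct_def)
  qed
  moreover have "FMor (Ch_funct T) K L f \<in> Mor (Ch D) (FOb (Ch_funct T) K) (FOb (Ch_funct T) L)"
    if K: "K \<in> Ob (Ch C)" "L \<in> Ob (Ch C)" "f \<in> Mor (Ch C) K L" for K L f
  proof -
    have o: "\<And>n. cob K n \<in> Ob C" "\<And>n. cob L n \<in> Ob C"
      and d: "\<And>n. cdiff K n \<in> Mor C (cob K n) (cob K (n + 1))" "\<And>n. cdiff L n \<in> Mor C (cob L n) (cob L (n + 1))"
      and f: "\<And>n. f n \<in> Mor C (cob K n) (cob L n)"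
      and c: "\<And>n. Cmp C (cob K n) (cob K (n + 1)) (cob L (n + 1)) (f (n + 1)) (cdiff K n) =
               Cmp C (cob K n) (cob L n) (cob L (n + 1)) (cdiff L n) (f n)"
      using K by (auto simp: Ch_def)
    show ?thesis
      using FMor_Cmp[OF T o(1) o(1) o(2) d(1) f] FMor_Cmp[OF T o(1) o(2) o(2) f d(2)] FMor_in_Mor[OF T o f]
      by (simp add: Ch_def Ch_funct_def c)
  qed
  moreover have "FMor (Ch_funct T) K K (Idn (Ch C) K) = Idn (Ch D) (FOb (Ch_funct T) K)"
    if "K \<in> Ob (Ch C)" for K
    using that FMor_Idn[OF T] by (simp add: Ch_def Ch_funct_def)
  moreover have "FMor (Ch_funct T) K M (Cmp (Ch C) K L M g f) =
      Cmp (Ch D) (FOb (Ch_funct T) K) (FOb (Ch_funct T) L) (FOb (Ch_funct T) M)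
        (FMor (Ch_funct T) L M g) (FMor (Ch_funct T) K L f)"
    if "K \<in> Ob (Ch C)" "L \<in> Ob (Ch C)" "M \<in> Ob (Ch C)" "f \<in> Mor (Ch C) K L" "g \<in> Mor (Ch C) L M"
    for K L M f g
    using that FMor_Cmp[OF T] by (simp add: Ch_def Ch_funct_def)
  ultimately show ?thesis unfolding is_functor_def by blast
qed

lemma Ch_funct_comp: "comp_funct (Ch_funct S) (Ch_funct T) = Ch_funct (comp_funct S T)"
  by (simp add: comp_funct_def Ch_funct_def)

lemma Ch_funct_id: "Ch_funct id_funct = id_funct"
  by (simp add: id_funct_def Ch_funct_def fun_eq_iff)

lemma funct_eq_on_Ch:
  assumes "funct_eq_on C S T"
  shows "funct_eq_on (Ch C) (Ch_funct S) (Ch_funct T)"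
  using assms by (auto simp: funct_eq_on_def Ch_def Ch_funct_def)

section \<open>Abelian groups and cohomology\<close>

lemma Ob_Ab [simp]: "Ob Ab = {G. comm_group G}" by (simp add: Ab_def)
lemma Mor_Ab: "Mor Ab G H = hom G H \<inter> extensional (carrier G)" by (simp add: Ab_def)
lemma Idn_Ab: "Idn Ab G = (\<lambda>s\<in>carrier G. s)" by (simp add: Ab_def)
lemma Cmp_Ab: "Cmp Ab G H K h g = compose (carrier G) h g" by (simp add: Ab_def)
lemma Zmor_Ab: "Zmor Ab G H = (\<lambda>s\<in>carrier G. \<one>\<^bsub>H\<^esub>)" by (simp add: Ab_def)

lemma Mor_Ab_carrier: "h \<in> Mor Ab G H \<Longrightarrow> s \<in> carrier G \<Longrightarrow> h s \<in> carrier H"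
  by (auto simp: Mor_Ab hom_def)

lemma Mor_Ab_mult:
  "h \<in> Mor Ab G H \<Longrightarrow> s \<in> carrier G \<Longrightarrow> t \<in> carrier G \<Longrightarrow> h (s \<otimes>\<^bsub>G\<^esub> t) = h s \<otimes>\<^bsub>H\<^esub> h t"
  by (auto simp: Mor_Ab hom_def)

text \<open>Homomorphisms are extensional on the carrier of the source, which turns the identity
  laws for \<open>compose\<close> into equations of functions.\<close>

lemma is_category_Ab: "is_category (Ab :: ('u monoid, 'u \<Rightarrow> 'u) zcategory)"
proof -
  have "compose (carrier A) g f \<in> Mor Ab A D"
    if "comm_group A" "f \<in> Mor Ab A B" "g \<in> Mor Ab B D" for A B D :: "'u monoid" and f g
    using that group.hom_compose[OF comm_group.axioms(2)[OF that(1)]] unfolding Mor_Ab by auto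
  moreover have "compose (carrier A) (\<lambda>s\<in>carrier B. s) f = f \<and> compose (carrier A) f (\<lambda>s\<in>carrier A. s) = f"
    if "f \<in> Mor Ab A B" for A B :: "'u monoid" and f
    using that unfolding Mor_Ab
    by (intro conjI Id_compose compose_Id[where B = "carrier B"]) (auto simp: hom_def)
  moreover have "compose (carrier A) h (compose (carrier A) g f) =
      compose (carrier A) (compose (carrier B) h g) f"
    if "f \<in> Mor Ab A B" for A B :: "'u monoid" and f and g h :: "'u \<Rightarrow> 'u"
    using that by (intro compose_assoc) (auto simp: Mor_Ab hom_def)
  moreover have "(\<lambda>s\<in>carrier A. s) \<in> Mor Ab A A" if "comm_group A" for A :: "'u monoid"
    using that by (auto simp: Mor_Ab hom_def comm_group.axioms group.is_monoid monoid.m_closed)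
  ultimately show ?thesis
    unfolding is_category_def Cmp_Ab Idn_Ab by simp
qed

lemma Ch_Ab_comm_group: "K \<in> Ob (Ch Ab) \<Longrightarrow> comm_group (cob K n)"
  by (simp add: Ch_def)

lemma Ch_Ab_cdiff: "K \<in> Ob (Ch Ab) \<Longrightarrow> cdiff K n \<in> Mor Ab (cob K n) (cob K (n + 1))"
  by (simp add: Ch_def)

lemma Ch_Ab_cdiff_cdiff:
  assumes "K \<in> Ob (Ch Ab)" "s \<in> carrier (cob K n)"
  shows "cdiff K (n + 1) (cdiff K n s) = \<one>\<^bsub>cob K (n + 1 + 1)\<^esub>"
proof -
  have "compose (carrier (cob K n)) (cdiff K (n + 1)) (cdiff K n) =
    (\<lambda>s\<in>carrier (cob K n). \<one>\<^bsub>cob K (n + 1 + 1)\<^esub>)"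
    using assms(1) unfolding Ch_def Cmp_Ab Zmor_Ab by simp
  from fun_cong[OF this, of s] show ?thesis using assms(2) by (simp add: compose_def)
qed

lemma Ch_Ab_Mor: "\<phi> \<in> Mor (Ch Ab) K L \<Longrightarrow> \<phi> n \<in> Mor Ab (cob K n) (cob L n)"
  by (simp add: Ch_def)

lemma Ch_Ab_Mor_cdiff:
  assumes "\<phi> \<in> Mor (Ch Ab) K L" "s \<in> carrier (cob K n)"
  shows "\<phi> (n + 1) (cdiff K n s) = cdiff L n (\<phi> n s)"
proof -
  have "compose (carrier (cob K n)) (\<phi> (n + 1)) (cdiff K n) = compose (carrier (cob K n)) (cdiff L n) (\<phi> n)"
    using assms(1) unfolding Ch_def Cmp_Ab by simp
  from fun_cong[OF this, of s] show ?thesis using assms(2) by (simp add: compose_def)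
qed

lemma group_hom_Mor_Ab: "comm_group G \<Longrightarrow> comm_group H \<Longrightarrow> h \<in> Mor Ab G H \<Longrightarrow> group_hom G H h"
  by (simp add: group_hom_def group_hom_axioms_def comm_group.axioms Mor_Ab)

lemma cocycles_subset: "cocycles K n \<subseteq> carrier (cob K n)"
  by (auto simp: cocycles_def kernel_def)

lemma subgroup_cocycles: "K \<in> Ob (Ch Ab) \<Longrightarrow> subgroup (cocycles K n) (cob K n)"
  unfolding cocycles_def
  by (intro group_hom.subgroup_kernel group_hom_Mor_Ab Ch_Ab_comm_group Ch_Ab_cdiff)

text \<open>The differential used starts in degree n - 1 and formally ends in degree n - 1 + 1; the
  simplifier identifies that degree with n.\<close>

lemma subgroup_coboundaries:
  assumes "K \<in> Ob (Ch Ab)" shows "subgroup (coboundaries K n) (cob K n)"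
  unfolding coboundaries_def
  using Ch_Ab_cdiff[OF assms, of "n - 1"]
  by (intro group_hom.img_is_subgroup group_hom_Mor_Ab Ch_Ab_comm_group assms) simp

lemma coboundaries_subset:
  assumes "K \<in> Ob (Ch Ab)" shows "coboundaries K n \<subseteq> cocycles K n"
  using Ch_Ab_cdiff_cdiff[OF assms, of _ "n - 1"] Ch_Ab_cdiff[OF assms, of "n - 1"]
  by (auto simp: coboundaries_def cocycles_def kernel_def Mor_Ab_carrier)

lemma comm_group_cohomology:
  assumes K: "K \<in> Ob (Ch Ab)" shows "comm_group (cohomology n K)"
proof -
  interpret G: comm_group "cob K n" using K by (rule Ch_Ab_comm_group)
  have "group (cob K n\<lparr>carrier := cocycles K n\<rparr>)"
    using subgroup_cocycles[OF K] by (rule subgroup.subgroup_is_group) (rule G.is_group)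
  then have "comm_group (cob K n\<lparr>carrier := cocycles K n\<rparr>)"
    using cocycles_subset[of K n] by (intro group.group_comm_groupI) (auto intro: G.m_comm)
  then show ?thesis
    unfolding cohomology_def
    by (intro comm_group.abelian_FactGroup G.subgroup_incl subgroup_coboundaries
        subgroup_cocycles coboundaries_subset K)
qed

section \<open>Cohomology classes and the maps induced on them\<close>

text \<open>The coset is formed in the whole group of cochains. It coincides with the coset in the
  group of cocycles, as restricting the carrier leaves the multiplication alone, and the library
  facts on cosets then apply to \<open>cob K n\<close>.\<close>

definition coh_class :: "('u monoid, 'u \<Rightarrow> 'u) cpx \<Rightarrow> int \<Rightarrow> 'u \<Rightarrow> 'u set" where
  "coh_class K n z = coboundaries K n #>\<^bsub>cob K n\<^esub> z"

lemma carrier_cohomology: "carrier (cohomology n K) = coh_class K n ` cocycles K n"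
  by (auto simp: cohomology_def carrier_FactGroup coh_class_def r_coset_def)

lemma mult_cohomology:
  assumes K: "K \<in> Ob (Ch Ab)" and z: "z \<in> cocycles K n" "z' \<in> cocycles K n"
  shows "coh_class K n z \<otimes>\<^bsub>cohomology n K\<^esub> coh_class K n z' = coh_class K n (z \<otimes>\<^bsub>cob K n\<^esub> z')"
proof -
  interpret G: comm_group "cob K n" using K by (rule Ch_Ab_comm_group)
  interpret N: normal "coboundaries K n" "cob K n"
    by (rule G.subgroup_imp_normal) (rule subgroup_coboundaries[OF K])
  have "coh_class K n z \<otimes>\<^bsub>cohomology n K\<^esub> coh_class K n z' =
      coh_class K n z <#>\<^bsub>cob K n\<^esub> coh_class K n z'"
    by (simp add: cohomology_def set_mult_def)
  also have "\<dots> = coh_class K n (z \<otimes>\<^bsub>cob K n\<^esub> z')"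
    using z cocycles_subset[of K n] unfolding coh_class_def by (intro N.rcos_sum) auto
  finally show ?thesis .
qed

text \<open>Cosets coincide as soon as one representative lies in the coset of the other. The
  explicit cochain b is the form in which the saturation of an open set of cocycles is described
  later.\<close>

lemma coh_class_eq_iff:
  assumes K: "K \<in> Ob (Ch Ab)" and z: "z \<in> carrier (cob K n)" "z' \<in> carrier (cob K n)"
  shows "coh_class K n z = coh_class K n z' \<longleftrightarrow>
    (\<exists>b\<in>carrier (cob K (n - 1)). z = cdiff K (n - 1) b \<otimes>\<^bsub>cob K n\<^esub> z')"
proof -
  interpret G: comm_group "cob K n" using K by (rule Ch_Ab_comm_group)
  have "coh_class K n z = coh_class K n z' \<longleftrightarrow> z \<in> coh_class K n z'"
    unfolding coh_class_def
    using G.repr_independence[OF _ z(2) subgroup_coboundaries[OF K]]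
      G.rcos_self[OF z(1) subgroup_coboundaries[OF K]] by auto
  then show ?thesis by (auto simp: coh_class_def r_coset_def coboundaries_def)
qed

lemma Mor_cocycles:
  assumes K: "K \<in> Ob (Ch Ab)" "L \<in> Ob (Ch Ab)" "\<phi> \<in> Mor (Ch Ab) K L" and z: "z \<in> cocycles K n"
  shows "\<phi> n z \<in> cocycles L n"
proof -
  have z': "z \<in> carrier (cob K n)" "cdiff K n z = \<one>\<^bsub>cob K (n + 1)\<^esub>"
    using z by (auto simp: cocycles_def kernel_def)
  have "\<phi> (n + 1) \<one>\<^bsub>cob K (n + 1)\<^esub> = \<one>\<^bsub>cob L (n + 1)\<^esub>"
    by (intro group_hom.hom_one group_hom_Mor_Ab Ch_Ab_comm_group Ch_Ab_Mor K)
  then show ?thesis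
    using Ch_Ab_Mor_cdiff[OF K(3) z'(1)] Mor_Ab_carrier[OF Ch_Ab_Mor[OF K(3)] z'(1)] z'(2)
    by (simp add: cocycles_def kernel_def)
qed

text \<open>The image of a coset under \<phi> may be smaller than a coset; multiplying by the
  coboundaries of L completes it. Nothing more is added, because \<phi> sends coboundaries of K to
  coboundaries of L.\<close>

lemma cohomology_map_coh_class:
  assumes K: "K \<in> Ob (Ch Ab)" "L \<in> Ob (Ch Ab)" "\<phi> \<in> Mor (Ch Ab) K L" and z: "z \<in> cocycles K n"
  shows "cohomology_map n K L \<phi> (coh_class K n z) = coh_class L n (\<phi> n z)"
proof -
  interpret GK: comm_group "cob K n" using K(1) by (rule Ch_Ab_comm_group)
  interpret GL: comm_group "cob L n" using K(2) by (rule Ch_Ab_comm_group)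
  interpret BK: subgroup "coboundaries K n" "cob K n" using subgroup_coboundaries[OF K(1)] .
  interpret BL: subgroup "coboundaries L n" "cob L n" using subgroup_coboundaries[OF K(2)] .
  interpret group_hom "cob K n" "cob L n" "\<phi> n"
    by (intro group_hom_Mor_Ab Ch_Ab_comm_group Ch_Ab_Mor K)
  have zc: "z \<in> carrier (cob K n)" using z cocycles_subset[of K n] by auto
  have bd: "\<phi> n b \<in> coboundaries L n" if b: "b \<in> coboundaries K n" for b
  proof -
    obtain s where s: "s \<in> carrier (cob K (n - 1))" "b = cdiff K (n - 1) s"
      using b by (auto simp: coboundaries_def)
    then have "\<phi> n b = cdiff L (n - 1) (\<phi> (n - 1) s)"
      using Ch_Ab_Mor_cdiff[OF K(3), of s "n - 1"] by simp
    then show ?thesis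
      using Mor_Ab_carrier[OF Ch_Ab_Mor[OF K(3)] s(1)] by (simp add: coboundaries_def)
  qed
  have "coboundaries L n <#>\<^bsub>cob L n\<^esub> (\<phi> n ` coh_class K n z) = coh_class L n (\<phi> n z)"
  proof (intro equalityI subsetI)
    fix t assume "t \<in> coboundaries L n <#>\<^bsub>cob L n\<^esub> (\<phi> n ` coh_class K n z)"
    then obtain b c where b: "b \<in> coboundaries L n" "c \<in> coboundaries K n"
      and t: "t = b \<otimes>\<^bsub>cob L n\<^esub> \<phi> n (c \<otimes>\<^bsub>cob K n\<^esub> z)"
      by (auto simp: set_mult_def coh_class_def r_coset_def)
    have "t = (b \<otimes>\<^bsub>cob L n\<^esub> \<phi> n c) \<otimes>\<^bsub>cob L n\<^esub> \<phi> n z"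
      using b zc by (simp add: t GL.m_assoc)
    then show "t \<in> coh_class L n (\<phi> n z)"
      using b bd by (auto simp: coh_class_def r_coset_def intro: BL.m_closed)
  next
    fix t assume "t \<in> coh_class L n (\<phi> n z)"
    moreover have "z \<in> coh_class K n z"
      unfolding coh_class_def using GK.rcos_self[OF zc subgroup_coboundaries[OF K(1)]] .
    ultimately show "t \<in> coboundaries L n <#>\<^bsub>cob L n\<^esub> (\<phi> n ` coh_class K n z)"
      by (auto simp: set_mult_def coh_class_def[of L] r_coset_def)
  qed
  then show ?thesis
    using z by (simp add: cohomology_map_def carrier_cohomology)
qed

lemma cohomology_map_in_Mor:
  assumes K: "K \<in> Ob (Ch Ab)" "L \<in> Ob (Ch Ab)" "\<phi> \<in> Mor (Ch Ab) K L"
  shows "cohomology_map n K L \<phi> \<in> Mor Ab (cohomology n K) (cohomology n L)"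
proof -
  have "cohomology_map n K L \<phi> \<in> hom (cohomology n K) (cohomology n L)"
  proof (rule homI)
    fix a assume "a \<in> carrier (cohomology n K)"
    then show "cohomology_map n K L \<phi> a \<in> carrier (cohomology n L)"
      by (auto simp: carrier_cohomology cohomology_map_coh_class K Mor_cocycles[OF K])
  next
    fix a b assume "a \<in> carrier (cohomology n K)" "b \<in> carrier (cohomology n K)"
    then obtain z w where z: "z \<in> cocycles K n" "a = coh_class K n z" "w \<in> cocycles K n" "b = coh_class K n w"
      by (auto simp: carrier_cohomology)
    moreover have "z \<otimes>\<^bsub>cob K n\<^esub> w \<in> cocycles K n"
      using subgroup_cocycles[OF K(1)] z by (simp add: subgroup.m_closed)
    moreover have "\<phi> n (z \<otimes>\<^bsub>cob K n\<^esub> w) = \<phi> n z \<otimes>\<^bsub>cob L n\<^esub> \<phi> n w"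
      using z cocycles_subset[of K n] by (intro Mor_Ab_mult[OF Ch_Ab_Mor[OF K(3)]]) auto
    ultimately show "cohomology_map n K L \<phi> (a \<otimes>\<^bsub>cohomology n K\<^esub> b) =
        cohomology_map n K L \<phi> a \<otimes>\<^bsub>cohomology n L\<^esub> cohomology_map n K L \<phi> b"
      by (simp add: mult_cohomology K cohomology_map_coh_class Mor_cocycles[OF K])
  qed
  then show ?thesis by (simp add: Mor_Ab cohomology_map_def)
qed

lemma Ch_Ab_Idn: "Idn (Ch Ab) K n = (\<lambda>s\<in>carrier (cob K n). s)"
  by (simp add: Ch_def Idn_Ab)

lemma Ch_Ab_Cmp: "Cmp (Ch Ab) K L M \<psi> \<phi> n = compose (carrier (cob K n)) (\<psi> n) (\<phi> n)"
  by (simp add: Ch_def Cmp_Ab)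

lemma is_functor_H_Ab: "is_functor (Ch (Ab :: ('u monoid, 'u \<Rightarrow> 'u) zcategory)) Ab (H_Ab n)"
proof -
  have C: "is_category (Ch (Ab :: ('u monoid, 'u \<Rightarrow> 'u) zcategory))" by (rule is_category_Ch) (rule is_category_Ab)
  have "cohomology_map n K K (Idn (Ch Ab) K) = Idn Ab (cohomology n K)"
    if K: "K \<in> Ob (Ch Ab)" for K :: "'u dab_obj"
  proof (rule extensionalityI[where A = "carrier (cohomology n K)"])
    fix a assume "a \<in> carrier (cohomology n K)"
    then obtain z where z: "z \<in> cocycles K n" "a = coh_class K n z" by (auto simp: carrier_cohomology)
    then have "z \<in> carrier (cob K n)" using cocycles_subset[of K n] by auto
    with z show "cohomology_map n K K (Idn (Ch Ab) K) a = Idn Ab (cohomology n K) a"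
      by (simp add: cohomology_map_coh_class Idn_in_Mor C K Ch_Ab_Idn Idn_Ab carrier_cohomology)
  qed (simp_all add: cohomology_map_def Idn_Ab)
  moreover have "cohomology_map n K M (Cmp (Ch Ab) K L M \<psi> \<phi>) =
      Cmp Ab (cohomology n K) (cohomology n L) (cohomology n M)
        (cohomology_map n L M \<psi>) (cohomology_map n K L \<phi>)"
    if K: "K \<in> Ob (Ch Ab)" "L \<in> Ob (Ch Ab)" "M \<in> Ob (Ch Ab)" "\<phi> \<in> Mor (Ch Ab) K L" "\<psi> \<in> Mor (Ch Ab) L M"
    for K L M :: "'u dab_obj" and \<phi> \<psi>
  proof (rule extensionalityI[where A = "carrier (cohomology n K)"])
    fix a assume a: "a \<in> carrier (cohomology n K)"
    then obtain z where z: "z \<in> cocycles K n" "a = coh_class K n z" by (auto simp: carrier_cohomology)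
    then have "z \<in> carrier (cob K n)" using cocycles_subset[of K n] by auto
    with z a show "cohomology_map n K M (Cmp (Ch Ab) K L M \<psi> \<phi>) a =
        Cmp Ab (cohomology n K) (cohomology n L) (cohomology n M)
        (cohomology_map n L M \<psi>) (cohomology_map n K L \<phi>) a"
      using cohomology_map_coh_class[OF K(1,3) Cmp_in_Mor[OF C K] z(1)]
        cohomology_map_coh_class[OF K(1,2,4) z(1)] Mor_cocycles[OF K(1,2,4) z(1)]
      by (simp add: cohomology_map_coh_class[OF K(2,3,5)] Ch_Ab_Cmp Cmp_Ab compose_eq)
  qed (simp_all add: cohomology_map_def Cmp_Ab)
  ultimately show ?thesis
    unfolding is_functor_def H_Ab_def by (simp add: comm_group_cohomology cohomology_map_in_Mor)
qed

lemma is_category_D_Ab: "is_category D_Ab"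
  unfolding D_Ab_def by (rule is_category_localization)

text \<open>Quasi-isomorphisms are by definition the maps that every \<open>H_Ab n\<close> sends to
  isomorphisms, so each of these functors descends.\<close>

lemma is_functor_H_D: "is_functor D_Ab Ab (H_D n)"
  unfolding D_Ab_def H_D_def
  by (intro is_functor_loc_lift is_category_Ch is_category_Ab is_functor_H_Ab)
    (auto simp: inverts_def qis_Ab_def H_Ab_def)

section \<open>Etale maps\<close>

text \<open>Local homeomorphism, split into three conditions that can be verified separately; the
  next lemma matches it with the form used in \<open>is_sheaf\<close>.\<close>

definition etale :: "'e topology \<Rightarrow> 'a topology \<Rightarrow> ('e \<Rightarrow> 'a) \<Rightarrow> bool" where
  "etale E X p \<longleftrightarrow> continuous_map E X p \<and> open_map E X p \<and>
     (\<forall>e\<in>topspace E. \<exists>U. openin E U \<and> e \<in> U \<and> inj_on p U)"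

lemma etale_continuous_map: "etale E X p \<Longrightarrow> continuous_map E X p"
  by (simp add: etale_def)

text \<open>From left to right, a continuous open map that is injective on an open U is a
  homeomorphism from U onto its open image. Conversely, continuity and openness can be checked near
  each point of the source.\<close>

lemma etale_iff_local_homeomorphism:
  "etale E X p \<longleftrightarrow> (\<forall>e\<in>topspace E. \<exists>U. openin E U \<and> e \<in> U \<and> openin X (p ` U) \<and>
     homeomorphic_map (subtopology E U) (subtopology X (p ` U)) p)" (is "_ \<longleftrightarrow> ?R")
proof
  assume et: "etale E X p"
  show ?R
  proof
    fix e assume "e \<in> topspace E"
    then obtain U where U: "openin E U" "e \<in> U" "inj_on p U"
      using et by (auto simp: etale_def)
    have sub: "U \<subseteq> topspace E" using U(1) by (rule openin_subset)
    have "openin X (p ` U)" using et U(1) by (auto simp: etale_def open_map_def)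
    moreover have "homeomorphic_map (subtopology E U) (subtopology X (p ` U)) p"
    proof (rule bijective_open_imp_homeomorphic_map)
      show "continuous_map (subtopology E U) (subtopology X (p ` U)) p"
        using et by (auto simp: etale_def continuous_map_in_subtopology continuous_map_from_subtopology)
      show "open_map (subtopology E U) (subtopology X (p ` U)) p"
        using et U by (intro open_map_into_subtopology open_map_from_subtopology) (auto simp: etale_def)
      show "p ` topspace (subtopology E U) = topspace (subtopology X (p ` U))"
        using sub et by (auto simp: etale_def continuous_map_def)
      show "inj_on p (topspace (subtopology E U))"
        using U(3) by (auto intro: inj_on_subset)
    qed
    ultimately show "\<exists>U. openin E U \<and> e \<in> U \<and> openin X (p ` U) \<and>
        homeomorphic_map (subtopology E U) (subtopology X (p ` U)) p"
      using U by blast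
  qed
next
  assume R: ?R
  show "etale E X p"
    unfolding etale_def
  proof (intro conjI ballI)
    fix e assume "e \<in> topspace E"
    then obtain U where U: "openin E U" "e \<in> U"
      "homeomorphic_map (subtopology E U) (subtopology X (p ` U)) p"
      using R by blast
    then have "inj_on p (topspace (subtopology E U))"
      by (auto dest: homeomorphic_imp_injective_map)
    then have "inj_on p U" using openin_subset[OF U(1)] by (simp add: Int_absorb1)
    with U show "\<exists>U. openin E U \<and> e \<in> U \<and> inj_on p U" by blast
  next
    show "open_map E X p"
      unfolding open_map_def
    proof (intro allI impI)
      fix W assume W: "openin E W"
      show "openin X (p ` W)"
      proof (subst openin_subopen, intro ballI)
        fix x assume "x \<in> p ` W"
        then obtain e where e: "e \<in> W" "x = p e" by auto
        then have "e \<in> topspace E" using openin_subset[OF W] by auto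
        then obtain U where U: "openin E U" "e \<in> U" "openin X (p ` U)"
          "homeomorphic_map (subtopology E U) (subtopology X (p ` U)) p"
          using R by blast
        have "openin (subtopology E U) (U \<inter> W)" using W by (simp add: openin_subtopology_Int2)
        then have "openin (subtopology X (p ` U)) (p ` (U \<inter> W))"
          using homeomorphic_imp_open_map[OF U(4)] by (simp add: open_map_def)
        then have "openin X (p ` (U \<inter> W))"
          using U(3) by (simp add: openin_open_subtopology)
        then show "\<exists>T. openin X T \<and> x \<in> T \<and> T \<subseteq> p ` W" using e U(2) by blast
      qed
    qed
  next
    show "continuous_map E X p"
      unfolding continuous_map
    proof (intro conjI allI impI)
      show "p ` topspace E \<subseteq> topspace X"
        using R openin_subset by blast
      fix V assume V: "openin X V"
      show "openin E {e \<in> topspace E. p e \<in> V}"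
      proof (subst openin_subopen, intro ballI)
        fix e assume e: "e \<in> {e \<in> topspace E. p e \<in> V}"
        then obtain U where U: "openin E U" "e \<in> U" "openin X (p ` U)"
          "homeomorphic_map (subtopology E U) (subtopology X (p ` U)) p"
          using R by blast
        have "openin (subtopology X (p ` U)) (p ` U \<inter> V)" using V by (simp add: openin_subtopology_Int2)
        from openin_continuous_map_preimage[OF homeomorphic_imp_continuous_map[OF U(4)] this]
        have "openin (subtopology E U) {e \<in> topspace E \<inter> U. p e \<in> p ` U \<inter> V}" by simp
        then have "openin E {e \<in> topspace E \<inter> U. p e \<in> p ` U \<inter> V}"
          using U(1) by (simp add: openin_open_subtopology)
        moreover have "e \<in> {e \<in> topspace E \<inter> U. p e \<in> p ` U \<inter> V}" using e U(2) by auto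
        moreover have "{e \<in> topspace E \<inter> U. p e \<in> p ` U \<inter> V} \<subseteq> {e \<in> topspace E. p e \<in> V}" by auto
        ultimately show "\<exists>T. openin E T \<and> e \<in> T \<and> T \<subseteq> {e \<in> topspace E. p e \<in> V}" by blast
      qed
    qed
  qed
qed

text \<open>Near h e the projection q is injective, so a nearby point of E' is determined by its
  base point. If that base point lies in the open set p(W'), for a suitable part W' of W, the point
  is h d for some d in W.\<close>

lemma etale_imp_open_map_over:
  assumes E: "etale E X p" and E': "etale E' X q" and h: "continuous_map E E' h"
    and over: "\<And>e. e \<in> topspace E \<Longrightarrow> q (h e) = p e"
  shows "open_map E E' h"
  unfolding open_map_def
proof (intro allI impI)
  fix W assume W: "openin E W"
  show "openin E' (h ` W)"
  proof (subst openin_subopen, intro ballI)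
    fix y assume "y \<in> h ` W"
    then obtain e where e: "e \<in> W" "y = h e" by auto
    have et: "e \<in> topspace E" using e openin_subset[OF W] by auto
    then have "h e \<in> topspace E'" using h by (auto simp: continuous_map_def)
    then obtain U where U: "openin E' U" "h e \<in> U" "inj_on q U" using E' by (auto simp: etale_def)
    \<comment> \<open>Shrinking W to the points sent into U puts both y and h d into U, where
      injectivity of q applies.\<close>
    let ?W = "{d \<in> topspace E. h d \<in> U} \<inter> W"
    have "openin E ?W" using openin_continuous_map_preimage[OF h U(1)] W by blast
    then have "openin X (p ` ?W)" using E by (simp add: etale_def open_map_def)
    then have "openin E' {y \<in> topspace E'. q y \<in> p ` ?W}"
      using E' by (intro openin_continuous_map_preimage) (auto simp: etale_def)
    then have "openin E' (U \<inter> {y \<in> topspace E'. q y \<in> p ` ?W})" using U(1) by blast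
    moreover have "U \<inter> {y \<in> topspace E'. q y \<in> p ` ?W} \<subseteq> h ` W"
    proof
      fix y assume y: "y \<in> U \<inter> {y \<in> topspace E'. q y \<in> p ` ?W}"
      then obtain d where d: "d \<in> topspace E" "h d \<in> U" "d \<in> W" "q y = p d" by auto
      then have "q y = q (h d)" using over by simp
      then have "y = h d" using U(3) y d by (auto dest: inj_onD)
      then show "y \<in> h ` W" using d by blast
    qed
    moreover have "y \<in> U \<inter> {y \<in> topspace E'. q y \<in> p ` ?W}"
      using e et U openin_subset[OF U(1)] over by auto
    ultimately show "\<exists>T. openin E' T \<and> y \<in> T \<and> T \<subseteq> h ` W" by blast
  qed
qed

lemma etale_subtopology:
  assumes "etale E X p" "openin E V" shows "etale (subtopology E V) X p"
  unfolding etale_def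
proof (intro conjI ballI)
  show "continuous_map (subtopology E V) X p" "open_map (subtopology E V) X p"
    using assms by (auto simp: etale_def continuous_map_from_subtopology open_map_from_subtopology)
  fix e assume "e \<in> topspace (subtopology E V)"
  then obtain U where "openin E U" "e \<in> U" "inj_on p U" "e \<in> V" using assms by (auto simp: etale_def)
  then show "\<exists>U. openin (subtopology E V) U \<and> e \<in> U \<and> inj_on p U"
    by (intro exI[of _ "V \<inter> U"]) (auto simp: openin_subtopology_Int2 intro: inj_on_subset)
qed

lemma etale_compose:
  assumes "etale E X p" "etale X Y q" shows "etale E Y (q \<circ> p)"
  unfolding etale_def
proof (intro conjI ballI)
  show "continuous_map E Y (q \<circ> p)" "open_map E Y (q \<circ> p)"
    using assms by (auto simp: etale_def intro: continuous_map_compose open_map_compose)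
  fix e assume e: "e \<in> topspace E"
  then obtain U where U: "openin E U" "e \<in> U" "inj_on p U" using assms by (auto simp: etale_def)
  have "p e \<in> topspace X" using e assms by (auto simp: etale_def continuous_map_def)
  then obtain V where V: "openin X V" "p e \<in> V" "inj_on q V" using assms by (auto simp: etale_def)
  have "openin E {e \<in> topspace E. p e \<in> V}"
    using V assms by (intro openin_continuous_map_preimage) (auto simp: etale_def)
  then have "openin E (U \<inter> {e \<in> topspace E. p e \<in> V})" using U by blast
  moreover have "inj_on (q \<circ> p) (U \<inter> {e \<in> topspace E. p e \<in> V})"
    using U(3) V(3) by (auto simp: inj_on_def)
  ultimately show "\<exists>U. openin E U \<and> e \<in> U \<and> inj_on (q \<circ> p) U"
    using e U V by (intro exI[of _ "U \<inter> {e \<in> topspace E. p e \<in> V}"]) auto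
qed

text \<open>Openness of the projection to X comes from openness of p. Local injectivity is inherited
  from a sheet U of E: there e is determined by p e, which equals q x.\<close>

lemma etale_fibre_product:
  assumes E: "etale E Y p" and q: "continuous_map X Y q"
  shows "etale (subtopology (prod_topology X E) {(x, e). q x = p e}) X fst"
  unfolding etale_def
proof (intro conjI ballI)
  let ?P = "subtopology (prod_topology X E) {(x, e). q x = p e}"
  show "continuous_map ?P X fst"
    by (intro continuous_map_from_subtopology continuous_map_fst)
  show "open_map ?P X fst"
    unfolding open_map_def
  proof (intro allI impI)
    fix W assume "openin ?P W"
    then obtain T where T: "openin (prod_topology X E) T" "W = T \<inter> {(x, e). q x = p e}"
      by (auto simp: openin_subtopology)
    show "openin X (fst ` W)"
    proof (subst openin_subopen, intro ballI)
      fix x assume "x \<in> fst ` W"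
      then obtain e where e: "(x, e) \<in> T" "q x = p e" using T by auto
      then obtain A B where AB: "openin X A" "openin E B" "x \<in> A" "e \<in> B" "A \<times> B \<subseteq> T"
        using T(1) unfolding openin_prod_topology_alt by metis
      \<comment> \<open>Over such a point x' some e' in B satisfies p e' = q x', so (x', e') lies in
        the box inside T and in the fibre product.\<close>
      let ?A = "A \<inter> {x \<in> topspace X. q x \<in> p ` B}"
      have "openin Y (p ` B)" using E AB by (auto simp: etale_def open_map_def)
      then have "openin X ?A" using openin_continuous_map_preimage[OF q] AB(1) by blast
      moreover have "x \<in> ?A" using AB e openin_subset[OF AB(1)] by auto
      moreover have "?A \<subseteq> fst ` W" using AB(5) T(2) by (force simp: image_iff)
      ultimately show "\<exists>T. openin X T \<and> x \<in> T \<and> T \<subseteq> fst ` W" by blast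
    qed
  qed
  fix d assume d: "d \<in> topspace ?P"
  then have "snd d \<in> topspace E" by auto
  then obtain U where U: "openin E U" "snd d \<in> U" "inj_on p U" using E by (auto simp: etale_def)
  have "openin ?P ((topspace X \<times> U) \<inter> {(x, e). q x = p e})"
    using U(1) unfolding openin_subtopology
    by (intro exI[of _ "topspace X \<times> U"]) (simp add: openin_prod_Times_iff)
  moreover have "inj_on fst ((topspace X \<times> U) \<inter> {(x, e). q x = p e})"
    using U(3) by (auto simp: inj_on_def)
  ultimately show "\<exists>U. openin ?P U \<and> d \<in> U \<and> inj_on fst U"
    using d U by (intro exI[of _ "(topspace X \<times> U) \<inter> {(x, e). q x = p e}"]) auto
qed

section \<open>Sheaves\<close>

abbreviation total_map :: "('a \<Rightarrow> 'u \<Rightarrow> 'v) \<Rightarrow> 'a \<times> 'u \<Rightarrow> 'a \<times> 'v" where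
  "total_map \<phi> \<equiv> \<lambda>(x, s). (x, \<phi> x s)"

lemma is_sheaf_iff:
  "is_sheaf X F \<longleftrightarrow>
     stalk F \<in> extensional (topspace X) \<and>
     (\<forall>x\<in>topspace X. comm_group (stalk F x)) \<and>
     topspace (espace F) = (SIGMA x:topspace X. carrier (stalk F x)) \<and>
     etale (espace F) X fst \<and>
     continuous_map
       (subtopology (prod_topology (espace F) (espace F)) {(d, e). fst d = fst e}) (espace F)
       (\<lambda>(d, e). (fst d, snd d \<otimes>\<^bsub>stalk F (fst d)\<^esub> snd e)) \<and>
     continuous_map (espace F) (espace F) (\<lambda>(x, s). (x, inv\<^bsub>stalk F x\<^esub> s))"
  unfolding is_sheaf_def etale_iff_local_homeomorphism ..

lemma Ob_Sh [simp]: "Ob (Sh X) = {F. is_sheaf X F}" by (simp add: Sh_def)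

lemma Mor_Sh: "Mor (Sh X) F G = {\<phi> \<in> (\<Pi>\<^sub>E x\<in>topspace X. Mor Ab (stalk F x) (stalk G x)).
    continuous_map (espace F) (espace G) (total_map \<phi>)}"
  by (simp add: Sh_def)

lemma Mor_Sh_stalk: "\<phi> \<in> Mor (Sh X) F G \<Longrightarrow> x \<in> topspace X \<Longrightarrow> \<phi> x \<in> Mor Ab (stalk F x) (stalk G x)"
  by (auto simp: Mor_Sh)

lemma Mor_Sh_continuous: "\<phi> \<in> Mor (Sh X) F G \<Longrightarrow> continuous_map (espace F) (espace G) (total_map \<phi>)"
  by (simp add: Mor_Sh)

lemma Idn_Sh: "Idn (Sh X) F = (\<lambda>x\<in>topspace X. Idn Ab (stalk F x))" by (simp add: Sh_def)

lemma Cmp_Sh: "Cmp (Sh X) F G H \<psi> \<phi> =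
    (\<lambda>x\<in>topspace X. Cmp Ab (stalk F x) (stalk G x) (stalk H x) (\<psi> x) (\<phi> x))"
  by (simp add: Sh_def)

lemma Zmor_Sh: "Zmor (Sh X) F G = (\<lambda>x\<in>topspace X. Zmor Ab (stalk F x) (stalk G x))"
  by (simp add: Sh_def)

lemma is_sheaf_stalk: "is_sheaf X F \<Longrightarrow> x \<in> topspace X \<Longrightarrow> comm_group (stalk F x)"
  by (simp add: is_sheaf_def)

lemma is_sheaf_topspace: "is_sheaf X F \<Longrightarrow> topspace (espace F) = (SIGMA x:topspace X. carrier (stalk F x))"
  by (simp add: is_sheaf_def)

lemma is_sheaf_etale: "is_sheaf X F \<Longrightarrow> etale (espace F) X fst"
  by (simp add: is_sheaf_iff)

lemma is_category_Sh: "is_category (Sh X :: (('a, 'u) sheaf, 'a \<Rightarrow> 'u \<Rightarrow> 'u) zcategory)"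
proof -
  note A = is_category_Ab
  have "Idn (Sh X) F \<in> Mor (Sh X) F F" if F: "is_sheaf X F" for F :: "('a, 'u) sheaf"
  proof -
    have "continuous_map (espace F) (espace F) (total_map (Idn (Sh X) F))"
      by (rule continuous_map_eq[OF continuous_map_id])
        (auto simp: is_sheaf_topspace[OF F] Idn_Sh Idn_Ab)
    then show ?thesis
      using Idn_in_Mor[OF A] is_sheaf_stalk[OF F] by (auto simp: Mor_Sh Idn_Sh)
  qed
  moreover have "Cmp (Sh X) F G H \<psi> \<phi> \<in> Mor (Sh X) F H"
    if o: "is_sheaf X F" "is_sheaf X G" "is_sheaf X H" and m: "\<phi> \<in> Mor (Sh X) F G" "\<psi> \<in> Mor (Sh X) G H"
    for F G H :: "('a, 'u) sheaf" and \<phi> \<psi>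
  proof -
    have "continuous_map (espace F) (espace H) (total_map (Cmp (Sh X) F G H \<psi> \<phi>))"
      by (rule continuous_map_eq[OF continuous_map_compose[OF m[THEN Mor_Sh_continuous]]])
        (auto simp: is_sheaf_topspace[OF o(1)] Cmp_Sh Cmp_Ab compose_eq)
    then show ?thesis
      using o[THEN is_sheaf_stalk] m[THEN Mor_Sh_stalk]
      by (auto simp: Mor_Sh Cmp_Sh intro!: Cmp_in_Mor[OF A])
  qed
  moreover have "Cmp (Sh X) F G G (Idn (Sh X) G) \<phi> = \<phi> \<and> Cmp (Sh X) F F G \<phi> (Idn (Sh X) F) = \<phi>"
    if o: "is_sheaf X F" "is_sheaf X G" and m: "\<phi> \<in> Mor (Sh X) F G" for F G :: "('a, 'u) sheaf" and \<phi>
    using m o[THEN is_sheaf_stalk] Mor_Sh_stalk[OF m] unfolding Cmp_Sh Idn_Sh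
    by (intro conjI; intro extensionalityI[where A = "topspace X"])
      (auto simp: category_laws[OF A] Mor_Sh PiE_def)
  moreover have "Cmp (Sh X) F H K h (Cmp (Sh X) F G H g f) = Cmp (Sh X) F G K (Cmp (Sh X) G H K h g) f"
    if o: "is_sheaf X F" "is_sheaf X G" "is_sheaf X H" "is_sheaf X K"
      and m: "f \<in> Mor (Sh X) F G" "g \<in> Mor (Sh X) G H" "h \<in> Mor (Sh X) H K"
    for F G H K :: "('a, 'u) sheaf" and f g h
    using o[THEN is_sheaf_stalk] m[THEN Mor_Sh_stalk] unfolding Cmp_Sh
    by (intro restrict_ext) (simp add: Cmp_assoc[OF A])
  ultimately show ?thesis
    unfolding is_category_def by simp
qed

section \<open>Inverse images\<close>

lemma FOb_inv_im: "FOb (inv_im X f) F = \<lparr> stalk = (\<lambda>x\<in>topspace X. stalk F (f x)),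
    espace = pullback_topology (SIGMA x:topspace X. carrier (stalk F (f x)))
      (\<lambda>(x, s). (x, (f x, s))) (prod_topology X (espace F)) \<rparr>"
  by (simp add: inv_im_def)

lemma FMor_inv_im: "FMor (inv_im X f) F G \<phi> = (\<lambda>x\<in>topspace X. \<phi> (f x))"
  by (simp add: inv_im_def)

lemma stalk_inv_im [simp]: "x \<in> topspace X \<Longrightarrow> stalk (FOb (inv_im X f) F) x = stalk F (f x)"
  by (simp add: FOb_inv_im)

context
  fixes X :: "'a topology" and Y :: "'b topology" and f :: "'a \<Rightarrow> 'b"
  assumes f: "continuous_map X Y f"
begin

lemma inverse_image_base_in_topspace: "x \<in> topspace X \<Longrightarrow> f x \<in> topspace Y"
  using f by (auto simp: continuous_map_def)

lemma topspace_inv_im: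
  assumes "is_sheaf Y F"
  shows "topspace (espace (FOb (inv_im X f) F)) = (SIGMA x:topspace X. carrier (stalk F (f x)))"
  using assms by (auto simp: FOb_inv_im topspace_pullback_topology is_sheaf_topspace inverse_image_base_in_topspace)

lemma continuous_map_inv_im_fst: "continuous_map (espace (FOb (inv_im X f) F)) X fst"
proof -
  have "continuous_map (espace (FOb (inv_im X f) F)) X (fst \<circ> (\<lambda>(x, s). (x, (f x, s))))"
    unfolding FOb_inv_im by (simp only: sheaf.select_convs) (intro continuous_map_pullback continuous_map_fst)
  then show ?thesis by (simp add: comp_def case_prod_unfold)
qed

lemma continuous_map_inv_im_canonical:
  "continuous_map (espace (FOb (inv_im X f) F)) (espace F) (\<lambda>(x, s). (f x, s))"
proof -
  have "continuous_map (espace (FOb (inv_im X f) F)) (espace F) (snd \<circ> (\<lambda>(x, s). (x, (f x, s))))"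
    unfolding FOb_inv_im by (simp only: sheaf.select_convs) (intro continuous_map_pullback continuous_map_snd)
  then show ?thesis by (simp add: comp_def case_prod_unfold)
qed

text \<open>The universal property of the fibre product; all later continuity proofs for inverse
  images reduce to the component in X and the component in the etale space of F.\<close>

lemma continuous_map_into_inv_im:
  assumes "continuous_map T X (\<lambda>t. fst (k t))" "continuous_map T (espace F) (\<lambda>t. (f (fst (k t)), snd (k t)))"
    and "is_sheaf Y F"
  shows "continuous_map T (espace (FOb (inv_im X f) F)) k"
proof -
  have "continuous_map T (prod_topology X (espace F)) (\<lambda>t. (fst (k t), (f (fst (k t)), snd (k t))))"
    using assms(1,2) by (simp add: continuous_map_paired)
  \<comment> \<open>Landing in the fibre product follows from the components: a point of
    \<open>espace F\<close> over f x is an element of the stalk there.\<close>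
  moreover have "k t \<in> (SIGMA x:topspace X. carrier (stalk F (f x)))" if "t \<in> topspace T" for t
  proof -
    have "fst (k t) \<in> topspace X" "(f (fst (k t)), snd (k t)) \<in> topspace (espace F)"
      using assms that by (auto simp: continuous_map_def)
    then show ?thesis using assms(3) by (auto simp: is_sheaf_topspace mem_Sigma_iff case_prod_unfold
        intro!: SigmaI[of "fst (k t)" _ "snd (k t)", simplified])
  qed
  ultimately show ?thesis
    unfolding FOb_inv_im by (auto simp: comp_def case_prod_unfold intro!: continuous_map_pullback')
qed

text \<open>Points of f\<inverse>F are pairs (x, s) rather than (x, (f x, s)), so openness is read
  off from the literal fibre product, where the corresponding open set has the same projection to X.
  A sheet is obtained by pulling back a sheet of F along the canonical map.\<close>

lemma etale_inv_im:
  assumes F: "is_sheaf Y F"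
  shows "etale (espace (FOb (inv_im X f) F)) X fst"
  unfolding etale_def
proof (intro conjI ballI)
  let ?E = "espace (FOb (inv_im X f) F)" and ?g = "\<lambda>(x, s). (x, (f x, s))"
  let ?A = "SIGMA x:topspace X. carrier (stalk F (f x))"
  let ?P = "subtopology (prod_topology X (espace F)) {(x, e). f x = fst e}"
  have et: "etale ?P X fst"
    by (rule etale_fibre_product[OF is_sheaf_etale[OF F] f])
  show "continuous_map ?E X fst" by (rule continuous_map_inv_im_fst)
  show "open_map ?E X fst"
    unfolding open_map_def
  proof (intro allI impI)
    fix W assume "openin ?E W"
    then obtain T where T: "openin (prod_topology X (espace F)) T" "W = ?g -` T \<inter> ?A"
      by (auto simp: FOb_inv_im openin_pullback_topology)
    have "openin ?P (T \<inter> {(x, e). f x = fst e})"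
      using T by (auto simp: openin_subtopology)
    then have "openin X (fst ` (T \<inter> {(x, e). f x = fst e}))"
      using et by (auto simp: etale_def open_map_def)
    moreover have "fst ` (T \<inter> {(x, e). f x = fst e}) = fst ` W"
    proof (intro equalityI subsetI)
      fix x assume "x \<in> fst ` (T \<inter> {(x, e). f x = fst e})"
      then obtain s where s: "(x, (f x, s)) \<in> T" by auto
      then have "x \<in> topspace X" "(f x, s) \<in> topspace (espace F)"
        using openin_subset[OF T(1)] by auto
      then have "(x, s) \<in> W" using s T(2) by (auto simp: is_sheaf_topspace[OF F])
      then show "x \<in> fst ` W" by force
    qed (use T(2) in force)
    ultimately show "openin X (fst ` W)" by simp
  qed
  fix d assume d: "d \<in> topspace ?E"
  obtain x s where xs: "d = (x, s)" by force
  then have "(f x, s) \<in> topspace (espace F)"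
    using d by (auto simp: topspace_inv_im[OF F] is_sheaf_topspace[OF F] inverse_image_base_in_topspace)
  then obtain U where U: "openin (espace F) U" "(f x, s) \<in> U" "inj_on fst U"
    using is_sheaf_etale[OF F] unfolding etale_def by blast
  let ?U = "{e \<in> topspace ?E. (\<lambda>(x, s). (f x, s)) e \<in> U}"
  have "openin ?E ?U"
    by (rule openin_continuous_map_preimage[OF continuous_map_inv_im_canonical U(1)])
  moreover have "inj_on fst ?U"
    by (rule inj_onI) (use inj_onD[OF U(3)] in fastforce)
  moreover have "d \<in> ?U" using d U(2) xs by simp
  ultimately show "\<exists>U. openin ?E U \<and> d \<in> U \<and> inj_on fst U" by blast
qed

text \<open>Both group operations are obtained from the universal property: the component in X is a
  projection, the component in F is the operation of F after the canonical map.\<close>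

lemma is_sheaf_inv_im:
  assumes F: "is_sheaf Y F"
  shows "is_sheaf X (FOb (inv_im X f) F)"
  unfolding is_sheaf_iff
proof (intro conjI ballI)
  let ?E = "espace (FOb (inv_im X f) F)"
  let ?S = "subtopology (prod_topology ?E ?E) {(d, e). fst d = fst e}"
  let ?k = "\<lambda>(x, s). (f x, s)"
  show "stalk (FOb (inv_im X f) F) \<in> extensional (topspace X)" by (simp add: FOb_inv_im)
  show "comm_group (stalk (FOb (inv_im X f) F) x)" if "x \<in> topspace X" for x
    using that F by (simp add: is_sheaf_stalk inverse_image_base_in_topspace)
  show "topspace ?E = (SIGMA x:topspace X. carrier (stalk (FOb (inv_im X f) F) x))"
    by (auto simp: topspace_inv_im[OF F])
  show "etale ?E X fst" by (rule etale_inv_im[OF F])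
  have "continuous_map ?S ?E (\<lambda>(d, e). (fst d, snd d \<otimes>\<^bsub>stalk F (f (fst d))\<^esub> snd e))"
  proof (rule continuous_map_into_inv_im[OF _ _ F])
    have "continuous_map ?S X (fst \<circ> fst)"
      by (rule continuous_map_compose[OF continuous_map_from_subtopology[OF continuous_map_fst]
            continuous_map_inv_im_fst])
    then show "continuous_map ?S X (\<lambda>t. fst ((\<lambda>(d, e). (fst d, snd d \<otimes>\<^bsub>stalk F (f (fst d))\<^esub> snd e)) t))"
      by (simp add: comp_def case_prod_unfold)
    have "continuous_map ?S (espace F) (?k \<circ> fst)" "continuous_map ?S (espace F) (?k \<circ> snd)"
      by (intro continuous_map_compose[OF _ continuous_map_inv_im_canonical]
          continuous_map_from_subtopology continuous_map_fst continuous_map_snd)+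
    then have "continuous_map ?S (subtopology (prod_topology (espace F) (espace F)) {(d, e). fst d = fst e})
        (\<lambda>t. (?k (fst t), ?k (snd t)))"
      by (auto simp: continuous_map_in_subtopology continuous_map_paired comp_def)
    moreover have "continuous_map (subtopology (prod_topology (espace F) (espace F)) {(d, e). fst d = fst e})
        (espace F) (\<lambda>(d, e). (fst d, snd d \<otimes>\<^bsub>stalk F (fst d)\<^esub> snd e))"
      using F by (simp add: is_sheaf_iff)
    ultimately have "continuous_map ?S (espace F)
        ((\<lambda>(d, e). (fst d, snd d \<otimes>\<^bsub>stalk F (fst d)\<^esub> snd e)) \<circ> (\<lambda>t. (?k (fst t), ?k (snd t))))"
      by (rule continuous_map_compose)
    then show "continuous_map ?S (espace F)
        (\<lambda>t. (f (fst ((\<lambda>(d, e). (fst d, snd d \<otimes>\<^bsub>stalk F (f (fst d))\<^esub> snd e)) t)),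
              snd ((\<lambda>(d, e). (fst d, snd d \<otimes>\<^bsub>stalk F (f (fst d))\<^esub> snd e)) t)))"
      by (simp add: comp_def case_prod_unfold)
  qed
  \<comment> \<open>The stalk function of f\<inverse>F is cut off outside X, so it may be replaced
    by the stalks of F only on the topological space itself.\<close>
  then show "continuous_map ?S ?E
      (\<lambda>(d, e). (fst d, snd d \<otimes>\<^bsub>stalk (FOb (inv_im X f) F) (fst d)\<^esub> snd e))"
    by (rule continuous_map_eq) (auto simp: topspace_inv_im[OF F])
  have "continuous_map ?E ?E (\<lambda>(x, s). (x, inv\<^bsub>stalk F (f x)\<^esub> s))"
  proof (rule continuous_map_into_inv_im[OF _ _ F])
    show "continuous_map ?E X (\<lambda>t. fst ((\<lambda>(x, s). (x, inv\<^bsub>stalk F (f x)\<^esub> s)) t))"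
      using continuous_map_inv_im_fst by (simp add: case_prod_unfold)
    have "continuous_map ?E (espace F) ((\<lambda>(x, s). (x, inv\<^bsub>stalk F x\<^esub> s)) \<circ> ?k)"
      using F by (intro continuous_map_compose[OF continuous_map_inv_im_canonical]) (simp add: is_sheaf_iff)
    then show "continuous_map ?E (espace F)
        (\<lambda>t. (f (fst ((\<lambda>(x, s). (x, inv\<^bsub>stalk F (f x)\<^esub> s)) t)), snd ((\<lambda>(x, s). (x, inv\<^bsub>stalk F (f x)\<^esub> s)) t)))"
      by (simp add: comp_def case_prod_unfold)
  qed
  then show "continuous_map ?E ?E (\<lambda>(x, s). (x, inv\<^bsub>stalk (FOb (inv_im X f) F) x\<^esub> s))"
    by (rule continuous_map_eq) (auto simp: topspace_inv_im[OF F])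
qed

lemma FMor_inv_im_in_Mor:
  assumes F: "is_sheaf Y F" and G: "is_sheaf Y G" and \<phi>: "\<phi> \<in> Mor (Sh Y) F G"
  shows "FMor (inv_im X f) F G \<phi> \<in> Mor (Sh X) (FOb (inv_im X f) F) (FOb (inv_im X f) G)"
proof -
  let ?E = "espace (FOb (inv_im X f) F)" and ?E' = "espace (FOb (inv_im X f) G)"
  have "continuous_map ?E ?E' (\<lambda>(x, s). (x, \<phi> (f x) s))"
  proof (rule continuous_map_into_inv_im[OF _ _ G])
    show "continuous_map ?E X (\<lambda>t. fst ((\<lambda>(x, s). (x, \<phi> (f x) s)) t))"
      using continuous_map_inv_im_fst by (simp add: case_prod_unfold)
    from continuous_map_compose[OF continuous_map_inv_im_canonical Mor_Sh_continuous[OF \<phi>]]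
    show "continuous_map ?E (espace G)
        (\<lambda>t. (f (fst ((\<lambda>(x, s). (x, \<phi> (f x) s)) t)), snd ((\<lambda>(x, s). (x, \<phi> (f x) s)) t)))"
      by (simp add: comp_def case_prod_unfold)
  qed
  then have "continuous_map ?E ?E' (total_map (FMor (inv_im X f) F G \<phi>))"
    by (rule continuous_map_eq) (auto simp: topspace_inv_im[OF F] FMor_inv_im)
  then show ?thesis
    using Mor_Sh_stalk[OF \<phi>] inverse_image_base_in_topspace by (simp add: Mor_Sh FMor_inv_im)
qed

lemma is_functor_inv_im:
  "is_functor (Sh Y) (Sh X)
     (inv_im X f :: (('b, 'u) sheaf, 'b \<Rightarrow> 'u \<Rightarrow> 'u, ('a, 'u) sheaf, 'a \<Rightarrow> 'u \<Rightarrow> 'u) funct)"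
  unfolding is_functor_def
  by (auto simp: is_sheaf_inv_im FMor_inv_im_in_Mor)
    (auto simp: FMor_inv_im Idn_Sh Cmp_Sh inverse_image_base_in_topspace intro!: restrict_ext)

lemma inv_im_Zmor:
  "FMor (inv_im X f) F G (Zmor (Sh Y) F G) = Zmor (Sh X) (FOb (inv_im X f) F) (FOb (inv_im X f) G)"
  by (auto simp: FMor_inv_im Zmor_Sh inverse_image_base_in_topspace intro!: restrict_ext)

end

section \<open>Strict identities between inverse images\<close>

text \<open>Turns equality of etale spaces into two continuity checks for the identity, to which the
  universal property applies.\<close>

lemma topology_eqI_continuous_map:
  assumes "continuous_map S T (\<lambda>x. x)" "continuous_map T S (\<lambda>x. x)"
  shows "S = T"
proof (rule topology_eq[THEN iffD2], intro allI)
  fix U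
  have t: "topspace S = topspace T" using assms by (auto simp: continuous_map_def)
  have "{x \<in> topspace S. x \<in> U} = U" if "U \<subseteq> topspace S" using that by auto
  then show "openin S U \<longleftrightarrow> openin T U"
    using openin_continuous_map_preimage[OF assms(1), of U] openin_continuous_map_preimage[OF assms(2), of U]
      t openin_subset by metis
qed

text \<open>One direction composes the two canonical maps, the other applies the universal property
  once for f and once for g. The inner cut-off of stalks disappears because f maps X into Y.\<close>

lemma inv_im_comp:
  assumes f: "continuous_map X Y f" and g: "continuous_map Y Z g" and F: "is_sheaf Z F"
  shows "FOb (inv_im X f) (FOb (inv_im Y g) F) = FOb (inv_im X (g \<circ> f)) F"
proof -
  note gf = continuous_map_compose[OF f g]
  note GF = is_sheaf_inv_im[OF g F]
  let ?S = "espace (FOb (inv_im X f) (FOb (inv_im Y g) F))" and ?T = "espace (FOb (inv_im X (g \<circ> f)) F)"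
  have "?S = ?T"
  proof (rule topology_eqI_continuous_map)
    have "continuous_map ?S (espace F) ((\<lambda>(x, s). (g x, s)) \<circ> (\<lambda>(x, s). (f x, s)))"
      by (rule continuous_map_compose[OF continuous_map_inv_im_canonical[OF f]
            continuous_map_inv_im_canonical[OF g]])
    then show "continuous_map ?S ?T (\<lambda>x. x)"
      by (intro continuous_map_into_inv_im[OF gf _ _ F] continuous_map_inv_im_fst[OF f])
        (simp add: comp_def case_prod_unfold)
    show "continuous_map ?T ?S (\<lambda>x. x)"
    proof (intro continuous_map_into_inv_im[OF f _ _ GF] continuous_map_into_inv_im[OF g _ _ F]
        continuous_map_inv_im_fst[OF gf])
      show "continuous_map ?T Y (\<lambda>t. fst (f (fst t), snd t))"
        using continuous_map_compose[OF continuous_map_inv_im_fst[OF gf] f] by (simp add: comp_def)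
      show "continuous_map ?T (espace F) (\<lambda>t. (g (fst (f (fst t), snd t)), snd (f (fst t), snd t)))"
        using continuous_map_inv_im_canonical[OF gf] by (simp add: case_prod_unfold)
    qed
  qed
  moreover have "stalk (FOb (inv_im X f) (FOb (inv_im Y g) F)) = stalk (FOb (inv_im X (g \<circ> f)) F)"
    using f by (auto simp: FOb_inv_im continuous_map_def intro!: restrict_ext)
  ultimately show ?thesis by simp
qed

lemma funct_eq_on_inv_im_comp:
  assumes f: "continuous_map X Y f" and g: "continuous_map Y Z g"
  shows "funct_eq_on (Sh Z) (comp_funct (inv_im X f) (inv_im Y g)) (inv_im X (g \<circ> f))"
  using f unfolding funct_eq_on_def
  by (auto simp: inv_im_comp[OF f g] FMor_inv_im continuous_map_def intro!: restrict_ext)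

text \<open>Extensionality of the stalk function in \<open>is_sheaf\<close> makes this an equality
  of records, not merely agreement over X.\<close>

lemma inv_im_id:
  assumes F: "is_sheaf X F" shows "FOb (inv_im X id) F = F"
proof -
  have "espace (FOb (inv_im X id) F) = espace F"
  proof (rule topology_eqI_continuous_map)
    show "continuous_map (espace (FOb (inv_im X id) F)) (espace F) (\<lambda>x. x)"
      using continuous_map_inv_im_canonical[OF continuous_map_id] by (simp add: case_prod_unfold)
    show "continuous_map (espace F) (espace (FOb (inv_im X id) F)) (\<lambda>x. x)"
      using etale_continuous_map[OF is_sheaf_etale[OF F]]
      by (intro continuous_map_into_inv_im[OF continuous_map_id _ _ F]) simp_all
  qed
  moreover have "stalk (FOb (inv_im X id) F) = stalk F"
    using F by (auto simp: FOb_inv_im is_sheaf_def extensional_restrict)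
  ultimately show ?thesis by simp
qed

lemma funct_eq_on_inv_im_id: "funct_eq_on (Sh X) (inv_im X id) id_funct"
  unfolding funct_eq_on_def
  by (auto simp: inv_im_id id_funct_def FMor_inv_im Mor_Sh extensional_restrict PiE_def)

section \<open>Abelian groups as constant sheaves\<close>

abbreviation pt :: "unit topology" where "pt \<equiv> discrete_topology UNIV"

text \<open>All spaces involved, products included, are discrete; singletons serve as
  sheets.\<close>

lemma is_sheaf_point:
  assumes G: "comm_group G"
  shows "is_sheaf pt (FOb Ab_to_Sh_point G)"
proof -
  interpret G: comm_group G by fact
  show ?thesis
    unfolding is_sheaf_iff
  proof (intro conjI)
    show "etale (espace (FOb Ab_to_Sh_point G)) pt fst"
      unfolding etale_def
    proof (intro conjI ballI)
      fix e assume "e \<in> topspace (espace (FOb Ab_to_Sh_point G))"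
      then show "\<exists>U. openin (espace (FOb Ab_to_Sh_point G)) U \<and> e \<in> U \<and> inj_on fst U"
        by (intro exI[of _ "{e}"]) (simp add: Ab_to_Sh_point_def)
    qed (auto simp: Ab_to_Sh_point_def open_map_def)
  qed (auto simp: Ab_to_Sh_point_def G simp flip: prod_topology_discrete_topology)
qed

lemma is_functor_Ab_to_Sh_point:
  "is_functor Ab (Sh pt)
    (Ab_to_Sh_point :: ('u monoid, 'u \<Rightarrow> 'u, (unit, 'u) sheaf, unit \<Rightarrow> 'u \<Rightarrow> 'u) funct)"
proof -
  have "FMor Ab_to_Sh_point G H h \<in> Mor (Sh pt) (FOb Ab_to_Sh_point G) (FOb Ab_to_Sh_point H)"
    if "h \<in> Mor Ab G H" for G H :: "'u monoid" and h
    using that by (auto simp: Ab_to_Sh_point_def Mor_Sh Mor_Ab_carrier)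
  then show ?thesis
    unfolding is_functor_def
    by (simp add: is_sheaf_point) (simp add: Ab_to_Sh_point_def Idn_Sh Cmp_Sh restrict_def)
qed

lemma continuous_map_to_point: "continuous_map X pt (\<lambda>_. ())"
  by simp

lemma is_functor_proj_inv:
  "is_functor Ab (Sh X)
    (proj_inv X :: ('u monoid, 'u \<Rightarrow> 'u, ('a, 'u) sheaf, 'a \<Rightarrow> 'u \<Rightarrow> 'u) funct)"
  unfolding proj_inv_def
  by (rule is_functor_comp_funct[OF is_functor_Ab_to_Sh_point is_functor_inv_im[OF continuous_map_to_point]])

lemma proj_inv_Zmor:
  "FMor (proj_inv X) G H (Zmor Ab G H) = Zmor (Sh X) (FOb (proj_inv X) G) (FOb (proj_inv X) H)"
  by (auto simp: proj_inv_def FMor_inv_im Zmor_Sh Ab_to_Sh_point_def intro!: restrict_ext)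

lemma stalk_proj_inv [simp]: "x \<in> topspace X \<Longrightarrow> stalk (FOb (proj_inv X) G) x = G"
  by (simp add: proj_inv_def Ab_to_Sh_point_def)

lemma FMor_proj_inv: "FMor (proj_inv X) G H h = (\<lambda>x\<in>topspace X. h)"
  by (simp add: proj_inv_def Ab_to_Sh_point_def FMor_inv_im)

text \<open>The composite of f with the projection of Y is the projection of X, so on objects this
  is an instance of \<open>inv_im_comp\<close>.\<close>

lemma funct_eq_on_inv_im_proj_inv:
  assumes f: "continuous_map X Y f"
  shows "funct_eq_on Ab (comp_funct (inv_im X f) (proj_inv Y)) (proj_inv X)"
proof -
  have "(\<lambda>_. ()) \<circ> f = (\<lambda>_. ())" by auto
  then show ?thesis
    using f inv_im_comp[OF f continuous_map_to_point is_sheaf_point] unfolding funct_eq_on_def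
    by (auto simp: proj_inv_def FMor_inv_im Ab_to_Sh_point_def continuous_map_def intro!: restrict_ext)
qed

section \<open>Quasi-isomorphisms of complexes of sheaves\<close>

lemma Ch_Sh_is_sheaf: "K \<in> Ob (Ch (Sh X)) \<Longrightarrow> is_sheaf X (cob K n)"
  by (simp add: Ch_def)

lemma Ch_Sh_cdiff: "K \<in> Ob (Ch (Sh X)) \<Longrightarrow> cdiff K n \<in> Mor (Sh X) (cob K n) (cob K (n + 1))"
  by (simp add: Ch_def)

lemma Ch_Sh_Mor: "\<phi> \<in> Mor (Ch (Sh X)) K L \<Longrightarrow> \<phi> n \<in> Mor (Sh X) (cob K n) (cob L n)"
  by (simp add: Ch_def)

lemma cob_stalk_cpx [simp]: "cob (stalk_cpx K x) n = stalk (cob K n) x"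
  by (simp add: stalk_cpx_def)

lemma cdiff_stalk_cpx [simp]: "cdiff (stalk_cpx K x) n = cdiff K n x"
  by (simp add: stalk_cpx_def)

lemma stalk_cpx_in_Ob:
  assumes K: "K \<in> Ob (Ch (Sh X))" and x: "x \<in> topspace X"
  shows "stalk_cpx K x \<in> Ob (Ch Ab)"
proof -
  have "Cmp Ab (stalk (cob K n) x) (stalk (cob K (n + 1)) x) (stalk (cob K (n + 1 + 1)) x)
      (cdiff K (n + 1) x) (cdiff K n x) = Zmor Ab (stalk (cob K n) x) (stalk (cob K (n + 1 + 1)) x)" for n
  proof -
    have "Cmp (Sh X) (cob K n) (cob K (n + 1)) (cob K (n + 1 + 1)) (cdiff K (n + 1)) (cdiff K n) =
        Zmor (Sh X) (cob K n) (cob K (n + 1 + 1))"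
      using K unfolding Ch_def by simp
    from fun_cong[OF this, of x] show ?thesis using x by (simp add: Cmp_Sh Zmor_Sh)
  qed
  moreover have "cdiff K n x \<in> Mor Ab (stalk (cob K n) x) (stalk (cob K (n + 1)) x)" for n
    using Mor_Sh_stalk[OF Ch_Sh_cdiff[OF K] x] .
  moreover have "comm_group (stalk (cob K n) x)" for n
    using is_sheaf_stalk[OF Ch_Sh_is_sheaf[OF K] x] .
  ultimately show ?thesis by (simp add: Ch_def)
qed

lemma stalk_cpx_in_Mor:
  assumes \<phi>: "\<phi> \<in> Mor (Ch (Sh X)) K L" and x: "x \<in> topspace X"
  shows "(\<lambda>n. \<phi> n x) \<in> Mor (Ch Ab) (stalk_cpx K x) (stalk_cpx L x)"
proof -
  have "Cmp Ab (stalk (cob K n) x) (stalk (cob K (n + 1)) x) (stalk (cob L (n + 1)) x)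
      (\<phi> (n + 1) x) (cdiff K n x) =
    Cmp Ab (stalk (cob K n) x) (stalk (cob L n) x) (stalk (cob L (n + 1)) x) (cdiff L n x) (\<phi> n x)" for n
  proof -
    have "Cmp (Sh X) (cob K n) (cob K (n + 1)) (cob L (n + 1)) (\<phi> (n + 1)) (cdiff K n) =
        Cmp (Sh X) (cob K n) (cob L n) (cob L (n + 1)) (cdiff L n) (\<phi> n)"
      using \<phi> unfolding Ch_def by simp
    from fun_cong[OF this, of x] show ?thesis using x by (simp add: Cmp_Sh)
  qed
  moreover have "\<phi> n x \<in> Mor Ab (stalk (cob K n) x) (stalk (cob L n) x)" for n
    using Mor_Sh_stalk[OF Ch_Sh_Mor[OF \<phi>] x] .
  ultimately show ?thesis by (simp add: Ch_def)
qed

section \<open>Etale spaces of cocycles and of cohomology sheaves\<close>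

text \<open>The zero section is the image of the etale space under s \<mapsto> s - s. This map is
  continuous by continuity of the group operations and lies over X, hence it is open.\<close>

lemma openin_zero_section:
  assumes F: "is_sheaf X F"
  shows "openin (espace F) ((\<lambda>x. (x, \<one>\<^bsub>stalk F x\<^esub>)) ` topspace X)"
proof -
  let ?E = "espace F" and ?h = "\<lambda>(x, s). (x, s \<otimes>\<^bsub>stalk F x\<^esub> inv\<^bsub>stalk F x\<^esub> s)"
  let ?i = "\<lambda>(x, s). (x, inv\<^bsub>stalk F x\<^esub> s)" and ?m = "\<lambda>(d, e). (fst d, snd d \<otimes>\<^bsub>stalk F (fst d)\<^esub> snd e)"
  let ?S = "subtopology (prod_topology ?E ?E) {(d, e). fst d = fst e}"
  have "continuous_map ?E ?S (\<lambda>e. (e, ?i e))"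
    using F by (auto simp: is_sheaf_iff continuous_map_in_subtopology continuous_map_paired)
  moreover have "continuous_map ?S ?E ?m" using F by (simp add: is_sheaf_iff)
  ultimately have "continuous_map ?E ?E (?m \<circ> (\<lambda>e. (e, ?i e)))"
    by (rule continuous_map_compose)
  then have "continuous_map ?E ?E ?h" by (simp add: comp_def case_prod_unfold)
  then have "open_map ?E ?E ?h"
    by (intro etale_imp_open_map_over[OF is_sheaf_etale[OF F] is_sheaf_etale[OF F]]) auto
  then have "openin ?E (?h ` topspace ?E)" by (simp add: open_map_def)
  also have "?h ` topspace ?E = (\<lambda>e. (fst e, \<one>\<^bsub>stalk F (fst e)\<^esub>)) ` topspace ?E"
    using is_sheaf_stalk[OF F] by (intro image_cong)
      (auto simp: is_sheaf_topspace[OF F] comm_group.axioms group.r_inv)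
  \<comment> \<open>Every point of X is reached because its stalk contains the neutral
    element.\<close>
  also have "\<dots> = (\<lambda>x. (x, \<one>\<^bsub>stalk F x\<^esub>)) ` topspace X"
  proof -
    have "(x, \<one>\<^bsub>stalk F x\<^esub>) \<in> topspace ?E" if "x \<in> topspace X" for x
      using is_sheaf_stalk[OF F that] that
      by (simp add: is_sheaf_topspace[OF F] comm_group.axioms group.is_monoid monoid.one_closed)
    then show ?thesis by (force simp: is_sheaf_topspace[OF F])
  qed
  finally show ?thesis .
qed

text \<open>Cocycles are the preimage of the open zero section in degree n + 1 under the continuous
  differential.\<close>

lemma openin_cocycles:
  assumes K: "K \<in> Ob (Ch (Sh X))"
  shows "openin (espace (cob K n)) (SIGMA x:topspace X. cocycles (stalk_cpx K x) n)"
proof -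
  note F = Ch_Sh_is_sheaf[OF K]
  have "openin (espace (cob K n)) {e \<in> topspace (espace (cob K n)).
      total_map (cdiff K n) e \<in> (\<lambda>x. (x, \<one>\<^bsub>stalk (cob K (n + 1)) x\<^esub>)) ` topspace X}"
    by (rule openin_continuous_map_preimage[OF Mor_Sh_continuous[OF Ch_Sh_cdiff[OF K]]
          openin_zero_section[OF F]])
  also have "{e \<in> topspace (espace (cob K n)).
      total_map (cdiff K n) e \<in> (\<lambda>x. (x, \<one>\<^bsub>stalk (cob K (n + 1)) x\<^esub>)) ` topspace X} =
    (SIGMA x:topspace X. cocycles (stalk_cpx K x) n)"
    by (auto simp: is_sheaf_topspace[OF F] cocycles_def kernel_def)
  finally show ?thesis .
qed

lemma topspace_cocycle_space:
  assumes K: "K \<in> Ob (Ch (Sh X))"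
  shows "topspace (cocycle_space X n K) = (SIGMA x:topspace X. cocycles (stalk_cpx K x) n)"
  using openin_subset[OF openin_cocycles[OF K]] by (auto simp: cocycle_space_def)

lemma openin_cocycle_space:
  assumes K: "K \<in> Ob (Ch (Sh X))"
  shows "openin (cocycle_space X n K) V \<longleftrightarrow>
    openin (espace (cob K n)) V \<and> V \<subseteq> (SIGMA x:topspace X. cocycles (stalk_cpx K x) n)"
  unfolding cocycle_space_def by (rule openin_open_subtopology[OF openin_cocycles[OF K]])

lemma cocycle_class_eq: "cocycle_class n K = (\<lambda>(x, s). (x, coh_class (stalk_cpx K x) n s))"
  by (simp add: cocycle_class_def coh_class_def)

lemma stalk_cohomology_sheaf [simp]:
  "x \<in> topspace X \<Longrightarrow> stalk (cohomology_sheaf X n K) x = cohomology n (stalk_cpx K x)"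
  by (simp add: cohomology_sheaf_def)

text \<open>\<open>topology\<close> returns the prescribed open sets only for a predicate satisfying
  \<open>istopology\<close>; here this holds since preimages commute with intersections and
  unions.\<close>

lemma openin_cohomology_sheaf:
  "openin (espace (cohomology_sheaf X n K)) U \<longleftrightarrow>
     U \<subseteq> (SIGMA x:topspace X. carrier (cohomology n (stalk_cpx K x))) \<and>
     openin (cocycle_space X n K) {e \<in> topspace (cocycle_space X n K). cocycle_class n K e \<in> U}"
proof -
  let ?pre = "\<lambda>U. {e \<in> topspace (cocycle_space X n K). cocycle_class n K e \<in> U}"
  have "openin (cocycle_space X n K) (?pre (U \<inter> V))"
    if "openin (cocycle_space X n K) (?pre U)" "openin (cocycle_space X n K) (?pre V)" for U V
  proof -
    have "?pre (U \<inter> V) = ?pre U \<inter> ?pre V" by auto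
    then show ?thesis using that by (simp add: openin_Int)
  qed
  moreover have "openin (cocycle_space X n K) (?pre (\<Union>\<U>))"
    if "\<And>U. U \<in> \<U> \<Longrightarrow> openin (cocycle_space X n K) (?pre U)" for \<U>
  proof -
    have "?pre (\<Union>\<U>) = (\<Union>U\<in>\<U>. ?pre U)" by auto
    then show ?thesis using that by (auto intro: openin_Union)
  qed
  ultimately have "istopology (\<lambda>U. U \<subseteq> (SIGMA x:topspace X. carrier (cohomology n (stalk_cpx K x))) \<and>
     openin (cocycle_space X n K) (?pre U))"
    unfolding istopology_def by (simp add: le_infI1 Sup_le_iff)
  then show ?thesis by (simp add: cohomology_sheaf_def topology_inverse')
qed

lemma cocycle_class_in:
  assumes K: "K \<in> Ob (Ch (Sh X))" and e: "e \<in> topspace (cocycle_space X n K)"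
  shows "cocycle_class n K e \<in> (SIGMA x:topspace X. carrier (cohomology n (stalk_cpx K x)))"
  using e by (auto simp: topspace_cocycle_space[OF K] cocycle_class_eq carrier_cohomology)

lemma topspace_cohomology_sheaf:
  assumes K: "K \<in> Ob (Ch (Sh X))"
  shows "topspace (espace (cohomology_sheaf X n K)) =
    (SIGMA x:topspace X. carrier (cohomology n (stalk_cpx K x)))" (is "_ = ?S")
proof
  show "topspace (espace (cohomology_sheaf X n K)) \<subseteq> ?S"
    using openin_topspace[of "espace (cohomology_sheaf X n K)"] unfolding openin_cohomology_sheaf by blast
  have "{e \<in> topspace (cocycle_space X n K). cocycle_class n K e \<in> ?S} = topspace (cocycle_space X n K)"
    using cocycle_class_in[OF K] by blast
  then have "openin (espace (cohomology_sheaf X n K)) ?S"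
    unfolding openin_cohomology_sheaf by simp
  then show "?S \<subseteq> topspace (espace (cohomology_sheaf X n K))" by (rule openin_subset)
qed

text \<open>
  The saturation of an open set \<open>V\<close> of cocycles is the image of the fibre product of the sheaf of
  cochains in degree \<open>n - 1\<close> with \<open>V\<close> under \<open>(b, v) \<mapsto> d b + v\<close>, which is a map of etale spaces.
\<close>

lemma openin_cocycle_class_image:
  assumes K: "K \<in> Ob (Ch (Sh X))" and V: "openin (cocycle_space X n K) V"
  shows "openin (espace (cohomology_sheaf X n K)) (cocycle_class n K ` V)"
proof -
  note F = Ch_Sh_is_sheaf[OF K]
  let ?E = "espace (cob K n)" and ?B = "espace (cob K (n - 1))"
  have VE: "openin ?E V" and VZ: "V \<subseteq> (SIGMA x:topspace X. cocycles (stalk_cpx K x) n)"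
    using V by (auto simp: openin_cocycle_space[OF K])
  let ?P = "subtopology (prod_topology ?B (subtopology ?E V)) {(b, v). fst b = fst v}"
  let ?m = "\<lambda>(d, e). (fst d, snd d \<otimes>\<^bsub>stalk (cob K n) (fst d)\<^esub> snd e)"
  let ?h = "\<lambda>(b, v). (fst b, cdiff K (n - 1) (fst b) (snd b) \<otimes>\<^bsub>stalk (cob K n) (fst b)\<^esub> snd v)"
  \<comment> \<open>Base change of the etale space V over X along the projection of the cochains in
    degree n - 1; composing with that projection makes the fibre product etale over X.\<close>
  have "etale ?P ?B fst"
    by (rule etale_fibre_product[OF etale_subtopology[OF is_sheaf_etale[OF F] VE]
          etale_continuous_map[OF is_sheaf_etale[OF F]]])
  from etale_compose[OF this is_sheaf_etale[OF F]] have P: "etale ?P X (fst \<circ> fst)" .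
  have d: "continuous_map ?B ?E (total_map (cdiff K (n - 1)))"
    using Mor_Sh_continuous[OF Ch_Sh_cdiff[OF K, of "n - 1"]] by simp
  have "continuous_map ?P ?E (total_map (cdiff K (n - 1)) \<circ> fst)"
    by (intro continuous_map_compose[OF _ d] continuous_map_from_subtopology continuous_map_fst)
  moreover have "continuous_map ?P ?E snd"
    using continuous_map_snd[of ?B "subtopology ?E V"]
    by (intro continuous_map_from_subtopology) (simp add: continuous_map_in_subtopology)
  ultimately have "continuous_map ?P (subtopology (prod_topology ?E ?E) {(d, e). fst d = fst e})
      (\<lambda>t. (total_map (cdiff K (n - 1)) (fst t), snd t))"
    by (auto simp: continuous_map_in_subtopology continuous_map_paired comp_def)
  moreover have "continuous_map (subtopology (prod_topology ?E ?E) {(d, e). fst d = fst e}) ?E ?m"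
    using F by (simp add: is_sheaf_iff)
  ultimately have "continuous_map ?P ?E (?m \<circ> (\<lambda>t. (total_map (cdiff K (n - 1)) (fst t), snd t)))"
    by (rule continuous_map_compose)
  then have "continuous_map ?P ?E ?h" by (simp add: comp_def case_prod_unfold)
  then have "open_map ?P ?E ?h"
    by (intro etale_imp_open_map_over[OF P is_sheaf_etale[OF F]]) auto
  then have op: "openin ?E (?h ` topspace ?P)"
    unfolding open_map_def using openin_topspace by blast
  have VT: "V \<subseteq> topspace ?E" using VE by (rule openin_subset)
  have "{e \<in> topspace (cocycle_space X n K). cocycle_class n K e \<in> cocycle_class n K ` V} = ?h ` topspace ?P"
  proof (intro equalityI subsetI)
    fix e assume e: "e \<in> {e \<in> topspace (cocycle_space X n K). cocycle_class n K e \<in> cocycle_class n K ` V}"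
    obtain x s where xs: "e = (x, s)" by force
    then have x: "x \<in> topspace X" "s \<in> cocycles (stalk_cpx K x) n"
      using e by (auto simp: topspace_cocycle_space[OF K])
    obtain t where t: "(x, t) \<in> V" "coh_class (stalk_cpx K x) n s = coh_class (stalk_cpx K x) n t"
      using e xs by (auto simp: cocycle_class_eq)
    have "s \<in> carrier (cob (stalk_cpx K x) n)" "t \<in> carrier (cob (stalk_cpx K x) n)"
      using cocycles_subset[of "stalk_cpx K x" n] x t VZ by auto
    then obtain b where b: "b \<in> carrier (stalk (cob K (n - 1)) x)"
      "s = cdiff K (n - 1) x b \<otimes>\<^bsub>stalk (cob K n) x\<^esub> t"
      using t(2) coh_class_eq_iff[OF stalk_cpx_in_Ob[OF K x(1)]] by auto
    have "((x, b), (x, t)) \<in> topspace ?P"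
      using b(1) x(1) t(1) VT by (auto simp: is_sheaf_topspace[OF F])
    moreover have "e = ?h ((x, b), (x, t))" using b(2) xs by simp
    ultimately show "e \<in> ?h ` topspace ?P" by (rule rev_image_eqI)
  next
    fix e assume "e \<in> ?h ` topspace ?P"
    then obtain x b t where b: "x \<in> topspace X" "b \<in> carrier (stalk (cob K (n - 1)) x)" "(x, t) \<in> V"
      "e = (x, cdiff K (n - 1) x b \<otimes>\<^bsub>stalk (cob K n) x\<^esub> t)"
      by (auto simp: is_sheaf_topspace[OF F])
    note Kx = stalk_cpx_in_Ob[OF K b(1)]
    let ?s = "cdiff K (n - 1) x b \<otimes>\<^bsub>stalk (cob K n) x\<^esub> t"
    have t: "t \<in> cocycles (stalk_cpx K x) n" using b VZ by auto
    have "cdiff K (n - 1) x b \<in> cocycles (stalk_cpx K x) n"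
      using coboundaries_subset[OF Kx, of n] b(2) by (auto simp: coboundaries_def)
    then have s: "?s \<in> cocycles (stalk_cpx K x) n"
      using subgroup.m_closed[OF subgroup_cocycles[OF Kx]] t by auto
    have "coh_class (stalk_cpx K x) n ?s = coh_class (stalk_cpx K x) n t"
      using cocycles_subset[of "stalk_cpx K x" n] s t b(2)
      by (subst coh_class_eq_iff[OF Kx]) auto
    then have "cocycle_class n K e = cocycle_class n K (x, t)" using b(4) by (simp add: cocycle_class_eq)
    then show "e \<in> {e \<in> topspace (cocycle_space X n K). cocycle_class n K e \<in> cocycle_class n K ` V}"
      using b s by (auto simp: topspace_cocycle_space[OF K])
  qed
  moreover have "cocycle_class n K ` V \<subseteq> (SIGMA x:topspace X. carrier (cohomology n (stalk_cpx K x)))"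
    using cocycle_class_in[OF K] openin_subset[OF V] by blast
  moreover have "{e \<in> topspace (cocycle_space X n K). cocycle_class n K e \<in> cocycle_class n K ` V}
      \<subseteq> (SIGMA x:topspace X. cocycles (stalk_cpx K x) n)"
    by (auto simp: topspace_cocycle_space[OF K])
  ultimately show ?thesis
    using op unfolding openin_cohomology_sheaf openin_cocycle_space[OF K] by simp
qed

section \<open>Maps of cohomology sheaves and the stalkwise criterion\<close>

context
  fixes X :: "'a topology" and K L :: "('a, 'u) dsh_obj" and \<phi>
  assumes K: "K \<in> Ob (Ch (Sh X))" and L: "L \<in> Ob (Ch (Sh X))" and \<phi>: "\<phi> \<in> Mor (Ch (Sh X)) K L"
begin

lemma total_map_in_cocycle_space:
  assumes "e \<in> topspace (cocycle_space X n K)"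
  shows "total_map (\<phi> n) e \<in> topspace (cocycle_space X n L)"
  using assms Mor_cocycles[OF stalk_cpx_in_Ob[OF K] stalk_cpx_in_Ob[OF L] stalk_cpx_in_Mor[OF \<phi>]]
  by (auto simp: topspace_cocycle_space[OF K] topspace_cocycle_space[OF L])

text \<open>The square formed with the two quotient maps; continuity and openness pass through it
  from cochains to cohomology sheaves.\<close>

lemma cohomology_sheaf_map_cocycle_class:
  assumes "e \<in> topspace (cocycle_space X n K)"
  shows "total_map (cohomology_sheaf_map X n K L \<phi>) (cocycle_class n K e) = cocycle_class n L (total_map (\<phi> n) e)"
  using assms cohomology_map_coh_class[OF stalk_cpx_in_Ob[OF K] stalk_cpx_in_Ob[OF L] stalk_cpx_in_Mor[OF \<phi>]]
  by (auto simp: topspace_cocycle_space[OF K] cocycle_class_eq cohomology_sheaf_map_def)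

lemma cohomology_sheaf_map_stalk:
  "x \<in> topspace X \<Longrightarrow> cohomology_sheaf_map X n K L \<phi> x \<in>
     Mor Ab (stalk (cohomology_sheaf X n K) x) (stalk (cohomology_sheaf X n L) x)"
  using cohomology_map_in_Mor[OF stalk_cpx_in_Ob[OF K] stalk_cpx_in_Ob[OF L] stalk_cpx_in_Mor[OF \<phi>]]
  by (simp add: cohomology_sheaf_map_def)

lemma cohomology_sheaf_map_in_topspace:
  assumes "e \<in> topspace (espace (cohomology_sheaf X n K))"
  shows "total_map (cohomology_sheaf_map X n K L \<phi>) e \<in> topspace (espace (cohomology_sheaf X n L))"
  using assms Mor_Ab_carrier[OF cohomology_sheaf_map_stalk]
  by (auto simp: topspace_cohomology_sheaf[OF K] topspace_cohomology_sheaf[OF L])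

lemma continuous_map_cohomology_sheaf_map:
  "continuous_map (espace (cohomology_sheaf X n K)) (espace (cohomology_sheaf X n L))
     (total_map (cohomology_sheaf_map X n K L \<phi>))"
  unfolding continuous_map
proof (intro conjI allI impI)
  let ?H = "total_map (cohomology_sheaf_map X n K L \<phi>)"
  let ?SK = "espace (cohomology_sheaf X n K)" and ?SL = "espace (cohomology_sheaf X n L)"
  show "?H ` topspace ?SK \<subseteq> topspace ?SL" using cohomology_sheaf_map_in_topspace by blast
  fix V assume "openin ?SL V"
  then have "openin (cocycle_space X n L) {e \<in> topspace (cocycle_space X n L). cocycle_class n L e \<in> V}"
    by (simp add: openin_cohomology_sheaf)
  then have V: "openin (espace (cob L n)) {e \<in> topspace (cocycle_space X n L). cocycle_class n L e \<in> V}"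
    by (simp add: openin_cocycle_space[OF L])
  from openin_continuous_map_preimage[OF Mor_Sh_continuous[OF Ch_Sh_Mor[OF \<phi>]] V]
  have "openin (espace (cob K n)) ({e \<in> topspace (espace (cob K n)). total_map (\<phi> n) e \<in>
      {e \<in> topspace (cocycle_space X n L). cocycle_class n L e \<in> V}} \<inter> (SIGMA x:topspace X. cocycles (stalk_cpx K x) n))"
    using openin_cocycles[OF K] by blast
  \<comment> \<open>By the square, pulling V back to cocycles of K through the cohomology sheaf of K
    gives the same set as pulling it back through the cocycles of L.\<close>
  also have "{e \<in> topspace (espace (cob K n)). total_map (\<phi> n) e \<in>
      {e \<in> topspace (cocycle_space X n L). cocycle_class n L e \<in> V}} \<inter> (SIGMA x:topspace X. cocycles (stalk_cpx K x) n) =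
    {e \<in> topspace (cocycle_space X n K). cocycle_class n K e \<in> {e \<in> topspace ?SK. ?H e \<in> V}}"
  proof (rule Set.set_eqI)
    fix e
    show "e \<in> {e \<in> topspace (espace (cob K n)). total_map (\<phi> n) e \<in>
        {e \<in> topspace (cocycle_space X n L). cocycle_class n L e \<in> V}} \<inter>
        (SIGMA x:topspace X. cocycles (stalk_cpx K x) n) \<longleftrightarrow>
      e \<in> {e \<in> topspace (cocycle_space X n K). cocycle_class n K e \<in> {e \<in> topspace ?SK. ?H e \<in> V}}"
    proof (cases "e \<in> topspace (cocycle_space X n K)")
      case True
      then have "e \<in> (SIGMA x:topspace X. cocycles (stalk_cpx K x) n)"
        by (simp only: topspace_cocycle_space[OF K])
      moreover from this have "e \<in> topspace (espace (cob K n))"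
        using openin_subset[OF openin_cocycles[OF K, of n]] by blast
      ultimately show ?thesis
        using True cohomology_sheaf_map_cocycle_class[OF True] total_map_in_cocycle_space[OF True]
          cocycle_class_in[OF K True]
        by (simp only: mem_Collect_eq Int_iff topspace_cohomology_sheaf[OF K] simp_thms)
    qed (simp only: mem_Collect_eq Int_iff topspace_cocycle_space[OF K] simp_thms)
  qed
  finally show "openin ?SK {e \<in> topspace ?SK. ?H e \<in> V}"
    unfolding openin_cohomology_sheaf openin_cocycle_space[OF K]
    by (auto simp: topspace_cohomology_sheaf[OF K] topspace_cocycle_space[OF K])
qed

lemma cohomology_sheaf_map_in_Mor:
  "cohomology_sheaf_map X n K L \<phi> \<in> Mor (Sh X) (cohomology_sheaf X n K) (cohomology_sheaf X n L)"
  using cohomology_sheaf_map_stalk[of _ n] continuous_map_cohomology_sheaf_map[of n]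
  by (auto simp: Mor_Sh cohomology_sheaf_map_def)

text \<open>An open U is lifted to cocycles of K, moved by the open map induced by \<phi> in degree
  n, and projected by the open quotient map of L; the square identifies the result with the image of
  U.\<close>

lemma open_map_cohomology_sheaf_map:
  "open_map (espace (cohomology_sheaf X n K)) (espace (cohomology_sheaf X n L))
     (total_map (cohomology_sheaf_map X n K L \<phi>))"
  unfolding open_map_def
proof (intro allI impI)
  fix U assume U: "openin (espace (cohomology_sheaf X n K)) U"
  let ?V = "{e \<in> topspace (cocycle_space X n K). cocycle_class n K e \<in> U}"
  have V: "openin (espace (cob K n)) ?V"
    using U by (simp add: openin_cohomology_sheaf openin_cocycle_space[OF K])
  have "open_map (espace (cob K n)) (espace (cob L n)) (total_map (\<phi> n))"
    by (rule etale_imp_open_map_over[OF is_sheaf_etale[OF Ch_Sh_is_sheaf[OF K]]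
          is_sheaf_etale[OF Ch_Sh_is_sheaf[OF L]] Mor_Sh_continuous[OF Ch_Sh_Mor[OF \<phi>]]]) auto
  then have "openin (espace (cob L n)) (total_map (\<phi> n) ` ?V)" using V by (simp add: open_map_def)
  then have "openin (cocycle_space X n L) (total_map (\<phi> n) ` ?V)"
    using total_map_in_cocycle_space[of _ n]
    unfolding openin_cocycle_space[OF L] topspace_cocycle_space[OF L] by blast
  then have "openin (espace (cohomology_sheaf X n L)) (cocycle_class n L ` total_map (\<phi> n) ` ?V)"
    by (rule openin_cocycle_class_image[OF L])
  also have "cocycle_class n L ` total_map (\<phi> n) ` ?V = total_map (cohomology_sheaf_map X n K L \<phi>) ` cocycle_class n K ` ?V"
    unfolding image_image by (intro image_cong refl) (simp only: mem_Collect_eq cohomology_sheaf_map_cocycle_class)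
  \<comment> \<open>Every class has a cocycle representing it, so U is the image of its own
    preimage.\<close>
  also have "cocycle_class n K ` ?V = U"
  proof
    show "U \<subseteq> cocycle_class n K ` ?V"
    proof
      fix e assume e: "e \<in> U"
      then have "e \<in> (SIGMA x:topspace X. carrier (cohomology n (stalk_cpx K x)))"
        using U unfolding openin_cohomology_sheaf by blast
      then obtain x s where "e = cocycle_class n K (x, s)" "(x, s) \<in> topspace (cocycle_space X n K)"
        by (auto simp: carrier_cohomology cocycle_class_eq topspace_cocycle_space[OF K])
      then show "e \<in> cocycle_class n K ` ?V" using e by blast
    qed
  qed auto
  finally show "openin (espace (cohomology_sheaf X n L)) (total_map (cohomology_sheaf_map X n K L \<phi>) ` U)" .
qed

text \<open>An inverse of sheaf maps restricts to stalks. Conversely the stalkwise inverses are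
  assembled into a family, and the only condition left to prove is its continuity.\<close>

lemma is_iso_cohomology_sheaf_map_iff:
  "is_iso (Sh X) (cohomology_sheaf X n K) (cohomology_sheaf X n L) (cohomology_sheaf_map X n K L \<phi>) \<longleftrightarrow>
   (\<forall>x\<in>topspace X. is_iso Ab (cohomology n (stalk_cpx K x)) (cohomology n (stalk_cpx L x))
      (cohomology_map n (stalk_cpx K x) (stalk_cpx L x) (\<lambda>m. \<phi> m x)))" (is "?l \<longleftrightarrow> ?r")
proof
  let ?SK = "cohomology_sheaf X n K" and ?SL = "cohomology_sheaf X n L"
  let ?H = "cohomology_sheaf_map X n K L \<phi>"
  have H: "?H x = cohomology_map n (stalk_cpx K x) (stalk_cpx L x) (\<lambda>m. \<phi> m x)" if "x \<in> topspace X" for x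
    using that by (simp add: cohomology_sheaf_map_def)
  {
    assume ?l
    then obtain g where g: "g \<in> Mor (Sh X) ?SL ?SK"
      "Cmp (Sh X) ?SK ?SL ?SK g ?H = Idn (Sh X) ?SK" "Cmp (Sh X) ?SL ?SK ?SL ?H g = Idn (Sh X) ?SL"
      by (auto simp: is_iso_def is_inverse_def)
    show ?r
    proof
      fix x assume x: "x \<in> topspace X"
      have "is_inverse Ab (cohomology n (stalk_cpx K x)) (cohomology n (stalk_cpx L x)) (?H x) (g x)"
        using fun_cong[OF g(2), of x] fun_cong[OF g(3), of x] Mor_Sh_stalk[OF g(1) x]
          cohomology_sheaf_map_stalk[OF x] x
        by (simp add: is_inverse_def Cmp_Sh Idn_Sh)
      then show "is_iso Ab (cohomology n (stalk_cpx K x)) (cohomology n (stalk_cpx L x))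
          (cohomology_map n (stalk_cpx K x) (stalk_cpx L x) (\<lambda>m. \<phi> m x))"
        unfolding is_iso_def using H[OF x] by auto
    qed
  }
  assume r: ?r
  define g where "g = (\<lambda>x\<in>topspace X. inverse_mor Ab (cohomology n (stalk_cpx K x)) (cohomology n (stalk_cpx L x)) (?H x))"
  have inv: "is_inverse Ab (cohomology n (stalk_cpx K x)) (cohomology n (stalk_cpx L x)) (?H x) (g x)"
    if "x \<in> topspace X" for x
    using that r H comm_group_cohomology[OF stalk_cpx_in_Ob[OF K]] comm_group_cohomology[OF stalk_cpx_in_Ob[OF L]]
    by (auto simp: g_def intro!: is_inverse_inverse_mor is_category_Ab)
  have gm: "g x \<in> Mor Ab (cohomology n (stalk_cpx L x)) (cohomology n (stalk_cpx K x))"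
    if "x \<in> topspace X" for x using inv[OF that] by (simp add: is_inverse_def)
  have gH: "g x (?H x s) = s" if "x \<in> topspace X" "s \<in> carrier (cohomology n (stalk_cpx K x))" for x s
    using inv[OF that(1)] that(2) fun_cong[of "compose _ (g x) (?H x)" _ s]
    by (fastforce simp: is_inverse_def Cmp_Ab Idn_Ab compose_eq dest: fun_cong[where x = s])
  have Hg: "?H x (g x s) = s" if "x \<in> topspace X" "s \<in> carrier (cohomology n (stalk_cpx L x))" for x s
    using inv[OF that(1)] that(2)
    by (fastforce simp: is_inverse_def Cmp_Ab Idn_Ab compose_eq dest: fun_cong[where x = s])
  have "continuous_map (espace ?SL) (espace ?SK) (total_map g)"
    unfolding continuous_map
  proof (intro conjI allI impI)
    show "total_map g ` topspace (espace ?SL) \<subseteq> topspace (espace ?SK)"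
      using Mor_Ab_carrier[OF gm] by (auto simp: topspace_cohomology_sheaf[OF K] topspace_cohomology_sheaf[OF L])
    fix U assume U: "openin (espace ?SK) U"
    then have sub: "U \<subseteq> topspace (espace ?SK)" by (rule openin_subset)
    \<comment> \<open>Preimages under the inverse are images under the map itself, so continuity of
      the inverse is openness of the map.\<close>
    have "{e \<in> topspace (espace ?SL). total_map g e \<in> U} = total_map ?H ` U"
    proof (intro equalityI subsetI)
      fix e assume e: "e \<in> {e \<in> topspace (espace ?SL). total_map g e \<in> U}"
      then have "e = total_map ?H (total_map g e)" by (auto simp: topspace_cohomology_sheaf[OF L] Hg)
      with e show "e \<in> total_map ?H ` U" by blast
    next
      fix e assume "e \<in> total_map ?H ` U"
      then obtain u where u: "u \<in> U" "e = total_map ?H u" by blast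
      then have us: "u \<in> topspace (espace ?SK)" using sub by blast
      then have "total_map g e = u" using u(2) by (auto simp: topspace_cohomology_sheaf[OF K] gH)
      moreover have "e \<in> topspace (espace ?SL)"
        using cohomology_sheaf_map_in_topspace[OF us] u(2) by simp
      ultimately show "e \<in> {e \<in> topspace (espace ?SL). total_map g e \<in> U}" using u(1) by simp
    qed
    then show "openin (espace ?SL) {e \<in> topspace (espace ?SL). total_map g e \<in> U}"
      using open_map_cohomology_sheaf_map[of n] U by (simp add: open_map_def)
  qed
  then have "g \<in> Mor (Sh X) ?SL ?SK"
    using gm by (auto simp: Mor_Sh g_def)
  moreover have "Cmp (Sh X) ?SK ?SL ?SK g ?H = Idn (Sh X) ?SK" "Cmp (Sh X) ?SL ?SK ?SL ?H g = Idn (Sh X) ?SL"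
    using inv by (auto simp: Cmp_Sh Idn_Sh is_inverse_def intro!: restrict_ext)
  ultimately show ?l
    unfolding is_iso_def is_inverse_def using cohomology_sheaf_map_in_Mor by blast
qed

lemma qis_Sh_iff:
  "\<phi> \<in> qis_Sh X K L \<longleftrightarrow> (\<forall>x\<in>topspace X. (\<lambda>n. \<phi> n x) \<in> qis_Ab (stalk_cpx K x) (stalk_cpx L x))"
  using \<phi> stalk_cpx_in_Mor[OF \<phi>] by (auto simp: qis_Sh_def qis_Ab_def is_iso_cohomology_sheaf_map_iff)

end

section \<open>Quasi-isomorphisms under inverse images\<close>

lemma is_functor_Ch_inv_im:
  "continuous_map X Y f \<Longrightarrow> is_functor (Ch (Sh Y)) (Ch (Sh X)) (Ch_funct (inv_im X f))"
  by (intro is_functor_Ch_funct is_functor_inv_im inv_im_Zmor)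

lemma is_functor_Ch_proj_inv: "is_functor (Ch Ab) (Ch (Sh X)) (Ch_funct (proj_inv X))"
  by (intro is_functor_Ch_funct is_functor_proj_inv proj_inv_Zmor)

lemma stalk_cpx_inv_im: "x \<in> topspace X \<Longrightarrow> stalk_cpx (FOb (Ch_funct (inv_im X f)) K) x = stalk_cpx K (f x)"
  by (simp add: stalk_cpx_def Ch_funct_def FMor_inv_im)

lemma stalk_cpx_proj_inv: "x \<in> topspace X \<Longrightarrow> stalk_cpx (FOb (Ch_funct (proj_inv X)) G) x = G"
  by (simp add: stalk_cpx_def Ch_funct_def FMor_proj_inv)

lemma preserves_class_inv_im:
  assumes f: "continuous_map X Y f"
  shows "preserves_class (Ch (Sh Y)) (qis_Sh Y) (qis_Sh X) (Ch_funct (inv_im X f))"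
  unfolding preserves_class_def
proof (intro ballI)
  fix K L :: "('b, 'u) dsh_obj" and \<phi>
  assume K: "K \<in> Ob (Ch (Sh Y))" "L \<in> Ob (Ch (Sh Y))" and \<phi>: "\<phi> \<in> Mor (Ch (Sh Y)) K L \<inter> qis_Sh Y K L"
  note T = is_functor_Ch_inv_im[OF f]
  have "\<forall>y\<in>topspace Y. (\<lambda>n. \<phi> n y) \<in> qis_Ab (stalk_cpx K y) (stalk_cpx L y)"
    using \<phi> qis_Sh_iff[OF K] by blast
  moreover have "f x \<in> topspace Y" if "x \<in> topspace X" for x
    using that f by (auto simp: continuous_map_def)
  moreover have "(\<lambda>n. FMor (Ch_funct (inv_im X f)) K L \<phi> n x) = (\<lambda>n. \<phi> n (f x))" if "x \<in> topspace X" for x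
    using that by (simp add: Ch_funct_def FMor_inv_im)
  ultimately show "FMor (Ch_funct (inv_im X f)) K L \<phi> \<in>
      qis_Sh X (FOb (Ch_funct (inv_im X f)) K) (FOb (Ch_funct (inv_im X f)) L)"
    using \<phi> by (subst qis_Sh_iff[OF FOb_in_Ob[OF T K(1)] FOb_in_Ob[OF T K(2)] FMor_in_Mor[OF T K]])
      (auto simp: stalk_cpx_inv_im)
qed

text \<open>Every stalk complex of \<pi>_X\<inverse>G is G itself, and the map on every stalk is the
  given one.\<close>

lemma preserves_class_proj_inv:
  "preserves_class (Ch Ab) qis_Ab (qis_Sh X) (Ch_funct (proj_inv X))"
  unfolding preserves_class_def
proof (intro ballI)
  fix K L :: "'u dab_obj" and \<phi>
  assume K: "K \<in> Ob (Ch Ab)" "L \<in> Ob (Ch Ab)" and \<phi>: "\<phi> \<in> Mor (Ch Ab) K L \<inter> qis_Ab K L"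
  note T = is_functor_Ch_proj_inv[of X]
  have "(\<lambda>n. FMor (Ch_funct (proj_inv X)) K L \<phi> n x) = \<phi>" if "x \<in> topspace X" for x
    using that by (simp add: Ch_funct_def FMor_proj_inv)
  then show "FMor (Ch_funct (proj_inv X)) K L \<phi> \<in>
      qis_Sh X (FOb (Ch_funct (proj_inv X)) K) (FOb (Ch_funct (proj_inv X)) L)"
    using \<phi> by (subst qis_Sh_iff[OF FOb_in_Ob[OF T K(1)] FOb_in_Ob[OF T K(2)] FMor_in_Mor[OF T K]])
      (auto simp: stalk_cpx_proj_inv)
qed

section \<open>Inverse images on derived categories\<close>

lemma is_category_Ch_Sh: "is_category (Ch (Sh X))"
  by (rule is_category_Ch) (rule is_category_Sh)

lemma is_category_Ch_Ab: "is_category (Ch Ab)"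
  by (rule is_category_Ch) (rule is_category_Ab)

lemma D_inv_im_eq: "D_inv_im X f = localized_functor (Ch (Sh X)) (qis_Sh X) (Ch_funct (inv_im X f))"
  by (simp add: D_inv_im_def localized_functor_def D_Sh_def)

lemma D_proj_inv_eq: "D_proj_inv X = localized_functor (Ch (Sh X)) (qis_Sh X) (Ch_funct (proj_inv X))"
  by (simp add: D_proj_inv_def localized_functor_def D_Sh_def)

lemma is_functor_D_inv_im:
  "continuous_map X Y f \<Longrightarrow> is_functor (D_Sh Y) (D_Sh X) (D_inv_im X f)"
  unfolding D_inv_im_eq D_Sh_def
  by (intro is_functor_localized_functor is_category_Ch_Sh is_functor_Ch_inv_im preserves_class_inv_im)

lemma is_functor_D_proj_inv: "is_functor D_Ab (D_Sh X) (D_proj_inv X)"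
  unfolding D_proj_inv_eq D_Sh_def D_Ab_def
  by (intro is_functor_localized_functor is_category_Ch_Sh is_category_Ch_Ab is_functor_Ch_proj_inv
      preserves_class_proj_inv)

lemma funct_eq_on_Ch_inv_im_proj_inv:
  assumes "continuous_map X Y f"
  shows "funct_eq_on (Ch Ab) (comp_funct (Ch_funct (inv_im X f)) (Ch_funct (proj_inv Y)))
    (Ch_funct (proj_inv X))"
  unfolding Ch_funct_comp by (intro funct_eq_on_Ch funct_eq_on_inv_im_proj_inv assms)

lemma funct_eq_on_Ch_inv_im_comp:
  assumes "continuous_map X Y f" "continuous_map Y Z g"
  shows "funct_eq_on (Ch (Sh Z)) (comp_funct (Ch_funct (inv_im X f)) (Ch_funct (inv_im Y g)))
    (Ch_funct (inv_im X (g \<circ> f)))"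
  unfolding Ch_funct_comp by (intro funct_eq_on_Ch funct_eq_on_inv_im_comp assms)

lemma funct_eq_on_Ch_inv_im_id: "funct_eq_on (Ch (Sh X)) (Ch_funct (inv_im X id)) id_funct"
  using funct_eq_on_Ch[OF funct_eq_on_inv_im_id] by (simp add: Ch_funct_id)

lemma funct_eq_on_D_inv_im_proj_inv:
  assumes f: "continuous_map X Y f"
  shows "funct_eq_on D_Ab (comp_funct (D_inv_im X f) (D_proj_inv Y)) (D_proj_inv X)"
  unfolding funct_eq_on_def D_inv_im_eq D_proj_inv_eq D_Ab_def
  by (simp add: funct_eq_on_FOb[OF funct_eq_on_Ch_inv_im_proj_inv[OF f], simplified]
        localized_functor_comp[OF is_category_Ch_Ab is_category_Ch_Sh is_category_Ch_Sh
        is_functor_Ch_proj_inv preserves_class_proj_inv is_functor_Ch_inv_im[OF f]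
        preserves_class_inv_im[OF f] is_functor_Ch_proj_inv preserves_class_proj_inv
        funct_eq_on_Ch_inv_im_proj_inv[OF f]])

lemma funct_eq_on_D_inv_im_comp:
  assumes f: "continuous_map X Y f" and g: "continuous_map Y Z g"
  shows "funct_eq_on (D_Sh Z) (comp_funct (D_inv_im X f) (D_inv_im Y g)) (D_inv_im X (g \<circ> f))"
proof -
  note gf = continuous_map_compose[OF f g]
  show ?thesis
    unfolding funct_eq_on_def D_inv_im_eq D_Sh_def
    by (simp add: funct_eq_on_FOb[OF funct_eq_on_Ch_inv_im_comp[OF f g], simplified]
        localized_functor_comp[OF is_category_Ch_Sh is_category_Ch_Sh is_category_Ch_Sh
          is_functor_Ch_inv_im[OF g] preserves_class_inv_im[OF g] is_functor_Ch_inv_im[OF f]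
          preserves_class_inv_im[OF f] is_functor_Ch_inv_im[OF gf] preserves_class_inv_im[OF gf]
          funct_eq_on_Ch_inv_im_comp[OF f g]])
qed

lemma funct_eq_on_D_inv_im_id: "funct_eq_on (D_Sh X) (D_inv_im X id) id_funct"
  unfolding funct_eq_on_def D_inv_im_eq D_Sh_def
  by (simp add: funct_eq_on_FOb[OF funct_eq_on_Ch_inv_im_id]
        localized_functor_id[OF is_category_Ch_Sh is_functor_Ch_inv_im[OF continuous_map_id]
        preserves_class_inv_im[OF continuous_map_id] funct_eq_on_Ch_inv_im_id] id_funct_def)

section \<open>Functoriality of homology\<close>

lemma homology_adjoint_FOb_in_Ob:
  assumes "is_homology_adjoint X L" "F \<in> Ob (D_Sh X)" shows "FOb L F \<in> Ob D_Ab"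
  using assms by (simp add: is_homology_adjoint_def is_left_adjoint_def is_functor_def)

lemma is_functor_homology_adjoint: "is_homology_adjoint X L \<Longrightarrow> is_functor (D_Sh X) D_Ab L"
  by (simp add: is_homology_adjoint_def is_left_adjoint_def)

lemma bij_betw_Adj:
  "is_homology_adjoint X L \<Longrightarrow> F \<in> Ob (D_Sh X) \<Longrightarrow> G \<in> Ob D_Ab \<Longrightarrow>
   bij_betw (Adj L F G) (Mor D_Ab (FOb L F) G) (Mor (D_Sh X) F (FOb (D_proj_inv X) G))"
  by (simp add: is_homology_adjoint_def is_left_adjoint_def)

lemma Adj_in_Mor:
  "is_homology_adjoint X L \<Longrightarrow> F \<in> Ob (D_Sh X) \<Longrightarrow> G \<in> Ob D_Ab \<Longrightarrow> u \<in> Mor D_Ab (FOb L F) G \<Longrightarrow>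
   Adj L F G u \<in> Mor (D_Sh X) F (FOb (D_proj_inv X) G)"
  using bij_betw_Adj bij_betwE by blast

lemma Adj_inject:
  "is_homology_adjoint X L \<Longrightarrow> F \<in> Ob (D_Sh X) \<Longrightarrow> G \<in> Ob D_Ab \<Longrightarrow> u \<in> Mor D_Ab (FOb L F) G \<Longrightarrow>
   v \<in> Mor D_Ab (FOb L F) G \<Longrightarrow> Adj L F G u = Adj L F G v \<Longrightarrow> u = v"
  using bij_betw_Adj bij_betw_imp_inj_on inj_onD by metis

lemma Adj_natural_left:
  "is_homology_adjoint X L \<Longrightarrow> F' \<in> Ob (D_Sh X) \<Longrightarrow> F \<in> Ob (D_Sh X) \<Longrightarrow> G \<in> Ob D_Ab \<Longrightarrow>
   a \<in> Mor (D_Sh X) F' F \<Longrightarrow> u \<in> Mor D_Ab (FOb L F) G \<Longrightarrow>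
   Adj L F' G (Cmp D_Ab (FOb L F') (FOb L F) G u (FMor L F' F a)) =
   Cmp (D_Sh X) F' F (FOb (D_proj_inv X) G) (Adj L F G u) a"
  by (simp add: is_homology_adjoint_def is_left_adjoint_def)

lemma Adj_natural_right:
  "is_homology_adjoint X L \<Longrightarrow> F \<in> Ob (D_Sh X) \<Longrightarrow> G \<in> Ob D_Ab \<Longrightarrow> G' \<in> Ob D_Ab \<Longrightarrow>
   b \<in> Mor D_Ab G G' \<Longrightarrow> u \<in> Mor D_Ab (FOb L F) G \<Longrightarrow>
   Adj L F G' (Cmp D_Ab (FOb L F) G G' b u) =
   Cmp (D_Sh X) F (FOb (D_proj_inv X) G) (FOb (D_proj_inv X) G') (FMor (D_proj_inv X) G G' b) (Adj L F G u)"
  by (simp add: is_homology_adjoint_def is_left_adjoint_def)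

lemma D_inv_im_in_Ob:
  "continuous_map X Y f \<Longrightarrow> F \<in> Ob (D_Sh Y) \<Longrightarrow> FOb (D_inv_im X f) F \<in> Ob (D_Sh X)"
  by (rule FOb_in_Ob[OF is_functor_D_inv_im])

text \<open>Makes the identification inside \<open>is_pushforward\<close> literal: f\<inverse> of a
  morphism into \<pi>_Y\<inverse>G is a morphism into \<pi>_X\<inverse>G.\<close>

lemma D_inv_im_proj_inv:
  assumes "continuous_map X Y f"
  shows "G \<in> Ob D_Ab \<Longrightarrow> FOb (D_inv_im X f) (FOb (D_proj_inv Y) G) = FOb (D_proj_inv X) G"
    and "G \<in> Ob D_Ab \<Longrightarrow> G' \<in> Ob D_Ab \<Longrightarrow> b \<in> Mor D_Ab G G' \<Longrightarrow>
      FMor (D_inv_im X f) (FOb (D_proj_inv Y) G) (FOb (D_proj_inv Y) G') (FMor (D_proj_inv Y) G G' b) =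
      FMor (D_proj_inv X) G G' b"
  by (simp_all add: funct_eq_on_FOb[OF funct_eq_on_D_inv_im_proj_inv[OF assms], simplified]
      funct_eq_on_FMor[OF funct_eq_on_D_inv_im_proj_inv[OF assms], simplified])

lemma D_inv_im_comp:
  assumes "continuous_map X Y f" "continuous_map Y Z g"
  shows "F \<in> Ob (D_Sh Z) \<Longrightarrow> FOb (D_inv_im X f) (FOb (D_inv_im Y g) F) = FOb (D_inv_im X (g \<circ> f)) F"
    and "F \<in> Ob (D_Sh Z) \<Longrightarrow> F' \<in> Ob (D_Sh Z) \<Longrightarrow> v \<in> Mor (D_Sh Z) F F' \<Longrightarrow>
      FMor (D_inv_im X f) (FOb (D_inv_im Y g) F) (FOb (D_inv_im Y g) F') (FMor (D_inv_im Y g) F F' v) =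
      FMor (D_inv_im X (g \<circ> f)) F F' v"
  by (simp_all add: funct_eq_on_FOb[OF funct_eq_on_D_inv_im_comp[OF assms], simplified]
      funct_eq_on_FMor[OF funct_eq_on_D_inv_im_comp[OF assms], simplified])

lemma D_inv_im_id:
  shows "F \<in> Ob (D_Sh X) \<Longrightarrow> FOb (D_inv_im X id) F = F"
    and "F \<in> Ob (D_Sh X) \<Longrightarrow> F' \<in> Ob (D_Sh X) \<Longrightarrow> v \<in> Mor (D_Sh X) F F' \<Longrightarrow>
      FMor (D_inv_im X id) F F' v = v"
  by (simp_all add: funct_eq_on_FOb[OF funct_eq_on_D_inv_im_id]
      funct_eq_on_FMor[OF funct_eq_on_D_inv_im_id] id_funct_def)

section \<open>The pushforward along one map\<close>

context
  fixes X :: "'a topology" and Y :: "'b topology" and f :: "'a \<Rightarrow> 'b"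
    and LX :: "('a, 'u) hladj" and LY :: "('b, 'u) hladj"
  assumes LX: "is_homology_adjoint X LX" and LY: "is_homology_adjoint Y LY"
    and f: "continuous_map X Y f"
begin

lemma inverse_image_Adj_in_Mor:
  assumes "F \<in> Ob (D_Sh Y)" "G \<in> Ob D_Ab" "u \<in> Mor D_Ab (FOb LY F) G"
  shows "FMor (D_inv_im X f) F (FOb (D_proj_inv Y) G) (Adj LY F G u) \<in>
    Mor (D_Sh X) (FOb (D_inv_im X f) F) (FOb (D_proj_inv X) G)"
  using FMor_in_Mor[OF is_functor_D_inv_im[OF f] assms(1)
      FOb_in_Ob[OF is_functor_D_proj_inv assms(2)] Adj_in_Mor[OF LY assms]]
  by (simp add: D_inv_im_proj_inv[OF f] assms(2))

text \<open>Yoneda: a pushforward is determined by the image of the identity of \<open>L(Y, F)\<close>.\<close>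

lemma is_pushforward_iff:
  assumes F: "F \<in> Ob (D_Sh Y)"
  shows "is_pushforward X Y f LX LY F h \<longleftrightarrow>
    h \<in> Mor D_Ab (FOb LX (FOb (D_inv_im X f) F)) (FOb LY F) \<and>
    Adj LX (FOb (D_inv_im X f) F) (FOb LY F) h =
      FMor (D_inv_im X f) F (FOb (D_proj_inv Y) (FOb LY F))
        (Adj LY F (FOb LY F) (Idn D_Ab (FOb LY F)))" (is "_ \<longleftrightarrow> ?m \<and> ?e")
proof
  note cat = is_category_D_Ab
  note ob = homology_adjoint_FOb_in_Ob[OF LY F] D_inv_im_in_Ob[OF f F]
  note ob' = homology_adjoint_FOb_in_Ob[OF LX ob(2)]
  let ?A = "FOb (D_inv_im X f) F" and ?B = "FOb LY F"
  note Id = Idn_in_Mor[OF cat ob(1)]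
  {
    assume h: "is_pushforward X Y f LX LY F h"
    then have m: ?m by (simp add: is_pushforward_def)
    \<comment> \<open>The defining condition is taken at G = L(Y, F) and at the identity.\<close>
    have "Adj LX ?A ?B (Cmp D_Ab (FOb LX ?A) ?B ?B (Idn D_Ab ?B) h) =
        FMor (D_inv_im X f) F (FOb (D_proj_inv Y) ?B) (Adj LY F ?B (Idn D_Ab ?B))"
      using h ob(1) Id unfolding is_pushforward_def by blast
    then show "?m \<and> ?e" using m Cmp_Idn_left[OF cat ob' ob(1) m] by simp
  next
    assume a: "?m \<and> ?e"
    have "Adj LX ?A G (Cmp D_Ab (FOb LX ?A) ?B G u h) =
        FMor (D_inv_im X f) F (FOb (D_proj_inv Y) G) (Adj LY F G u)"
      if G: "G \<in> Ob D_Ab" and u: "u \<in> Mor D_Ab ?B G" for G u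
    proof -
      note pob = FOb_in_Ob[OF is_functor_D_proj_inv[of Y]]
      have "Adj LX ?A G (Cmp D_Ab (FOb LX ?A) ?B G u h) =
          Cmp (D_Sh X) ?A (FOb (D_proj_inv X) ?B) (FOb (D_proj_inv X) G)
            (FMor (D_proj_inv X) ?B G u) (Adj LX ?A ?B h)"
        using a by (intro Adj_natural_right[OF LX ob(2,1) G u]) simp
      \<comment> \<open>The adjoint of h becomes f\<inverse> of the unit, and \<pi>_X\<inverse>u
        becomes f\<inverse>\<pi>_Y\<inverse>u; both factors are now inverse images along f and can
        be merged.\<close>
      also have "\<dots> = Cmp (D_Sh X) ?A (FOb (D_inv_im X f) (FOb (D_proj_inv Y) ?B))
            (FOb (D_inv_im X f) (FOb (D_proj_inv Y) G))
            (FMor (D_inv_im X f) (FOb (D_proj_inv Y) ?B) (FOb (D_proj_inv Y) G) (FMor (D_proj_inv Y) ?B G u))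
            (FMor (D_inv_im X f) F (FOb (D_proj_inv Y) ?B) (Adj LY F ?B (Idn D_Ab ?B)))"
        using a G u ob(1) by (simp add: D_inv_im_proj_inv[OF f])
      also have "\<dots> = FMor (D_inv_im X f) F (FOb (D_proj_inv Y) G)
          (Cmp (D_Sh Y) F (FOb (D_proj_inv Y) ?B) (FOb (D_proj_inv Y) G)
            (FMor (D_proj_inv Y) ?B G u) (Adj LY F ?B (Idn D_Ab ?B)))"
        by (rule FMor_Cmp[OF is_functor_D_inv_im[OF f] F pob[OF ob(1)] pob[OF G]
              Adj_in_Mor[OF LY F ob(1) Id] FMor_in_Mor[OF is_functor_D_proj_inv ob(1) G u], symmetric])
      also have "Cmp (D_Sh Y) F (FOb (D_proj_inv Y) ?B) (FOb (D_proj_inv Y) G)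
            (FMor (D_proj_inv Y) ?B G u) (Adj LY F ?B (Idn D_Ab ?B)) =
          Adj LY F G (Cmp D_Ab ?B ?B G u (Idn D_Ab ?B))"
        by (rule Adj_natural_right[OF LY F ob(1) G u Id, symmetric])
      also have "Cmp D_Ab ?B ?B G u (Idn D_Ab ?B) = u" by (rule Cmp_Idn_right[OF cat ob(1) G u])
      finally show ?thesis .
    qed
    with a show "is_pushforward X Y f LX LY F h" by (simp add: is_pushforward_def)
  }
qed

text \<open>Surjectivity of the adjunction bijection for X at L(Y, F) yields h, and its injectivity
  yields uniqueness.\<close>

lemma ex1_is_pushforward:
  assumes F: "F \<in> Ob (D_Sh Y)"
  shows "\<exists>!h. is_pushforward X Y f LX LY F h"
proof -
  note ob = homology_adjoint_FOb_in_Ob[OF LY F] D_inv_im_in_Ob[OF f F]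
  let ?e = "FMor (D_inv_im X f) F (FOb (D_proj_inv Y) (FOb LY F))
    (Adj LY F (FOb LY F) (Idn D_Ab (FOb LY F)))"
  have "?e \<in> Mor (D_Sh X) (FOb (D_inv_im X f) F) (FOb (D_proj_inv X) (FOb LY F))"
    by (rule inverse_image_Adj_in_Mor[OF F ob(1) Idn_in_Mor[OF is_category_D_Ab ob(1)]])
  then have "?e \<in> Adj LX (FOb (D_inv_im X f) F) (FOb LY F) `
      Mor D_Ab (FOb LX (FOb (D_inv_im X f) F)) (FOb LY F)"
    by (simp only: bij_betw_imp_surj_on[OF bij_betw_Adj[OF LX ob(2,1)]])
  then obtain h where h: "?e = Adj LX (FOb (D_inv_im X f) F) (FOb LY F) h"
    "h \<in> Mor D_Ab (FOb LX (FOb (D_inv_im X f) F)) (FOb LY F)"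
    by (rule imageE)
  show ?thesis
    unfolding is_pushforward_iff[OF F]
  proof (rule ex1I[of _ h])
    fix h' assume "h' \<in> Mor D_Ab (FOb LX (FOb (D_inv_im X f) F)) (FOb LY F) \<and>
      Adj LX (FOb (D_inv_im X f) F) (FOb LY F) h' = ?e"
    with h show "h' = h" using Adj_inject[OF LX ob(2,1), of h' h] by simp
  qed (use h in simp)
qed

lemma is_pushforward_pushforward:
  "F \<in> Ob (D_Sh Y) \<Longrightarrow> is_pushforward X Y f LX LY F (pushforward X Y f LX LY F)"
  unfolding pushforward_def by (rule theI') (rule ex1_is_pushforward)

lemma pushforward_eqI:
  "F \<in> Ob (D_Sh Y) \<Longrightarrow> is_pushforward X Y f LX LY F h \<Longrightarrow> pushforward X Y f LX LY F = h"
  using ex1_is_pushforward is_pushforward_pushforward by blast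

lemma pushforward_in_Mor:
  "F \<in> Ob (D_Sh Y) \<Longrightarrow> pushforward X Y f LX LY F \<in> Mor D_Ab (FOb LX (FOb (D_inv_im X f) F)) (FOb LY F)"
  using is_pushforward_pushforward by (simp add: is_pushforward_def)

lemma Adj_pushforward:
  assumes "F \<in> Ob (D_Sh Y)" "G \<in> Ob D_Ab" "u \<in> Mor D_Ab (FOb LY F) G"
  shows "Adj LX (FOb (D_inv_im X f) F) G
      (Cmp D_Ab (FOb LX (FOb (D_inv_im X f) F)) (FOb LY F) G u (pushforward X Y f LX LY F)) =
    FMor (D_inv_im X f) F (FOb (D_proj_inv Y) G) (Adj LY F G u)"
  using is_pushforward_pushforward[OF assms(1)] assms(2,3) by (simp add: is_pushforward_def)

text \<open>Under the adjunction for X both sides become f\<inverse> of the adjoint of L(Y, v): the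
  left side by the defining property at u = L(Y, v), the right side by naturality of both
  adjunctions in the first variable.\<close>

lemma pushforward_natural:
  assumes F: "F \<in> Ob (D_Sh Y)" "F' \<in> Ob (D_Sh Y)" and v: "v \<in> Mor (D_Sh Y) F F'"
  shows "Cmp D_Ab (FOb LX (FOb (D_inv_im X f) F)) (FOb LY F) (FOb LY F')
      (FMor LY F F' v) (pushforward X Y f LX LY F) =
    Cmp D_Ab (FOb LX (FOb (D_inv_im X f) F)) (FOb LX (FOb (D_inv_im X f) F')) (FOb LY F')
      (pushforward X Y f LX LY F')
      (FMor LX (FOb (D_inv_im X f) F) (FOb (D_inv_im X f) F') (FMor (D_inv_im X f) F F' v))" (is "?l = ?r")
proof -
  let ?A = "FOb (D_inv_im X f) F" and ?A' = "FOb (D_inv_im X f) F'" and ?B = "FOb LY F" and ?B' = "FOb LY F'"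
  note cat = is_category_D_Ab
  note A = F[THEN D_inv_im_in_Ob[OF f]] and B = F[THEN homology_adjoint_FOb_in_Ob[OF LY]]
  note LA = A[THEN homology_adjoint_FOb_in_Ob[OF LX]]
  note p = F[THEN pushforward_in_Mor]
  have w: "FMor (D_inv_im X f) F F' v \<in> Mor (D_Sh X) ?A ?A'"
    by (rule FMor_in_Mor[OF is_functor_D_inv_im[OF f] F v])
  have Lw: "FMor LX ?A ?A' (FMor (D_inv_im X f) F F' v) \<in> Mor D_Ab (FOb LX ?A) (FOb LX ?A')"
    by (rule FMor_in_Mor[OF is_functor_homology_adjoint[OF LX] A w])
  have Lv: "FMor LY F F' v \<in> Mor D_Ab ?B ?B'"
    by (rule FMor_in_Mor[OF is_functor_homology_adjoint[OF LY] F v])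
  note Id = Idn_in_Mor[OF cat B(2)]
  have "Adj LX ?A ?B' ?r = Cmp (D_Sh X) ?A ?A' (FOb (D_proj_inv X) ?B') (Adj LX ?A' ?B' (pushforward X Y f LX LY F'))
      (FMor (D_inv_im X f) F F' v)"
    by (rule Adj_natural_left[OF LX A B(2) w p(2)])
  also have "Adj LX ?A' ?B' (pushforward X Y f LX LY F') =
      FMor (D_inv_im X f) F' (FOb (D_proj_inv Y) ?B') (Adj LY F' ?B' (Idn D_Ab ?B'))"
    using is_pushforward_pushforward[OF F(2)] by (simp add: is_pushforward_iff[OF F(2)])
  also have "Cmp (D_Sh X) ?A ?A' (FOb (D_proj_inv X) ?B') \<dots> (FMor (D_inv_im X f) F F' v) =
      FMor (D_inv_im X f) F (FOb (D_proj_inv Y) ?B')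
        (Cmp (D_Sh Y) F F' (FOb (D_proj_inv Y) ?B') (Adj LY F' ?B' (Idn D_Ab ?B')) v)"
    using FMor_Cmp[OF is_functor_D_inv_im[OF f] F FOb_in_Ob[OF is_functor_D_proj_inv B(2)] v
        Adj_in_Mor[OF LY F(2) B(2) Id]]
    by (simp add: D_inv_im_proj_inv[OF f] B(2))
  also have "Cmp (D_Sh Y) F F' (FOb (D_proj_inv Y) ?B') (Adj LY F' ?B' (Idn D_Ab ?B')) v =
      Adj LY F ?B' (Cmp D_Ab ?B ?B' ?B' (Idn D_Ab ?B') (FMor LY F F' v))"
    by (rule Adj_natural_left[OF LY F B(2) v Id, symmetric])
  also have "Cmp D_Ab ?B ?B' ?B' (Idn D_Ab ?B') (FMor LY F F' v) = FMor LY F F' v"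
    by (rule Cmp_Idn_left[OF cat B Lv])
  also have "FMor (D_inv_im X f) F (FOb (D_proj_inv Y) ?B') (Adj LY F ?B' (FMor LY F F' v)) = Adj LX ?A ?B' ?l"
    by (rule Adj_pushforward[OF F(1) B(2) Lv, symmetric])
  finally have "Adj LX ?A ?B' ?l = Adj LX ?A ?B' ?r" by simp
  then show ?thesis
    by (rule Adj_inject[OF LX A(1) B(2) Cmp_in_Mor[OF cat LA(1) B p(1) Lv] Cmp_in_Mor[OF cat LA B(2) Lw p(2)]])
qed

lemma homology_pushforward_in_hom:
  assumes F: "F \<in> Ob (D_Sh Y)"
  shows "homology_pushforward X Y f LX LY i F \<in> hom (homology LX i (FOb (D_inv_im X f) F)) (homology LY i F)"
  using FMor_in_Mor[OF is_functor_H_D homology_adjoint_FOb_in_Ob[OF LX D_inv_im_in_Ob[OF f F]] homology_adjoint_FOb_in_Ob[OF LY F]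
      pushforward_in_Mor[OF F]]
  by (simp add: homology_pushforward_def homology_def Mor_Ab)

end

section \<open>Naturality on homology, composition and identities\<close>

text \<open>Composition in \<open>Ab\<close> is cut off outside the carrier, so functoriality of
  cohomology is spelled out for elements of the carrier.\<close>

lemma FMor_H_D_Cmp:
  assumes "A \<in> Ob D_Ab" "B \<in> Ob D_Ab" "E \<in> Ob D_Ab" "u \<in> Mor D_Ab A B" "v \<in> Mor D_Ab B E"
    and "c \<in> carrier (FOb (H_D n) A)"
  shows "FMor (H_D n) A E (Cmp D_Ab A B E v u) c = FMor (H_D n) B E v (FMor (H_D n) A B u c)"
  using FMor_Cmp[OF is_functor_H_D assms(1-5)] assms(6) by (simp add: Cmp_Ab compose_eq)

lemma homology_pushforward_natural:
  assumes LX: "is_homology_adjoint X LX" and LY: "is_homology_adjoint Y LY" and f: "continuous_map X Y f"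
    and F: "F \<in> Ob (D_Sh Y)" "F' \<in> Ob (D_Sh Y)" and v: "v \<in> Mor (D_Sh Y) F F'"
    and c: "c \<in> carrier (homology LX i (FOb (D_inv_im X f) F))"
  shows "homology_map LY i F F' v (homology_pushforward X Y f LX LY i F c) =
    homology_pushforward X Y f LX LY i F' (homology_map LX i (FOb (D_inv_im X f) F)
      (FOb (D_inv_im X f) F') (FMor (D_inv_im X f) F F' v) c)"
proof -
  note A = F[THEN D_inv_im_in_Ob[OF f]] and B = F[THEN homology_adjoint_FOb_in_Ob[OF LY]]
  note LA = A[THEN homology_adjoint_FOb_in_Ob[OF LX]]
  note p = F[THEN pushforward_in_Mor[OF LX LY f]]
  note w = FMor_in_Mor[OF is_functor_D_inv_im[OF f] F v]
  note Lw = FMor_in_Mor[OF is_functor_homology_adjoint[OF LX] A w]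
  note Lv = FMor_in_Mor[OF is_functor_homology_adjoint[OF LY] F v]
  note c' = c[unfolded homology_def]
  show ?thesis
    unfolding homology_map_def homology_pushforward_def
    using FMor_H_D_Cmp[OF LA(1) B p(1) Lv c'] FMor_H_D_Cmp[OF LA B(2) Lw p(2) c']
    by (simp add: pushforward_natural[OF LX LY f F v])
qed

text \<open>The composite is tested against the defining property for every u. The property of f_*
  extracts f\<inverse>, that of g_* extracts g\<inverse>, and f\<inverse>g\<inverse> applied to the
  adjoint of u is its inverse image along g \<circ> f.\<close>

lemma pushforward_comp:
  assumes LX: "is_homology_adjoint X LX" and LY: "is_homology_adjoint Y LY" and LZ: "is_homology_adjoint Z LZ"
    and f: "continuous_map X Y f" and g: "continuous_map Y Z g" and F: "F \<in> Ob (D_Sh Z)"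
  shows "pushforward X Z (g \<circ> f) LX LZ F =
    Cmp D_Ab (FOb LX (FOb (D_inv_im X (g \<circ> f)) F)) (FOb LY (FOb (D_inv_im Y g) F)) (FOb LZ F)
      (pushforward Y Z g LY LZ F) (pushforward X Y f LX LY (FOb (D_inv_im Y g) F))" (is "_ = ?h")
proof -
  note cat = is_category_D_Ab
  note gf = continuous_map_compose[OF f g]
  let ?F' = "FOb (D_inv_im Y g) F" and ?F'' = "FOb (D_inv_im X (g \<circ> f)) F"
  have F': "?F' \<in> Ob (D_Sh Y)" by (rule D_inv_im_in_Ob[OF g F])
  have F'': "?F'' \<in> Ob (D_Sh X)" by (rule D_inv_im_in_Ob[OF gf F])
  note ob = homology_adjoint_FOb_in_Ob[OF LX F''] homology_adjoint_FOb_in_Ob[OF LY F'] homology_adjoint_FOb_in_Ob[OF LZ F]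
  \<comment> \<open>The source of f_* is L(X, f\<inverse>g\<inverse>F), which strictness rewrites as
    L(X, (g \<circ> f)\<inverse>F).\<close>
  have p: "pushforward X Y f LX LY ?F' \<in> Mor D_Ab (FOb LX ?F'') (FOb LY ?F')"
    using pushforward_in_Mor[OF LX LY f F'] by (simp add: D_inv_im_comp[OF f g F])
  note q = pushforward_in_Mor[OF LY LZ g F]
  have h: "?h \<in> Mor D_Ab (FOb LX ?F'') (FOb LZ F)" by (rule Cmp_in_Mor[OF cat ob p q])
  have "Adj LX ?F'' G (Cmp D_Ab (FOb LX ?F'') (FOb LZ F) G u ?h) =
      FMor (D_inv_im X (g \<circ> f)) F (FOb (D_proj_inv Z) G) (Adj LZ F G u)"
    if G: "G \<in> Ob D_Ab" and u: "u \<in> Mor D_Ab (FOb LZ F) G" for G u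
  proof -
    let ?w = "Cmp D_Ab (FOb LY ?F') (FOb LZ F) G u (pushforward Y Z g LY LZ F)"
    have w: "?w \<in> Mor D_Ab (FOb LY ?F') G" by (rule Cmp_in_Mor[OF cat ob(2,3) G q u])
    have "Adj LX ?F'' G (Cmp D_Ab (FOb LX ?F'') (FOb LZ F) G u ?h) =
        Adj LX ?F'' G (Cmp D_Ab (FOb LX ?F'') (FOb LY ?F') G ?w (pushforward X Y f LX LY ?F'))"
      by (subst Cmp_assoc[OF cat ob G p q u]) simp
    also have "\<dots> = FMor (D_inv_im X f) ?F' (FOb (D_proj_inv Y) G) (Adj LY ?F' G ?w)"
      using Adj_pushforward[OF LX LY f F' G w] by (simp add: D_inv_im_comp[OF f g F])
    also have "Adj LY ?F' G ?w = FMor (D_inv_im Y g) F (FOb (D_proj_inv Z) G) (Adj LZ F G u)"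
      by (rule Adj_pushforward[OF LY LZ g F G u])
    also have "FMor (D_inv_im X f) ?F' (FOb (D_proj_inv Y) G) \<dots> =
        FMor (D_inv_im X (g \<circ> f)) F (FOb (D_proj_inv Z) G) (Adj LZ F G u)"
      using D_inv_im_comp(2)[OF f g F FOb_in_Ob[OF is_functor_D_proj_inv G] Adj_in_Mor[OF LZ F G u]]
      by (simp add: D_inv_im_proj_inv[OF g] G)
    finally show ?thesis .
  qed
  with h have "is_pushforward X Z (g \<circ> f) LX LZ F ?h" by (simp add: is_pushforward_def)
  then show ?thesis by (rule pushforward_eqI[OF LX LZ gf F])
qed

lemma homology_pushforward_comp:
  assumes LX: "is_homology_adjoint X LX" and LY: "is_homology_adjoint Y LY" and LZ: "is_homology_adjoint Z LZ"
    and f: "continuous_map X Y f" and g: "continuous_map Y Z g" and F: "F \<in> Ob (D_Sh Z)"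
    and c: "c \<in> carrier (homology LX i (FOb (D_inv_im X (g \<circ> f)) F))"
  shows "homology_pushforward X Z (g \<circ> f) LX LZ i F c =
    homology_pushforward Y Z g LY LZ i F (homology_pushforward X Y f LX LY i (FOb (D_inv_im Y g) F) c)"
proof -
  note F' = D_inv_im_in_Ob[OF g F] and F'' = D_inv_im_in_Ob[OF continuous_map_compose[OF f g] F]
  have p: "pushforward X Y f LX LY (FOb (D_inv_im Y g) F) \<in>
      Mor D_Ab (FOb LX (FOb (D_inv_im X (g \<circ> f)) F)) (FOb LY (FOb (D_inv_im Y g) F))"
    using pushforward_in_Mor[OF LX LY f F'] by (simp add: D_inv_im_comp[OF f g F])
  show ?thesis
    unfolding homology_pushforward_def pushforward_comp[OF LX LY LZ f g F] D_inv_im_comp(1)[OF f g F]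
    by (rule FMor_H_D_Cmp[OF homology_adjoint_FOb_in_Ob[OF LX F''] homology_adjoint_FOb_in_Ob[OF LY F'] homology_adjoint_FOb_in_Ob[OF LZ F] p
          pushforward_in_Mor[OF LY LZ g F] c[unfolded homology_def]])
qed

text \<open>As the inverse image along the identity fixes objects and morphisms, the defining
  property only asks that u composed with the identity have the same adjoint as u.\<close>

lemma pushforward_id:
  assumes L: "is_homology_adjoint X L" and F: "F \<in> Ob (D_Sh X)"
  shows "pushforward X X id L L F = Idn D_Ab (FOb L F)"
proof (rule pushforward_eqI[OF L L continuous_map_id F])
  note LF = homology_adjoint_FOb_in_Ob[OF L F]
  show "is_pushforward X X id L L F (Idn D_Ab (FOb L F))"
    using F LF unfolding is_pushforward_def
    by (simp add: D_inv_im_id Idn_in_Mor[OF is_category_D_Ab] Cmp_Idn_right[OF is_category_D_Ab]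
        Adj_in_Mor[OF L] FOb_in_Ob[OF is_functor_D_proj_inv])
qed

lemma homology_pushforward_id:
  assumes L: "is_homology_adjoint X L" and F: "F \<in> Ob (D_Sh X)" and c: "c \<in> carrier (homology L i F)"
  shows "homology_pushforward X X id L L i F c = c"
  using c FMor_Idn[OF is_functor_H_D homology_adjoint_FOb_in_Ob[OF L F]]
  by (simp add: homology_pushforward_def homology_def pushforward_id[OF L F] D_inv_im_id(1)[OF F] Idn_Ab)

text \<open>Unique existence is stated together with membership, since \<open>pushforward\<close> is
  a definite description. The equalities of objects are included because they make the composites
  meaningful, and the laws on homology are stated for elements of the carrier, where extensional
  maps are compared.\<close>

theorem proposition2p14:
  fixes X :: "'a topology" and Y :: "'b topology" and f :: "'a \<Rightarrow> 'b"
    and LX :: "('a, 'u) hladj" and LY :: "('b, 'u) hladj"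
  assumes "locally_connected_space X" and "is_homology_adjoint X LX"
    and "locally_connected_space Y" and "is_homology_adjoint Y LY"
    and "continuous_map X Y f"
  shows
    "(\<forall>G\<in>Ob (D_Ab :: ('u dab_obj, 'u dab_mor) category).
        FOb (D_inv_im X f) (FOb (D_proj_inv Y) G) = FOb (D_proj_inv X) G) \<and>
     (\<forall>F\<in>Ob (D_Sh Y).
        (\<exists>!h. is_pushforward X Y f LX LY F h) \<and>
        pushforward X Y f LX LY F \<in> Mor D_Ab (FOb LX (FOb (D_inv_im X f) F)) (FOb LY F) \<and>
        (\<forall>i. homology_pushforward X Y f LX LY i F
               \<in> hom (homology LX i (FOb (D_inv_im X f) F)) (homology LY i F))) \<and>
     (\<forall>F\<in>Ob (D_Sh Y). \<forall>F'\<in>Ob (D_Sh Y). \<forall>v\<in>Mor (D_Sh Y) F F'.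
        Cmp D_Ab (FOb LX (FOb (D_inv_im X f) F)) (FOb LY F) (FOb LY F')
          (FMor LY F F' v) (pushforward X Y f LX LY F) =
        Cmp D_Ab (FOb LX (FOb (D_inv_im X f) F)) (FOb LX (FOb (D_inv_im X f) F')) (FOb LY F')
          (pushforward X Y f LX LY F')
          (FMor LX (FOb (D_inv_im X f) F) (FOb (D_inv_im X f) F') (FMor (D_inv_im X f) F F' v)) \<and>
        (\<forall>i. \<forall>c\<in>carrier (homology LX i (FOb (D_inv_im X f) F)).
           homology_map LY i F F' v (homology_pushforward X Y f LX LY i F c) =
           homology_pushforward X Y f LX LY i F'
             (homology_map LX i (FOb (D_inv_im X f) F) (FOb (D_inv_im X f) F')
               (FMor (D_inv_im X f) F F' v) c))) \<and>
     (\<forall>(Z :: 'c topology) (g :: 'b \<Rightarrow> 'c) (LZ :: ('c, 'u) hladj).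
        locally_connected_space Z \<and> is_homology_adjoint Z LZ \<and> continuous_map Y Z g \<longrightarrow>
        (\<forall>F\<in>Ob (D_Sh Z).
           FOb (D_inv_im X f) (FOb (D_inv_im Y g) F) = FOb (D_inv_im X (g \<circ> f)) F \<and>
           pushforward X Z (g \<circ> f) LX LZ F =
           Cmp D_Ab (FOb LX (FOb (D_inv_im X (g \<circ> f)) F)) (FOb LY (FOb (D_inv_im Y g) F)) (FOb LZ F)
             (pushforward Y Z g LY LZ F) (pushforward X Y f LX LY (FOb (D_inv_im Y g) F)) \<and>
           (\<forall>i. \<forall>c\<in>carrier (homology LX i (FOb (D_inv_im X (g \<circ> f)) F)).
              homology_pushforward X Z (g \<circ> f) LX LZ i F c =
              homology_pushforward Y Z g LY LZ i F
                (homology_pushforward X Y f LX LY i (FOb (D_inv_im Y g) F) c)))) \<and>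
     (\<forall>F\<in>Ob (D_Sh X).
        FOb (D_inv_im X id) F = F \<and>
        pushforward X X id LX LX F = Idn D_Ab (FOb LX F) \<and>
        (\<forall>i. \<forall>c\<in>carrier (homology LX i F). homology_pushforward X X id LX LX i F c = c))"
proof -
  note LX = assms(2) and LY = assms(4) and f = assms(5)
  note thms = D_inv_im_proj_inv(1)[OF f] ex1_is_pushforward[OF LX LY f] pushforward_in_Mor[OF LX LY f]
    homology_pushforward_in_hom[OF LX LY f] pushforward_natural[OF LX LY f]
    homology_pushforward_natural[OF LX LY f] D_inv_im_comp(1)[OF f] pushforward_comp[OF LX LY _ f]
    homology_pushforward_comp[OF LX LY _ f] D_inv_im_id(1) pushforward_id[OF LX] homology_pushforward_id[OF LX]
  show ?thesis
    by (intro conjI ballI allI impI; (elim conjE)?; rule thms; assumption)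
qed

end
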